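(* Let $\Omega\subset\mathbb{R}^N$ be a domain, let $\mathscr{A}$ be an $N\times N$ matrix function on $\Omega$ with complex valued entries in $L^\infty(\Omega)$, let $\varphi:(0,+\infty)\to(0,+\infty)$ satisfy conditions (i)--(v) of the context, let $\Lambda$ be the associated function defined in the context, and let $Eu=\nabla(\mathscr{A}\nabla u)$. The operator $E$ is $L^\Phi$-dissipative if and only if $$\operatorname{Re}\int_\Omega\Big[\langle\mathscr{A}\nabla v,\nabla v\rangle+\Lambda(|v|)\,\langle(\mathscr{A}-\mathscr{A}^* )\nabla|v|,\,|v|^{-1}\overline{v}\,\nabla v\rangle-\Lambda^2(|v|)\,\langle\mathscr{A}\nabla|v|,\nabla|v|\rangle\Big]dx\geq0$$ for all $v\in\mathring{H}^1(\Omega)$, where the integrand is extended by zero on the set where $v$ vanishes.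
   Context: Conditions on the positive function $\varphi$ on $(0,+\infty)$: (i) $\varphi\in C^1((0,+\infty))$; (ii) $(s\varphi(s))'>0$ for any $s>0$; (iii) the range of the strictly increasing function $s\mapsto s\varphi(s)$ is $(0,+\infty)$; (iv) there exist positive constants $C_1,C_2$, a real number $r>-1$ and $s_0>0$ such that $C_1 s^r\leq (s\varphi(s))'\leq C_2 s^r$ for $s\in(0,s_0)$; if $r=0$ it is moreover required that the finite limit $\lim_{s\to0^+}\varphi(s)=\varphi_+(0)>0$ exists and that $\lim_{s\to0^+}s\varphi'(s)=0$; (v) there exists $s_1>s_0$ such that either $\varphi'(s)\geq0$ for all $s\geq s_1$, or $\varphi'(s)\leq0$ for all $s\geq s_1$. The function $s\mapsto s\sqrt{\varphi(s)}$ is strictly increasing with range $(0,+\infty)$; let $\zeta(t)$ be its inverse, which is $C^1$ on $(0,+\infty)$. Define, for $t>0$, $\Theta(t)=\zeta(t)/t$ and $\Lambda(t)=t\,\Theta'(t)/\Theta(t)$. Notation: $\mathscr{A}^*=\overline{\mathscr{A}}^{t}$ is the adjoint matrix. $\langle\cdot,\cdot\rangle$ is the standard inner product in $\mathbb{C}^N$ (conjugate linear in the second argument). $\mathring{H}^1(\Omega)$ is the closure of the complex valued functions in $C_0^\infty(\Omega)$ in the $H^1$ norm; its elements are complex valued. The combination $\varphi(|u|)u$ is taken to be $0$ where $u$ vanishes. Definition: with $\Phi(s)=\int_0^s\sigma\varphi(\sigma)\,d\sigma$, the operator $E$ is called $L^\Phi$-dissipative if $$\operatorname{Re}\int_\Omega\langle\mathscr{A}\nabla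 u,\nabla(\varphi(|u|)\,u)\rangle\,dx\geq0$$ for any complex valued $u\in\mathring{H}^1(\Omega)$ such that $\varphi(|u|)\,u\in\mathring{H}^1(\Omega)$. *)

theory Defs
  imports "HOL-Analysis.Analysis"
begin

definition domain :: "(real^'n) set \<Rightarrow> bool" where
  "domain \<Omega> \<longleftrightarrow> open \<Omega> \<and> connected \<Omega> \<and> \<Omega> \<noteq> {}"

definition herm_inner :: "complex^'n \<Rightarrow> complex^'n \<Rightarrow> complex" where
  "herm_inner a b = (\<Sum>i\<in>UNIV. a $ i * cnj (b $ i))"

definition adjoint_matrix :: "complex^'n^'m \<Rightarrow> complex^'m^'n" where
  "adjoint_matrix A = map_matrix cnj (transpose A)"

definition L2 :: "(real^'n) set \<Rightarrow> (real^'n \<Rightarrow> 'b::euclidean_space) set" where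
  "L2 \<Omega> = {f. f \<in> borel_measurable (lebesgue_on \<Omega>) \<and>
               integrable (lebesgue_on \<Omega>) (\<lambda>x. (norm (f x))\<^sup>2)}"

definition Linfty :: "(real^'n) set \<Rightarrow> (real^'n \<Rightarrow> 'b::euclidean_space) set" where
  "Linfty \<Omega> = {f. f \<in> borel_measurable (lebesgue_on \<Omega>) \<and>
                   (\<exists>C. AE x in lebesgue_on \<Omega>. norm (f x) \<le> C)}"

definition locally_integrable :: "(real^'n) set \<Rightarrow> (real^'n \<Rightarrow> 'b::euclidean_space) \<Rightarrow> bool" where
  "locally_integrable \<Omega> f \<longleftrightarrow> (\<forall>K. compact K \<and> K \<subseteq> \<Omega> \<longrightarrow> f absolutely_integrable_on K)"

definition partial_deriv :: "'n \<Rightarrow> (real^'n \<Rightarrow> complex) \<Rightarrow> real^'n \<Rightarrow> complex" where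
  "partial_deriv i f x = frechet_derivative f (at x) (axis i 1)"

text \<open>A function is \<open>C\<^sup>\<infinity>\<close> iff all its iterated partial derivatives exist and are
  Frechet differentiable; their continuity then follows.\<close>

definition smooth :: "(real^'n \<Rightarrow> complex) \<Rightarrow> bool" where
  "smooth f \<longleftrightarrow> (\<forall>js. foldr partial_deriv js f differentiable_on UNIV)"

definition test_functions :: "(real^'n) set \<Rightarrow> (real^'n \<Rightarrow> complex) set" where
  "test_functions \<Omega> =
     {\<psi>. smooth \<psi> \<and> compact (closure {x. \<psi> x \<noteq> 0}) \<and> closure {x. \<psi> x \<noteq> 0} \<subseteq> \<Omega>}"

definition has_weak_gradient ::
    "(real^'n) set \<Rightarrow> (real^'n \<Rightarrow> complex) \<Rightarrow> (real^'n \<Rightarrow> complex^'n) \<Rightarrow> bool" where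
  "has_weak_gradient \<Omega> u G \<longleftrightarrow>
     locally_integrable \<Omega> u \<and> locally_integrable \<Omega> G \<and>
     (\<forall>\<psi>\<in>test_functions \<Omega>. \<forall>i.
        (LINT x|lebesgue_on \<Omega>. u x * partial_deriv i \<psi> x) =
        - (LINT x|lebesgue_on \<Omega>. G x $ i * \<psi> x))"

text \<open>Functions stand for their almost-everywhere classes. On an open set the weak gradient is
  unique up to null sets, so the choice of representative below does not affect any integral.\<close>

definition weak_grad :: "(real^'n) set \<Rightarrow> (real^'n \<Rightarrow> complex) \<Rightarrow> real^'n \<Rightarrow> complex^'n" where
  "weak_grad \<Omega> u = (SOME G. has_weak_gradient \<Omega> u G)"

definition H1 :: "(real^'n) set \<Rightarrow> (real^'n \<Rightarrow> complex) set" where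
  "H1 \<Omega> = {u \<in> L2 \<Omega>. \<exists>G\<in>L2 \<Omega>. has_weak_gradient \<Omega> u G}"

definition H1_norm :: "(real^'n) set \<Rightarrow> (real^'n \<Rightarrow> complex) \<Rightarrow> real" where
  "H1_norm \<Omega> u =
     sqrt (LINT x|lebesgue_on \<Omega>. (norm (u x))\<^sup>2 + (norm (weak_grad \<Omega> u x))\<^sup>2)"

definition H10 :: "(real^'n) set \<Rightarrow> (real^'n \<Rightarrow> complex) set" where
  "H10 \<Omega> = {u \<in> H1 \<Omega>. \<forall>\<epsilon>>0. \<exists>\<psi>\<in>test_functions \<Omega>. H1_norm \<Omega> (\<lambda>x. u x - \<psi> x) < \<epsilon>}"

text \<open>Only the values of \<open>\<phi>\<close> on \<open>{0<..}\<close> matter here and below. The last two conditions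
  share the number \<open>s0\<close>.\<close>

definition phi_conditions :: "(real \<Rightarrow> real) \<Rightarrow> bool" where
  "phi_conditions \<phi> \<longleftrightarrow>
     (\<forall>s>0. \<phi> s > 0) \<and>
     \<phi> C1_differentiable_on {0<..} \<and>
     (\<forall>s>0. deriv (\<lambda>s. s * \<phi> s) s > 0) \<and>
     (\<lambda>s. s * \<phi> s) ` {0<..} = {0<..} \<and>
     (\<exists>C1 C2 r s0. C1 > 0 \<and> C2 > 0 \<and> r > -1 \<and> s0 > 0 \<and>
        (\<forall>s\<in>{0<..<s0}. C1 * s powr r \<le> deriv (\<lambda>s. s * \<phi> s) s \<and>
                         deriv (\<lambda>s. s * \<phi> s) s \<le> C2 * s powr r) \<and>
        (r = 0 \<longrightarrow> (\<exists>\<phi>0>0. (\<phi> \<longlongrightarrow> \<phi>0) (at_right 0)) \<and>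
                    ((\<lambda>s. s * deriv \<phi> s) \<longlongrightarrow> 0) (at_right 0)) \<and>
        (\<exists>s1>s0. (\<forall>s\<ge>s1. deriv \<phi> s \<ge> 0) \<or> (\<forall>s\<ge>s1. deriv \<phi> s \<le> 0)))"

definition zeta :: "(real \<Rightarrow> real) \<Rightarrow> real \<Rightarrow> real" where
  "zeta \<phi> = inv_into {0<..} (\<lambda>s. s * sqrt (\<phi> s))"

definition Theta :: "(real \<Rightarrow> real) \<Rightarrow> real \<Rightarrow> real" where
  "Theta \<phi> t = zeta \<phi> t / t"

definition Lambda :: "(real \<Rightarrow> real) \<Rightarrow> real \<Rightarrow> real" where
  "Lambda \<phi> t = t * deriv (Theta \<phi>) t / Theta \<phi> t"

definition phi_mult :: "(real \<Rightarrow> real) \<Rightarrow> (real^'n \<Rightarrow> complex) \<Rightarrow> real^'n \<Rightarrow> complex" where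
  "phi_mult \<phi> u x = (if u x = 0 then 0 else complex_of_real (\<phi> (cmod (u x))) * u x)"

text \<open>The operator \<open>E u = div (A \<nabla>u)\<close> enters through its coefficient matrix \<open>A\<close>, and
  \<open>\<Phi> s = \<integral>\<^sub>0\<^sup>s \<sigma> \<phi>(\<sigma>) d\<sigma>\<close> through its density \<open>\<phi>\<close>. For \<open>A\<close> with bounded measurable
  entries the integrand is integrable, so the integral never takes its default value.\<close>

definition L_Phi_dissipative ::
    "(real^'n) set \<Rightarrow> (real^'n \<Rightarrow> complex^'n^'n) \<Rightarrow> (real \<Rightarrow> real) \<Rightarrow> bool" where
  "L_Phi_dissipative \<Omega> A \<phi> \<longleftrightarrow>
     (\<forall>u\<in>H10 \<Omega>. phi_mult \<phi> u \<in> H10 \<Omega> \<longrightarrow>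
        Re (LINT x|lebesgue_on \<Omega>.
              herm_inner (A x *v weak_grad \<Omega> u x) (weak_grad \<Omega> (phi_mult \<phi> u) x)) \<ge> 0)"

text \<open>Integrability also holds here, since \<open>Lambda \<phi>\<close> takes values in \<open>{-1<..<1}\<close> on
  \<open>{0<..}\<close> under \<open>phi_conditions \<phi>\<close>: with \<open>t = s * sqrt (\<phi> s)\<close> and
  \<open>q = s * deriv \<phi> s / \<phi> s > -1\<close> one has \<open>Lambda \<phi> t = - q / (q + 2)\<close>.\<close>

definition Lambda_integrand ::
    "(real^'n) set \<Rightarrow> (real^'n \<Rightarrow> complex^'n^'n) \<Rightarrow> (real \<Rightarrow> real) \<Rightarrow>
     (real^'n \<Rightarrow> complex) \<Rightarrow> real^'n \<Rightarrow> complex" where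
  "Lambda_integrand \<Omega> A \<phi> v x =
     (if v x = 0 then 0 else
        (let gv = weak_grad \<Omega> v x;
             gm = weak_grad \<Omega> (\<lambda>y. complex_of_real (cmod (v y))) x;
             l = complex_of_real (Lambda \<phi> (cmod (v x)))
         in herm_inner (A x *v gv) gv
            + l * herm_inner ((A x - adjoint_matrix (A x)) *v gm)
                    ((cnj (v x) / complex_of_real (cmod (v x))) *s gv)
            - l\<^sup>2 * herm_inner (A x *v gm) gm))"

end

theory Submission
  imports Defs
begin

text \<open>With $v = \sqrt{\varphi(|u|)}\,u$ one has $u = \Theta(|v|) v$ and
  $\varphi(|u|) u = v / \Theta(|v|)$, and the real parts of the two integrands agree pointwise almost everywhere.

  To see that the substitution stays in the Sobolev space, all functions are written as radial
  functions $f(|w|)\, w/|w|$ of $w = u + \varphi(|u|) u$. As functions of $m = |w|$ both $|u|$ and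
  $\varphi(|u|)|u|$ are increasing with derivatives summing to 1, hence Lipschitz, and $|v|$ is their
  geometric mean. It is Lipschitz too because, with $p = (s\varphi)'/\varphi$, conditions (iv) and (v)
  make $(1+p)(1+\varphi)/(1+p\varphi)$ bounded on the whole half-line.

  Conversely, for an arbitrary $v$ one replaces $m(|v|)$ by the harmonic type mean
  $m_k = (1/m(|v|) + 1/(k|v|) + 1/k)^{-1}$, which is Lipschitz in $|v|$. The same bound on $p$ and
  $\varphi$ then dominates the integrands of the corresponding functions $u_k$ uniformly in $k$.\<close>

section \<open>Square integrable functions\<close>

text \<open>The conditions on \<open>\<phi>\<close> act through the elasticity
  \<open>p = s * b' / b\<close> of \<open>b s = s * \<phi> s\<close>. The quotient in the overview
  can blow up only where one of \<open>p\<close> and \<open>\<phi>\<close> is large while the other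
  is small. Condition (iv) keeps \<open>p\<close> between positive constants near zero; the
  monotonicity in (v) fixes on which side of 1 \<open>p\<close> lies far out, and bounds
  \<open>\<phi>\<close> on the side that this requires. The obstacle is that \<open>\<phi>\<close>
  may degenerate or blow up at both ends, so neither the map from |u| to |v| nor its inverse need be
  Lipschitz. Given \<open>u\<close>, both \<open>u\<close> and its multiple lie in the space, so
  their sum is a safe variable. Given only \<open>v\<close>, no such second function is at hand, and
  approximations take its place. A harmonic type mean is preferred to a minimum because it remains
  continuously differentiable and because its logarithmic derivative is an average of those of its
  members, hence bounded uniformly in k. The pointwise identity becomes visible once gradients are
  divided by the common phase: radial functions then act diagonally, with one factor on the real
  part and another on the imaginary part.\<close>

lemma L2_measurable: "f \<in> L2 \<Omega> \<Longrightarrow> f \<in> borel_measurable (lebesgue_on \<Omega>)"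
  by (simp add: L2_def)

lemma L2_integrable: "f \<in> L2 \<Omega> \<Longrightarrow> integrable (lebesgue_on \<Omega>) (\<lambda>x. (norm (f x))\<^sup>2)"
  by (simp add: L2_def)

lemma norm_add_sq_le: "(norm (a + b))\<^sup>2 \<le> 2 * (norm a)\<^sup>2 + 2 * (norm (b::'a::real_normed_vector))\<^sup>2"
proof -
  have "(norm (a + b))\<^sup>2 \<le> (norm a + norm b)\<^sup>2"
    by (intro power_mono norm_triangle_ineq norm_ge_zero)
  also have "\<dots> \<le> 2 * (norm a)\<^sup>2 + 2 * (norm b)\<^sup>2"
    using sum_squares_bound[of "norm a" "norm b"] by (simp add: power2_sum)
  finally show ?thesis .
qed

lemma norm_diff_sq_le:
  "(norm (a - c))\<^sup>2 \<le> 2 * (norm (a - b))\<^sup>2 + 2 * (norm (b - c :: 'a::real_normed_vector))\<^sup>2"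
  using norm_add_sq_le[of "a - b" "b - c"] by simp

lemma norm_mult_le_sq: "a * b \<le> a\<^sup>2 + (b::real)\<^sup>2"
proof -
  have "a * b \<le> \<bar>a * b\<bar>" by simp
  also have "\<bar>a * b\<bar> \<le> a\<^sup>2 + b\<^sup>2"
    using sum_squares_bound[of "\<bar>a\<bar>" "\<bar>b\<bar>"] mult_nonneg_nonneg[OF abs_ge_zero[of a] abs_ge_zero[of b]]
    unfolding abs_mult power2_abs by linarith
  finally show ?thesis .
qed

lemma L2_bound:
  assumes f: "f \<in> L2 \<Omega>" and g: "g \<in> borel_measurable (lebesgue_on \<Omega>)"
    and le: "AE x in lebesgue_on \<Omega>. norm (g x) \<le> C * norm (f x)"
  shows "g \<in> L2 \<Omega>"
proof -
  have "integrable (lebesgue_on \<Omega>) (\<lambda>x. C\<^sup>2 * (norm (f x))\<^sup>2)"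
    using L2_integrable[OF f] by simp
  then have "integrable (lebesgue_on \<Omega>) (\<lambda>x. (norm (g x))\<^sup>2)"
  proof (rule Bochner_Integration.integrable_bound)
    show "(\<lambda>x. (norm (g x))\<^sup>2) \<in> borel_measurable (lebesgue_on \<Omega>)" using g by measurable
    show "AE x in lebesgue_on \<Omega>. norm ((norm (g x))\<^sup>2) \<le> norm (C\<^sup>2 * (norm (f x))\<^sup>2)"
      using le
    proof eventually_elim
      case (elim x)
      have "(norm (g x))\<^sup>2 \<le> (C * norm (f x))\<^sup>2"
        using elim by (intro power_mono) auto
      then show ?case by (simp add: power_mult_distrib)
    qed
  qed
  with g show ?thesis by (simp add: L2_def)
qed

lemma L2_add:
  assumes f: "f \<in> L2 \<Omega>" and g: "g \<in> L2 \<Omega>"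
  shows "(\<lambda>x. f x + g x) \<in> L2 \<Omega>"
proof -
  note [measurable] = L2_measurable[OF f] L2_measurable[OF g]
  have "integrable (lebesgue_on \<Omega>) (\<lambda>x. 2 * (norm (f x))\<^sup>2 + 2 * (norm (g x))\<^sup>2)"
    using L2_integrable[OF f] L2_integrable[OF g] by simp
  then have "integrable (lebesgue_on \<Omega>) (\<lambda>x. (norm (f x + g x))\<^sup>2)"
    by (rule Bochner_Integration.integrable_bound) (measurable, simp add: norm_add_sq_le)
  then show ?thesis by (simp add: L2_def)
qed

lemma L2_uminus: "f \<in> L2 \<Omega> \<Longrightarrow> (\<lambda>x. - f x) \<in> L2 \<Omega>"
  by (simp add: L2_def)

lemma L2_diff: "f \<in> L2 \<Omega> \<Longrightarrow> g \<in> L2 \<Omega> \<Longrightarrow> (\<lambda>x. f x - g x) \<in> L2 \<Omega>"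
  using L2_add[OF _ L2_uminus, of f \<Omega> g] by simp

lemma L2_AE_cong_measurable:
  assumes "f \<in> L2 \<Omega>" "g \<in> borel_measurable (lebesgue_on \<Omega>)" "AE x in lebesgue_on \<Omega>. g x = f x"
  shows "g \<in> L2 \<Omega>"
  using assms(3) by (intro L2_bound[OF assms(1,2), of 1]) auto

lemma L2_Pair_iff:
  fixes f :: "real^'n \<Rightarrow> 'a::euclidean_space" and g :: "real^'n \<Rightarrow> 'b::euclidean_space"
  shows "(\<lambda>x. (f x, g x)) \<in> L2 \<Omega> \<longleftrightarrow> f \<in> L2 \<Omega> \<and> g \<in> L2 \<Omega>"
proof
  assume *: "(\<lambda>x. (f x, g x)) \<in> L2 \<Omega>"
  have "(\<lambda>x. fst (f x, g x)) \<in> borel_measurable (lebesgue_on \<Omega>)"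
    by (rule measurable_compose[OF L2_measurable[OF *]]) (intro borel_measurable_continuous_onI continuous_intros)
  moreover have "(\<lambda>x. snd (f x, g x)) \<in> borel_measurable (lebesgue_on \<Omega>)"
    by (rule measurable_compose[OF L2_measurable[OF *]]) (intro borel_measurable_continuous_onI continuous_intros)
  ultimately show "f \<in> L2 \<Omega> \<and> g \<in> L2 \<Omega>"
    by (auto intro!: L2_bound[OF *, of _ 1] AE_I2 simp: norm_fst_le norm_snd_le)
next
  assume *: "f \<in> L2 \<Omega> \<and> g \<in> L2 \<Omega>"
  then have "integrable (lebesgue_on \<Omega>) (\<lambda>x. (norm (f x))\<^sup>2 + (norm (g x))\<^sup>2)"
    by (auto intro!: L2_integrable)
  moreover have "(\<lambda>x. (f x, g x)) \<in> borel_measurable (lebesgue_on \<Omega>)"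
    using * by (intro borel_measurable_Pair) (auto intro: L2_measurable)
  ultimately show "(\<lambda>x. (f x, g x)) \<in> L2 \<Omega>"
    by (simp add: L2_def norm_Pair)
qed

lemma integrable_L2_prod:
  assumes f: "f \<in> L2 \<Omega>" and g: "g \<in> L2 \<Omega>" and h: "h \<in> borel_measurable (lebesgue_on \<Omega>)"
    and le: "AE x in lebesgue_on \<Omega>. norm (h x :: 'c::{banach,second_countable_topology}) \<le> C * (norm (f x) * norm (g x))"
  shows "integrable (lebesgue_on \<Omega>) h"
proof -
  have "integrable (lebesgue_on \<Omega>) (\<lambda>x. \<bar>C\<bar> * ((norm (f x))\<^sup>2 + (norm (g x))\<^sup>2))"
    using L2_integrable[OF f] L2_integrable[OF g] by simp
  then show ?thesis
  proof (rule Bochner_Integration.integrable_bound[OF _ h])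
    show "AE x in lebesgue_on \<Omega>. norm (h x) \<le> norm (\<bar>C\<bar> * ((norm (f x))\<^sup>2 + (norm (g x))\<^sup>2))"
      using le
    proof eventually_elim
      case (elim x)
      have "C * (norm (f x) * norm (g x)) \<le> \<bar>C\<bar> * ((norm (f x))\<^sup>2 + (norm (g x))\<^sup>2)"
        by (rule mult_mono) (auto intro: norm_mult_le_sq)
      with elim show ?case by simp
    qed
  qed
qed

text \<open>One fixed square integrable \<open>g\<close> dominates, so the squared distances stay
  below \<open>4 * C\<^sup>2 * (norm (g x))\<^sup>2\<close>. Membership of the limit is a second
  conclusion, so the closure arguments below need no completeness of the space.\<close>

lemma L2_dominated_convergence:
  fixes U :: "real^'n \<Rightarrow> 'b::euclidean_space"
  assumes m: "\<And>n. V n \<in> borel_measurable (lebesgue_on \<Omega>)" "U \<in> borel_measurable (lebesgue_on \<Omega>)"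
    and g: "g \<in> L2 \<Omega>"
    and le: "\<And>n. AE x in lebesgue_on \<Omega>. norm (V n x) \<le> C * norm (g x)"
    and lim: "AE x in lebesgue_on \<Omega>. (\<lambda>n. V n x) \<longlonglongrightarrow> U x"
  shows "(\<lambda>n. LINT x|lebesgue_on \<Omega>. (norm (V n x - U x))\<^sup>2) \<longlonglongrightarrow> 0"
    and "U \<in> L2 \<Omega>"
proof -
  have le': "AE x in lebesgue_on \<Omega>. \<forall>n. norm (V n x) \<le> C * norm (g x)"
    using le by (simp add: AE_all_countable)
  have leU: "AE x in lebesgue_on \<Omega>. norm (U x) \<le> C * norm (g x)"
    using le' lim by eventually_elim (auto intro: Lim_norm_ubound[OF trivial_limit_sequentially])
  show "U \<in> L2 \<Omega>" by (rule L2_bound[OF g m(2) leU])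
  have "(\<lambda>n. LINT x|lebesgue_on \<Omega>. (norm (V n x - U x))\<^sup>2) \<longlonglongrightarrow> (LINT x|lebesgue_on \<Omega>. 0)"
  proof (rule integral_dominated_convergence)
    show "(\<lambda>x. (norm (V n x - U x))\<^sup>2) \<in> borel_measurable (lebesgue_on \<Omega>)" for n
      using m by measurable
    show "integrable (lebesgue_on \<Omega>) (\<lambda>x. 4 * C\<^sup>2 * (norm (g x))\<^sup>2)"
      using L2_integrable[OF g] by simp
    show "AE x in lebesgue_on \<Omega>. (\<lambda>n. (norm (V n x - U x))\<^sup>2) \<longlonglongrightarrow> 0"
      using lim by eventually_elim (auto intro!: tendsto_eq_intros dest: LIM_zero)
    show "AE x in lebesgue_on \<Omega>. norm ((norm (V n x - U x))\<^sup>2) \<le> 4 * C\<^sup>2 * (norm (g x))\<^sup>2" for n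
      using le[of n] leU
    proof eventually_elim
      case (elim x)
      have "norm (V n x - U x) \<le> 2 * (C * norm (g x))"
        using elim norm_triangle_ineq4[of "V n x" "U x"] by linarith
      then have "(norm (V n x - U x))\<^sup>2 \<le> (2 * (C * norm (g x)))\<^sup>2"
        by (intro power_mono) auto
      then show ?case by (simp add: power_mult_distrib)
    qed
  qed simp
  then show "(\<lambda>n. LINT x|lebesgue_on \<Omega>. (norm (V n x - U x))\<^sup>2) \<longlonglongrightarrow> 0" by simp
qed

text \<open>Squared distances replace norms throughout. The price is the factor 2, from which the
  quarters of \<open>\<epsilon>\<close> in the closure arguments come.\<close>

lemma L2_dist_triangle:
  assumes "f \<in> L2 \<Omega>" "g \<in> L2 \<Omega>" "h \<in> L2 \<Omega>"
  shows "(LINT x|lebesgue_on \<Omega>. (norm (f x - h x))\<^sup>2) \<le>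
    2 * (LINT x|lebesgue_on \<Omega>. (norm (f x - g x))\<^sup>2) + 2 * (LINT x|lebesgue_on \<Omega>. (norm (g x - h x))\<^sup>2)"
proof -
  note i = L2_integrable[OF L2_diff[OF assms(1,2)]] L2_integrable[OF L2_diff[OF assms(2,3)]] L2_integrable[OF L2_diff[OF assms(1,3)]]
  have "(LINT x|lebesgue_on \<Omega>. (norm (f x - h x))\<^sup>2) \<le>
    (LINT x|lebesgue_on \<Omega>. 2 * (norm (f x - g x))\<^sup>2 + 2 * (norm (g x - h x))\<^sup>2)"
    using i by (intro integral_mono) (auto intro: norm_diff_sq_le)
  also have "\<dots> = 2 * (LINT x|lebesgue_on \<Omega>. (norm (f x - g x))\<^sup>2) + 2 * (LINT x|lebesgue_on \<Omega>. (norm (g x - h x))\<^sup>2)"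
    using i by simp
  finally show ?thesis .
qed

lemma L2_AE_subseq:
  fixes U :: "real^'n \<Rightarrow> 'b::euclidean_space"
  assumes "\<And>n. V n \<in> L2 \<Omega>" "U \<in> L2 \<Omega>"
    and lim: "(\<lambda>n. LINT x|lebesgue_on \<Omega>. (norm (V n x - U x))\<^sup>2) \<longlonglongrightarrow> 0"
  obtains r where "strict_mono r" "AE x in lebesgue_on \<Omega>. (\<lambda>n. V (r n) x) \<longlonglongrightarrow> U x"
proof -
  have "\<exists>r. strict_mono r \<and> (AE x in lebesgue_on \<Omega>. (\<lambda>n. (norm (V (r n) x - U x))\<^sup>2) \<longlonglongrightarrow> 0)"
    by (rule tendsto_L1_AE_subseq) (use L2_integrable[OF L2_diff[OF assms(1,2)]] lim in auto)
  then obtain r where r: "strict_mono r" "AE x in lebesgue_on \<Omega>. (\<lambda>n. (norm (V (r n) x - U x))\<^sup>2) \<longlonglongrightarrow> 0"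
    by blast
  have "AE x in lebesgue_on \<Omega>. (\<lambda>n. V (r n) x) \<longlonglongrightarrow> U x"
    using r(2)
  proof eventually_elim
    case (elim x)
    then have "(\<lambda>n. sqrt ((norm (V (r n) x - U x))\<^sup>2)) \<longlonglongrightarrow> sqrt 0"
      by (rule tendsto_real_sqrt)
    then show ?case by (simp add: LIM_zero_iff tendsto_norm_zero_iff)
  qed
  with r(1) show ?thesis by (rule that)
qed

section \<open>Smooth functions and bump functions\<close>

lemma partial_deriv_eq:
  assumes "(f has_derivative f') (at x)"
  shows "partial_deriv i f x = f' (axis i 1)"
  using frechet_derivative_at[OF assms] by (simp add: partial_deriv_def)

text \<open>Differentiability counted by order instead of by lists of directions. The product rule
  produces sums of products of lower order, and an induction on the order with both factors
  arbitrary absorbs them.\<close>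

fun diff_times :: "nat \<Rightarrow> (real^'n \<Rightarrow> complex) \<Rightarrow> bool" where
  "diff_times 0 f \<longleftrightarrow> f differentiable_on UNIV"
| "diff_times (Suc n) f \<longleftrightarrow> f differentiable_on UNIV \<and> (\<forall>i. diff_times n (partial_deriv i f))"

lemma diff_times_SucD: "diff_times (Suc n) f \<Longrightarrow> diff_times n f"
  by (induction n arbitrary: f) auto

lemma smooth_iff_diff_times: "smooth f \<longleftrightarrow> (\<forall>n. diff_times n f)"
proof
  assume "smooth f"
  then show "\<forall>n. diff_times n f"
  proof (intro allI)
    fix n show "smooth f \<Longrightarrow> diff_times n f"
    proof (induction n arbitrary: f)
      case 0
      then show ?case by (simp add: smooth_def) (metis foldr.simps(1) id_apply)
    next
      case (Suc n)
      have "smooth (partial_deriv i f)" for i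
        unfolding smooth_def
      proof
        fix js
        \<comment> \<open>\<open>foldr\<close> applies the last entry of the list first, so the
          additional derivative is appended at the end.\<close>
        show "foldr partial_deriv js (partial_deriv i f) differentiable_on UNIV"
          using Suc.prems[unfolded smooth_def, rule_format, of "js @ [i]"] by simp
      qed
      moreover have "f differentiable_on UNIV"
        using Suc.prems[unfolded smooth_def, rule_format, of "[]"] by simp
      ultimately show ?case using Suc.IH by simp
    qed
  qed
next
  assume *: "\<forall>n. diff_times n f"
  have "diff_times (length js) f \<Longrightarrow> foldr partial_deriv js f differentiable_on UNIV" for js
    by (induction js arbitrary: f rule: rev_induct) auto
  with * show "smooth f" by (simp add: smooth_def)
qed

lemma smooth_partial_deriv: "smooth f \<Longrightarrow> smooth (partial_deriv i f)"
  unfolding smooth_iff_diff_times by (metis diff_times.simps(2))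

lemma smooth_differentiable: "smooth f \<Longrightarrow> f differentiable (at x)"
  using smooth_iff_diff_times[of f] by (metis UNIV_I diff_times.simps(1) differentiable_on_def)

lemma smooth_has_derivative: "smooth f \<Longrightarrow> (f has_derivative frechet_derivative f (at x)) (at x)"
  using smooth_differentiable frechet_derivative_works by blast

lemma smooth_continuous: "smooth f \<Longrightarrow> continuous_on UNIV f"
  using smooth_differentiable[of f]
  by (meson continuous_at_imp_continuous_on differentiable_imp_continuous_within)

text \<open>Spares all formulas for higher derivatives: it suffices to exhibit a family that
  contains the function and is closed under differentiation.\<close>

lemma smooth_coinduct:
  assumes "f \<in> S" "\<And>g. g \<in> S \<Longrightarrow> g differentiable_on UNIV"
    "\<And>g i. g \<in> S \<Longrightarrow> partial_deriv i g \<in> S"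
  shows "smooth f"
proof -
  have "g \<in> S \<Longrightarrow> diff_times n g" for n g
    by (induction n arbitrary: g) (auto simp: assms)
  with assms(1) show ?thesis by (simp add: smooth_iff_diff_times)
qed

lemma smooth_const: "smooth (\<lambda>x. c)"
proof (rule smooth_coinduct)
  show "(\<lambda>x. c) \<in> range (\<lambda>c x. c)" by blast
  show "g differentiable_on UNIV" if "g \<in> range (\<lambda>c x. c)" for g :: "real^'n \<Rightarrow> complex"
    using that by auto
  show "partial_deriv i g \<in> range (\<lambda>c x. c)" if "g \<in> range (\<lambda>c x. c)" for g :: "real^'n \<Rightarrow> complex" and i
  proof -
    from that obtain c where g: "g = (\<lambda>x. c)" by blast
    have "partial_deriv i g = (\<lambda>x. 0)"
      by (rule ext, subst partial_deriv_eq[where f' = "\<lambda>_. 0"]) (auto simp: g)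
    then show ?thesis by blast
  qed
qed

lemma differentiable_on_UNIV_D:
  "f differentiable_on UNIV \<Longrightarrow> (f has_derivative frechet_derivative f (at x)) (at x)"
  using frechet_derivative_works by (auto simp: differentiable_on_def)

section \<open>Algebraic operations on smooth functions\<close>

lemma partial_deriv_add:
  assumes "f differentiable_on UNIV" "g differentiable_on UNIV"
  shows "partial_deriv i (\<lambda>x. f x + g x) = (\<lambda>x. partial_deriv i f x + partial_deriv i g x)"
proof
  fix x
  show "partial_deriv i (\<lambda>x. f x + g x) x = partial_deriv i f x + partial_deriv i g x"
    by (subst partial_deriv_eq[OF has_derivative_add[OF assms[THEN differentiable_on_UNIV_D]]])
      (simp add: partial_deriv_def)
qed

lemma partial_deriv_mult:
  assumes "f differentiable_on UNIV" "g differentiable_on UNIV"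
  shows "partial_deriv i (\<lambda>x. f x * g x) = (\<lambda>x. f x * partial_deriv i g x + partial_deriv i f x * g x)"
proof
  fix x
  show "partial_deriv i (\<lambda>x. f x * g x) x = f x * partial_deriv i g x + partial_deriv i f x * g x"
    by (subst partial_deriv_eq[OF has_derivative_mult[OF assms[THEN differentiable_on_UNIV_D]]])
      (simp add: partial_deriv_def)
qed

lemma partial_deriv_cnj:
  assumes "f differentiable_on UNIV"
  shows "partial_deriv i (\<lambda>x. cnj (f x)) = (\<lambda>x. cnj (partial_deriv i f x))"
proof
  fix x
  show "partial_deriv i (\<lambda>x. cnj (f x)) x = cnj (partial_deriv i f x)"
    by (subst partial_deriv_eq[OF has_derivative_cnj[OF assms[THEN differentiable_on_UNIV_D]]])
      (simp add: partial_deriv_def)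
qed

lemma smooth_add:
  assumes "smooth f" "smooth g" shows "smooth (\<lambda>x. f x + g x)"
proof -
  have "diff_times n f \<Longrightarrow> diff_times n g \<Longrightarrow> diff_times n (\<lambda>x. f x + g x)" for n
    by (induction n arbitrary: f g) (auto simp: partial_deriv_add differentiable_on_add)
  with assms show ?thesis by (simp add: smooth_iff_diff_times)
qed

lemma smooth_mult:
  assumes "smooth f" "smooth g" shows "smooth (\<lambda>x. f x * g x)"
proof -
  have add: "diff_times n f \<Longrightarrow> diff_times n g \<Longrightarrow> diff_times n (\<lambda>x. f x + g x)" for n and f g :: "real^'n \<Rightarrow> complex"
    by (induction n arbitrary: f g) (auto simp: partial_deriv_add differentiable_on_add)
  have "diff_times n f \<Longrightarrow> diff_times n g \<Longrightarrow> diff_times n (\<lambda>x. f x * g x)" for n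
  proof (induction n arbitrary: f g)
    case 0 then show ?case by (auto simp: differentiable_on_mult)
  next
    case (Suc n)
    from Suc.prems have d: "f differentiable_on UNIV" "g differentiable_on UNIV" by auto
    have "diff_times n (partial_deriv i (\<lambda>x. f x * g x))" for i
      unfolding partial_deriv_mult[OF d]
      using Suc.prems Suc.prems[THEN diff_times_SucD] by (intro add Suc.IH) auto
    then show ?case using d by (simp add: differentiable_on_mult)
  qed
  with assms show ?thesis by (simp add: smooth_iff_diff_times)
qed

lemma smooth_cnj:
  assumes "smooth f" shows "smooth (\<lambda>x. cnj (f x))"
proof -
  have "diff_times n f \<Longrightarrow> diff_times n (\<lambda>x. cnj (f x))" for n
  proof (induction n arbitrary: f)
    case 0 then show ?case
      by (auto simp: differentiable_on_def intro!: differentiable_compose[OF bounded_linear_imp_differentiable[OF bounded_linear_cnj]])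
  next
    case (Suc n)
    then have "(\<lambda>x. cnj (f x)) differentiable_on UNIV"
      by (auto simp: differentiable_on_def intro!: differentiable_compose[OF bounded_linear_imp_differentiable[OF bounded_linear_cnj]])
    with Suc show ?case by (simp add: partial_deriv_cnj)
  qed
  with assms show ?thesis by (simp add: smooth_iff_diff_times)
qed

lemma smooth_sum: "(\<And>i. i \<in> I \<Longrightarrow> smooth (f i)) \<Longrightarrow> smooth (\<lambda>x. \<Sum>i\<in>I. f i x)"
  by (induction I rule: infinite_finite_induct) (auto intro: smooth_const smooth_add)

lemma smooth_prod: "(\<And>i. i \<in> I \<Longrightarrow> smooth (f i)) \<Longrightarrow> smooth (\<lambda>x. \<Prod>i\<in>I. f i x)"
  by (induction I rule: infinite_finite_induct) (auto intro: smooth_const smooth_mult)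

lemma smooth_power: "smooth f \<Longrightarrow> smooth (\<lambda>x. f x ^ n)"
  by (induction n) (auto intro: smooth_const smooth_mult)

text \<open>This family of functions is closed under differentiation, which gives smoothness by coinduction.\<close>

definition flat_exp :: "real poly \<Rightarrow> real \<Rightarrow> real" where
  "flat_exp P x = (if x > 0 then poly P (1 / x) * exp (- (1 / x)) else 0)"

lemma poly_exp_tendsto_0: "((\<lambda>y. poly P y * exp (- y)) \<longlongrightarrow> (0::real)) at_top"
proof -
  have "((\<lambda>y. \<Sum>i\<le>degree P. coeff P i * (y ^ i / exp y)) \<longlongrightarrow> (\<Sum>i\<le>degree P. coeff P i * 0)) at_top"
    by (intro tendsto_sum tendsto_mult tendsto_const tendsto_power_div_exp_0)
  then show ?thesis
    by (simp add: poly_altdef exp_minus sum_distrib_right divide_inverse mult.assoc)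
qed

text \<open>Only the limit from the right has content. With \<open>y = 1 / x\<close> it is the decay
  of a polynomial times exp(-y) at infinity.\<close>

lemma flat_exp_tendsto_0: "(flat_exp P \<longlongrightarrow> 0) (at 0)"
proof (rule filterlim_split_at)
  have "(flat_exp P \<longlongrightarrow> 0) (at_left 0) \<longleftrightarrow> ((\<lambda>_. 0::real) \<longlongrightarrow> 0) (at_left (0::real))"
    by (rule tendsto_cong) (auto simp: flat_exp_def eventually_at_filter)
  then show "(flat_exp P \<longlongrightarrow> 0) (at_left 0)" by simp
  have "(flat_exp P \<longlongrightarrow> 0) (at_right 0) \<longleftrightarrow>
     ((\<lambda>x. poly P (inverse x) * exp (- inverse x)) \<longlongrightarrow> 0) (at_right 0)"
    by (rule tendsto_cong) (auto simp: flat_exp_def eventually_at_filter divide_inverse)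
  also have \<dots>
    by (rule filterlim_compose[OF poly_exp_tendsto_0 filterlim_inverse_at_top_right])
  finally show "(flat_exp P \<longlongrightarrow> 0) (at_right 0)" .
qed

text \<open>With \<open>y = 1 / x\<close> one has dy/dx = -y^2, so P(y) exp(-y) has the x-derivative
  y^2 (P - P')(y) exp(-y), again a polynomial in y times exp(-y).\<close>

definition flat_deriv :: "real poly \<Rightarrow> real poly" where
  "flat_deriv P = [:0, 0, 1:] * (P - pderiv P)"

lemma flat_exp_DERIV: "(flat_exp P has_real_derivative flat_exp (flat_deriv P) x) (at x)"
proof (cases x "0::real" rule: linorder_cases)
  case less
  have "((\<lambda>_. 0::real) has_real_derivative 0) (at x)" by simp
  then have "(flat_exp P has_real_derivative 0) (at x)"
    by (rule has_field_derivative_transform_within_open[where S = "{..<0}"]) (use less in \<open>auto simp: flat_exp_def\<close>)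
  then show ?thesis using less by (simp add: flat_exp_def)
next
  case equal
  \<comment> \<open>Dividing by \<open>h\<close> multiplies the polynomial by its variable
    \<open>1 / h\<close>, so the difference quotient at zero belongs to the same family and the
    limit above applies.\<close>
  have "((\<lambda>h. flat_exp P h / h) \<longlongrightarrow> 0) (at 0)"
  proof (rule Lim_transform_eventually[OF flat_exp_tendsto_0[of "[:0,1:] * P"]])
    show "\<forall>\<^sub>F h in at 0. flat_exp ([:0, 1:] * P) h = flat_exp P h / h"
      by (auto simp: flat_exp_def eventually_at_filter)
  qed
  then show ?thesis using equal by (simp add: DERIV_def flat_exp_def)
next
  case greater
  have "((\<lambda>x. poly P (1 / x) * exp (- (1 / x))) has_real_derivative flat_exp (flat_deriv P) x) (at x)"
    using greater
    by (auto intro!: derivative_eq_intros DERIV_chain2[OF poly_DERIV] simp: flat_exp_def flat_deriv_def field_simps power2_eq_square)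
  then show ?thesis
    by (rule has_field_derivative_transform_within_open[where S = "{0<..}"]) (use greater in \<open>auto simp: flat_exp_def\<close>)
qed

lemma flat_exp_smult: "flat_exp (smult c P) x = c * flat_exp P x"
  by (simp add: flat_exp_def)

lemma smooth_flat_exp: "smooth (\<lambda>x::real^'n. complex_of_real (flat_exp P (c * x $ i + d)))"
proof (rule smooth_coinduct)
  let ?S = "range (\<lambda>P (x::real^'n). complex_of_real (flat_exp P (c * x $ i + d)))"
  have D: "((\<lambda>x. complex_of_real (flat_exp P (c * x $ i + d))) has_derivative
     (\<lambda>h. complex_of_real (flat_exp (flat_deriv P) (c * x $ i + d) * (c * h $ i)))) (at x)" for P and x :: "real^'n"
  proof (rule has_derivative_of_real)
    have "((\<lambda>x::real^'n. c * x $ i + d) has_derivative (\<lambda>h. c * h $ i)) (at x)"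
      by (auto intro!: derivative_eq_intros bounded_linear_imp_has_derivative bounded_linear_vec_nth)
    from has_derivative_compose[OF this flat_exp_DERIV[unfolded has_field_derivative_def]]
    show "((\<lambda>x. flat_exp P (c * x $ i + d)) has_derivative
        (\<lambda>h. flat_exp (flat_deriv P) (c * x $ i + d) * (c * h $ i))) (at x)" .
  qed
  show "(\<lambda>x. complex_of_real (flat_exp P (c * x $ i + d))) \<in> ?S" by blast
  show "g differentiable_on UNIV" if "g \<in> ?S" for g
    using that D by (fastforce simp: differentiable_on_def differentiable_def)
  show "partial_deriv j g \<in> ?S" if g: "g \<in> ?S" for g j
  proof -
    from g obtain P where g: "g = (\<lambda>x. complex_of_real (flat_exp P (c * x $ i + d)))" by blast
    \<comment> \<open>The argument is affine in \<open>x\<close>, so its derivative in direction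
      \<open>j\<close> is a constant, which the polynomial absorbs.\<close>
    have "partial_deriv j g = (\<lambda>x. complex_of_real (flat_exp (smult (c * axis j 1 $ i) (flat_deriv P)) (c * x $ i + d)))"
      unfolding g by (rule ext, subst partial_deriv_eq[OF D]) (simp add: flat_exp_smult)
    then show ?thesis by blast
  qed
qed

section \<open>Supports of test functions and operations on them\<close>

lemma test_function_smooth: "\<psi> \<in> test_functions \<Omega> \<Longrightarrow> smooth \<psi>"
  by (simp add: test_functions_def)

lemma test_function_support:
  assumes "\<psi> \<in> test_functions \<Omega>"
  obtains K where "compact K" "K \<subseteq> \<Omega>" "\<And>x. x \<notin> K \<Longrightarrow> \<psi> x = 0"
    "\<And>x i. x \<notin> K \<Longrightarrow> partial_deriv i \<psi> x = 0"
proof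
  let ?K = "closure {x. \<psi> x \<noteq> 0}"
  show "compact ?K" "?K \<subseteq> \<Omega>" using assms by (auto simp: test_functions_def)
  show z: "\<psi> x = 0" if "x \<notin> ?K" for x
    using that subsetD[OF closure_subset, of x "{x. \<psi> x \<noteq> 0}"] by auto
  show "partial_deriv i \<psi> x = 0" if "x \<notin> ?K" for x i
  proof -
    have "((\<lambda>_. 0) has_derivative (\<lambda>_. 0)) (at x)" by simp
    then have "(\<psi> has_derivative (\<lambda>_. 0)) (at x)"
    proof (rule has_derivative_transform_within_open)
      show "open (- ?K)" by (rule open_Compl[OF closed_closure])
      show "x \<in> - ?K" using that by simp
      show "0 = \<psi> y" if "y \<in> - ?K" for y using z[OF ComplD[OF that]] by (rule sym)
    qed
    then show ?thesis by (simp add: partial_deriv_eq)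
  qed
qed

lemma test_functionI:
  assumes "smooth \<psi>" "compact K" "K \<subseteq> \<Omega>" "\<And>x. x \<notin> K \<Longrightarrow> \<psi> x = 0"
  shows "\<psi> \<in> test_functions \<Omega>"
proof -
  have "closure {x. \<psi> x \<noteq> 0} \<subseteq> K"
    using assms by (intro closure_minimal compact_imp_closed) auto
  moreover have "compact (closure {x. \<psi> x \<noteq> 0})"
    using assms(4) bounded_subset[OF compact_imp_bounded[OF assms(2)], of "{x. \<psi> x \<noteq> 0}"]
    by (auto simp: compact_closure)
  ultimately show ?thesis
    using assms(1,3) by (auto simp: test_functions_def)
qed

lemma test_function_add:
  assumes "f \<in> test_functions \<Omega>" "g \<in> test_functions \<Omega>"
  shows "(\<lambda>x. f x + g x) \<in> test_functions \<Omega>"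
proof -
  obtain K where K: "compact K" "K \<subseteq> \<Omega>" "\<And>x. x \<notin> K \<Longrightarrow> f x = 0"
    using test_function_support[OF assms(1)] by metis
  obtain K' where K': "compact K'" "K' \<subseteq> \<Omega>" "\<And>x. x \<notin> K' \<Longrightarrow> g x = 0"
    using test_function_support[OF assms(2)] by metis
  show ?thesis
    by (rule test_functionI[where K = "K \<union> K'"])
      (use K K' assms in \<open>auto intro: smooth_add test_function_smooth\<close>)
qed

lemma test_function_mult:
  assumes "f \<in> test_functions \<Omega>" "smooth g"
  shows "(\<lambda>x. f x * g x) \<in> test_functions \<Omega>"
proof -
  obtain K where K: "compact K" "K \<subseteq> \<Omega>" "\<And>x. x \<notin> K \<Longrightarrow> f x = 0"
    using test_function_support[OF assms(1)] by metis
  show ?thesis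
    by (rule test_functionI[OF _ K(1,2)])
      (use K assms in \<open>auto intro: smooth_mult test_function_smooth\<close>)
qed

lemma zero_test_function: "(\<lambda>x. 0) \<in> test_functions \<Omega>"
  by (rule test_functionI[of _ "{}"]) (auto intro: smooth_const)

text \<open>\<open>flat_exp 1\<close> is exp(-1/y) for positive y and 0 otherwise. Stretching the
  distances to the faces by \<open>Suc k\<close> drives the exponents to zero, so the bumps tend to
  the indicator of the open box while staying bounded by 1.\<close>

definition box_bump :: "real^'n \<Rightarrow> real^'n \<Rightarrow> nat \<Rightarrow> real^'n \<Rightarrow> complex" where
  "box_bump a b k x = (\<Prod>i\<in>UNIV. complex_of_real (flat_exp 1 (Suc k * (x $ i - a $ i))) *
     complex_of_real (flat_exp 1 (Suc k * (b $ i - x $ i))))"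

lemma box_bump_outside: "x \<notin> box a b \<Longrightarrow> box_bump a b k x = 0"
proof -
  assume "x \<notin> box a b"
  then obtain i where "\<not> (a $ i < x $ i \<and> x $ i < b $ i)" by (auto simp: mem_box_cart)
  then have "complex_of_real (flat_exp 1 (Suc k * (x $ i - a $ i))) *
     complex_of_real (flat_exp 1 (Suc k * (b $ i - x $ i))) = 0"
    by (auto simp: flat_exp_def zero_less_mult_iff)
  then show ?thesis unfolding box_bump_def by (intro prod_zero) auto
qed

lemma norm_box_bump_le: "norm (box_bump a b k x) \<le> 1"
proof -
  have f: "\<bar>flat_exp 1 y\<bar> \<le> 1" for y by (simp add: flat_exp_def)
  have "norm (box_bump a b k x) = (\<Prod>i\<in>UNIV. \<bar>flat_exp 1 (Suc k * (x $ i - a $ i))\<bar> * \<bar>flat_exp 1 (Suc k * (b $ i - x $ i))\<bar>)"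
    by (simp add: box_bump_def prod_norm[symmetric] norm_mult)
  also have "\<dots> \<le> 1"
    by (rule prod_le_1) (auto intro!: mult_le_one f)
  finally show ?thesis by simp
qed

lemma box_bump_test:
  assumes "cbox a b \<subseteq> \<Omega>" shows "box_bump a b k \<in> test_functions \<Omega>"
proof (rule test_functionI[OF _ compact_cbox assms])
  have "smooth (\<lambda>x. \<Prod>i\<in>UNIV. complex_of_real (flat_exp 1 (Suc k * x $ i + (- Suc k * a $ i))) *
     complex_of_real (flat_exp 1 (- Suc k * x $ i + Suc k * b $ i)))"
    by (intro smooth_prod smooth_mult smooth_flat_exp)
  also have "(\<lambda>x. \<Prod>i\<in>UNIV. complex_of_real (flat_exp 1 (Suc k * x $ i + (- Suc k * a $ i))) *
     complex_of_real (flat_exp 1 (- Suc k * x $ i + Suc k * b $ i))) = box_bump a b k"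
    by (rule ext) (simp add: box_bump_def algebra_simps)
  finally show "smooth (box_bump a b k)" .
  show "box_bump a b k x = 0" if "x \<notin> cbox a b" for x
    using that box_subset_cbox by (intro box_bump_outside) blast
qed

lemma flat_exp_1_tendsto:
  fixes y :: real
  assumes "y > 0" shows "(\<lambda>k. flat_exp 1 (real (Suc k) * y)) \<longlonglongrightarrow> 1"
proof -
  have "(\<lambda>k. exp (- ((1 / y) * inverse (real (Suc k))))) \<longlonglongrightarrow> exp (- ((1 / y) * 0))"
    by (intro tendsto_intros LIMSEQ_inverse_real_of_nat)
  moreover have "flat_exp 1 (real (Suc k) * y) = exp (- ((1 / y) * inverse (real (Suc k))))" for k
    using assms by (auto simp: flat_exp_def divide_inverse mult.commute zero_less_mult_iff simp del: of_nat_Suc)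
  ultimately show ?thesis by simp
qed

lemma box_bump_tendsto:
  fixes a b x :: "real^'n"
  shows "(\<lambda>k. box_bump a b k x) \<longlonglongrightarrow> indicator (box a b) x"
proof (cases "x \<in> box a b")
  case True
  have "(\<lambda>k. box_bump a b k x) \<longlonglongrightarrow> (\<Prod>i\<in>(UNIV::'n set). complex_of_real 1 * complex_of_real 1)"
    unfolding box_bump_def
    by (intro tendsto_prod tendsto_mult tendsto_of_real flat_exp_1_tendsto) (use True in \<open>auto simp: mem_box_cart\<close>)
  with True show ?thesis by simp
qed (simp add: box_bump_outside)

section \<open>Integration by parts and the fundamental lemma\<close>

text \<open>Open boxes form an intersection stable generator of the Borel sets, so vanishing
  integrals spread from boxes to all Borel sets. The bounded support turns the integral over the
  whole space into one over a box; complements need this.\<close>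

lemma AE_0_if_box_integrals_0_borel:
  fixes f :: "'a::euclidean_space \<Rightarrow> real"
  assumes f: "integrable lborel f" and supp: "\<And>x. x \<notin> box c d \<Longrightarrow> f x = 0"
    and 0: "\<And>a b. (LINT x:box a b|lborel. f x) = 0"
  shows "AE x in lborel. f x = 0"
proof (rule sigma_finite_measure.density_zero[OF sigma_finite_lborel f])
  have UNIV0: "(LINT x:UNIV|lborel. f x) = 0"
  proof -
    have "(LINT x:UNIV|lborel. f x) = (LINT x:box c d|lborel. f x)"
      unfolding set_lebesgue_integral_def
      by (rule Bochner_Integration.integral_cong) (auto simp: indicator_def supp)
    with 0 show ?thesis by simp
  qed
  have set_int: "set_integrable lborel A f" if "A \<in> sets borel" for A
    unfolding set_integrable_def using integrable_mult_indicator[OF _ f, of A] that by simp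
  fix A :: "'a set" assume "A \<in> sets lborel"
  then have A: "A \<in> sigma_sets UNIV (range (\<lambda>(a, b). box a b))"
    by (simp add: borel_eq_box)
  have "Int_stable (range (\<lambda>(a, b). box a b :: 'a set))"
    by (auto simp: Int_stable_def box_Int_box)
  moreover have "range (\<lambda>(a, b). box a b :: 'a set) \<subseteq> Pow UNIV" by simp
  ultimately show "(LINT x:A|lborel. f x) = 0" using A
  proof (induction A rule: sigma_sets_induct_disjoint)
    case (compl A)
    then have A: "A \<in> sets borel" by (simp add: borel_eq_box)
    have "(LINT x:A \<union> (UNIV - A)|lborel. f x) = (LINT x:A|lborel. f x) + (LINT x:UNIV - A|lborel. f x)"
      by (intro set_integral_Un set_int) (use A in auto)
    with UNIV0 compl show ?case by simp
  next
    case (union A)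
    then have A: "A i \<in> sets borel" for i by (auto simp: borel_eq_box)
    have "(LINT x:\<Union>(range A)|lborel. f x) = (\<Sum>i. LINT x:A i|lborel. f x)"
      by (rule lebesgue_integral_countable_add) (use A union(1) set_int in \<open>auto simp: disjoint_family_on_def\<close>)
    with union show ?case by simp
  qed (use 0 in \<open>auto simp: set_lebesgue_integral_def\<close>)
qed

lemma AE_0_if_box_integrals_0:
  fixes f :: "'a::euclidean_space \<Rightarrow> real"
  assumes f: "integrable lebesgue f" and supp: "\<And>x. x \<notin> box c d \<Longrightarrow> f x = 0"
    and 0: "\<And>a b. (LINT x:box a b|lebesgue. f x) = 0"
  shows "AE x in lebesgue. f x = 0"
proof -
  obtain g0 where g0: "g0 \<in> borel_measurable lborel" "AE x in lborel. f x = g0 x"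
    using completion_ex_borel_measurable_real[of f lborel] f by auto
  \<comment> \<open>The Borel representative may be nonzero somewhere outside the box. Cutting it
    off restores the support condition at every point.\<close>
  define g where "g = (\<lambda>x. indicator (box c d) x * g0 x)"
  have gm[measurable]: "g \<in> borel_measurable lborel"
    unfolding g_def using g0(1) by measurable
  have fg: "AE x in lborel. f x = g x"
    using g0(2) by eventually_elim (auto simp: g_def indicator_def supp)
  then have fg': "AE x in lebesgue. f x = g x" by (rule AE_completion)
  have gm': "g \<in> borel_measurable lebesgue" using gm measurable_completion by blast
  have fm: "f \<in> borel_measurable lebesgue" using f by simp
  have "integrable lebesgue g"
    by (rule integrable_cong_AE_imp[OF f gm']) (use fg' in auto)
  then have gi: "integrable lborel g" by (simp add: integrable_completion gm)
  have "AE x in lborel. g x = 0"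
  proof (rule AE_0_if_box_integrals_0_borel[OF gi])
    show "g x = 0" if "x \<notin> box c d" for x using that by (simp add: g_def)
    fix a b :: 'a
    have "(LINT x:box a b|lborel. g x) = (LINT x:box a b|lebesgue. g x)"
      unfolding set_lebesgue_integral_def by (rule integral_completion[symmetric]) measurable
    also have "\<dots> = (LINT x:box a b|lebesgue. f x)"
      unfolding set_lebesgue_integral_def
      by (rule integral_cong_AE) (use fg' fm gm' in \<open>auto intro!: borel_measurable_times borel_measurable_indicator elim: eventually_mono\<close>)
    finally show "(LINT x:box a b|lborel. g x) = 0" using 0 by simp
  qed
  with fg have "AE x in lborel. f x = 0" by eventually_elim simp
  then show ?thesis by (rule AE_completion)
qed

lemma integrable_compact_support:
  fixes f :: "real^'n \<Rightarrow> 'b::euclidean_space"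
  assumes "continuous_on UNIV f" "compact K" "\<And>x. x \<notin> K \<Longrightarrow> f x = 0"
  shows "integrable lborel f"
proof -
  have "integrable lborel (\<lambda>x. indicator K x *\<^sub>R f x)"
    by (rule borel_integrable_compact[OF assms(2)]) (rule continuous_on_subset[OF assms(1)], simp)
  moreover have "(\<lambda>x. indicator K x *\<^sub>R f x) = f"
    using assms(3) by (auto simp: fun_eq_iff indicator_def)
  ultimately show ?thesis by simp
qed

lemma borel_measurable_lebesgue_on_continuous:
  fixes f :: "real^'n \<Rightarrow> 'b::euclidean_space"
  assumes "continuous_on UNIV f"
  shows "f \<in> borel_measurable (lebesgue_on \<Omega>)"
  using borel_measurable_continuous_onI[OF assms]
  by (intro measurable_restrict_space1) (simp add: measurable_completion)

lemma integrable_lebesgue_on_compact_support: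
  fixes f :: "real^'n \<Rightarrow> 'b::euclidean_space"
  assumes \<Omega>: "\<Omega> \<in> sets lebesgue"
    and f: "continuous_on UNIV f" "compact K" "\<And>x. x \<notin> K \<Longrightarrow> f x = 0"
  shows "integrable (lebesgue_on \<Omega>) f"
    and "K \<subseteq> \<Omega> \<Longrightarrow> (LINT x|lebesgue_on \<Omega>. f x) = (LINT x|lborel. f x)"
proof -
  have fm: "f \<in> borel_measurable lborel" using borel_measurable_continuous_onI[OF f(1)] by simp
  have fi: "integrable lebesgue f"
    using integrable_compact_support[OF f] fm by (simp add: integrable_completion)
  show "integrable (lebesgue_on \<Omega>) f"
    using \<Omega> fi by (auto simp: integrable_restrict_space intro: integrable_mult_indicator)
  assume K: "K \<subseteq> \<Omega>"
  have "(LINT x|lebesgue_on \<Omega>. f x) = (LINT x|lebesgue. indicator \<Omega> x *\<^sub>R f x)"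
    using \<Omega> by (subst integral_restrict_space) auto
  also have "(\<lambda>x. indicator \<Omega> x *\<^sub>R f x) = f"
    using f(3) K by (auto simp: fun_eq_iff indicator_def)
  finally show "(LINT x|lebesgue_on \<Omega>. f x) = (LINT x|lborel. f x)"
    using fm by (simp add: integral_completion)
qed

text \<open>By translation invariance the difference quotients have integral zero.\<close>

lemma integral_directional_derivative_eq_0:
  fixes g :: "real^'n \<Rightarrow> complex"
  assumes g: "\<And>x. (g has_derivative g' x) (at x)" and K: "compact K" "\<And>x. x \<notin> K \<Longrightarrow> g x = 0"
    and p: "continuous_on UNIV (\<lambda>x. g' x e)"
  shows "(LINT x|lborel. g' x e) = 0"
proof -
  have contg: "continuous_on UNIV g"
    by (rule continuous_at_imp_continuous_on) (auto intro: has_derivative_continuous[OF g])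
  obtain R where "\<forall>x\<in>K. norm x \<le> R"
    using compact_imp_bounded[OF K(1)] unfolding bounded_iff by blast
  then have R: "K \<subseteq> cball 0 R" by auto
  \<comment> \<open>The steps \<open>h k\<close> never exceed 1, so this ball contains the supports
    of all the difference quotients.\<close>
  define K' where "K' = cball (0::real^'n) (R + norm e)"
  have p0: "g' x e = 0" if "x \<notin> K" for x
  proof -
    have "((\<lambda>_. 0) has_derivative (\<lambda>_. 0)) (at x)" by simp
    then have "(g has_derivative (\<lambda>_. 0)) (at x)"
      by (rule has_derivative_transform_within_open[where s = "- K"])
        (use that K compact_imp_closed in \<open>auto simp: open_Compl\<close>)
    then have "g' x = (\<lambda>_. 0)" using g has_derivative_unique by blast
    then show ?thesis by simp
  qed
  have "compact ((\<lambda>x. g' x e) ` K)"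
    by (rule compact_continuous_image[OF continuous_on_subset[OF p] K(1)]) simp
  then obtain B0 where B0: "\<And>x. x \<in> K \<Longrightarrow> norm (g' x e) \<le> B0"
    using compact_imp_bounded[of "(\<lambda>x. g' x e) ` K"] unfolding bounded_iff by auto
  define B where "B = max 0 B0"
  have B: "norm (g' x e) \<le> B" for x
    using B0[of x] p0[of x] by (cases "x \<in> K") (auto simp: B_def)
  define h where "h k = inverse (real (Suc k))" for k
  have h: "0 < h k" "h k \<le> 1" for k by (auto simp: h_def field_simps)
  define q where "q k x = (1 / h k) *\<^sub>R (g (x + h k *\<^sub>R e) - g x)" for k x
  have line: "((\<lambda>t. g (x + t *\<^sub>R e)) has_derivative (\<lambda>s. g' (x + t *\<^sub>R e) (s *\<^sub>R e))) (at t)" for x t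
    by (rule has_derivative_compose[OF _ g]) (auto intro!: derivative_eq_intros)
  have lin: "g' x (s *\<^sub>R e) = s *\<^sub>R g' x e" for x s
    using has_derivative_bounded_linear[OF g] by (simp add: linear_simps)
  have qB: "norm (q k x) \<le> B" for k x
  proof -
    \<comment> \<open>The mean value inequality on the segment bounds the quotients by the supremum
      of the derivative, uniformly in \<open>k\<close>; together with the common support this is the
      domination.\<close>
    have "\<exists>t\<in>{0<..<h k}. norm (g (x + h k *\<^sub>R e) - g (x + 0 *\<^sub>R e)) \<le> norm (g' (x + t *\<^sub>R e) ((h k - 0) *\<^sub>R e))"
      by (rule mvt_general[OF h(1)])
        (auto intro!: line continuous_at_imp_continuous_on has_derivative_continuous[OF line])
    then obtain t where "norm (g (x + h k *\<^sub>R e) - g x) \<le> h k * norm (g' (x + t *\<^sub>R e) e)"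
      using h(1)[of k] by (auto simp: lin)
    also have "\<dots> \<le> h k * B" using h(1)[of k] by (intro mult_left_mono B) auto
    finally show ?thesis using h(1)[of k] by (simp add: q_def divide_simps mult.commute)
  qed
  have q0: "q k x = 0" if "x \<notin> K'" for k x
  proof -
    have n: "norm x > R + norm e" using that by (simp add: K'_def)
    have "norm x \<le> norm (x + h k *\<^sub>R e) + norm (h k *\<^sub>R e)"
      using norm_triangle_ineq4[of "x + h k *\<^sub>R e" "h k *\<^sub>R e"] by simp
    also have "norm (h k *\<^sub>R e) \<le> norm e"
      using h[of k] by (simp add: mult_left_le_one_le)
    finally have "norm (x + h k *\<^sub>R e) > R" using n by simp
    moreover have "norm x > R" using n norm_ge_zero[of e] by linarith
    ultimately have "x \<notin> K" "x + h k *\<^sub>R e \<notin> K" using R by (auto simp: subset_iff)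
    then show ?thesis by (simp add: q_def K(2))
  qed
  have gi: "integrable lborel g" by (rule integrable_compact_support[OF contg K])
  have sh: "integrable lborel (\<lambda>x. g (x + c))" "(LINT x|lborel. g (x + c)) = (LINT x|lborel. g x)" for c
  proof -
    have m: "((+) c) \<in> borel_measurable lborel" by measurable
    have "integrable (distr lborel borel ((+) c)) g" using gi by (simp add: lborel_distr_plus)
    then show "integrable lborel (\<lambda>x. g (x + c))"
      by (subst (asm) integrable_distr_eq) (use gi m in \<open>auto simp: add.commute\<close>)
    have "(LINT x|lborel. g x) = (LINT x|distr lborel borel ((+) c). g x)" by (simp add: lborel_distr_plus)
    also have "\<dots> = (LINT x|lborel. g (x + c))"
      by (subst integral_distr) (use gi m in \<open>auto simp: add.commute\<close>)
    finally show "(LINT x|lborel. g (x + c)) = (LINT x|lborel. g x)" by simp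
  qed
  have q_int: "(LINT x|lborel. q k x) = 0" for k
    unfolding q_def using sh gi by simp
  have "(\<lambda>k. LINT x|lborel. q k x) \<longlonglongrightarrow> (LINT x|lborel. g' x e)"
  proof (rule integral_dominated_convergence)
    show "(\<lambda>x. g' x e) \<in> borel_measurable lborel"
      using borel_measurable_continuous_onI[OF p] by simp
    have "continuous_on UNIV (q k)" for k
      unfolding q_def by (intro continuous_intros continuous_on_compose2[OF contg]) auto
    then show "q k \<in> borel_measurable lborel" for k
      using borel_measurable_continuous_onI by auto
    show "integrable lborel (\<lambda>x. indicator K' x *\<^sub>R B)"
      unfolding K'_def by (rule borel_integrable_compact) (auto intro: continuous_intros)
    show "AE x in lborel. norm (q k x) \<le> indicator K' x *\<^sub>R B" for k
      using qB q0 by (auto simp: indicator_def)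
    show "AE x in lborel. (\<lambda>k. q k x) \<longlonglongrightarrow> g' x e"
    proof (rule AE_I2)
      fix x
      have "((\<lambda>t. g (x + t *\<^sub>R e)) has_vector_derivative g' x e) (at 0)"
        using line[of x 0] by (simp add: has_vector_derivative_def lin)
      then have "((\<lambda>s. (1 / norm s) *\<^sub>R (g (x + s *\<^sub>R e) - (g x + s *\<^sub>R g' x e))) \<longlongrightarrow> 0) (at 0)"
        by (simp add: has_vector_derivative_def has_derivative_within)
      moreover have "filterlim h (at 0) sequentially"
        unfolding filterlim_at h_def
        using LIMSEQ_inverse_real_of_nat by (auto simp: eventually_sequentially)
      ultimately have "(\<lambda>k. (1 / norm (h k)) *\<^sub>R (g (x + h k *\<^sub>R e) - (g x + h k *\<^sub>R g' x e))) \<longlonglongrightarrow> 0"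
        by (rule filterlim_compose)
      moreover have "(1 / norm (h k)) *\<^sub>R (g (x + h k *\<^sub>R e) - (g x + h k *\<^sub>R g' x e)) = q k x - g' x e" for k
        using h(1)[of k] by (simp add: q_def scaleR_diff_right scaleR_add_right)
      ultimately show "(\<lambda>k. q k x) \<longlonglongrightarrow> g' x e" by (simp add: LIM_zero_iff)
    qed
  qed
  with q_int show ?thesis by (simp add: LIMSEQ_const_iff)
qed

lemma smooth_partial_deriv_continuous: "smooth \<psi> \<Longrightarrow> continuous_on UNIV (partial_deriv i \<psi>)"
  by (intro smooth_continuous smooth_partial_deriv)

text \<open>The product has compact support inside \<open>\<Omega>\<close> as soon as one factor
  has, so its derivative integrates to zero and no boundary term appears, whatever the shape of
  \<open>\<Omega>\<close>.\<close>

lemma test_integration_by_parts: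
  assumes \<Omega>: "open \<Omega>" and \<psi>: "smooth \<psi>" and \<eta>: "\<eta> \<in> test_functions \<Omega>"
  shows "(LINT x|lebesgue_on \<Omega>. \<psi> x * partial_deriv i \<eta> x) = - (LINT x|lebesgue_on \<Omega>. partial_deriv i \<psi> x * \<eta> x)"
proof -
  have \<Omega>m: "\<Omega> \<in> sets lebesgue" using \<Omega> by simp
  obtain K where K: "compact K" "K \<subseteq> \<Omega>" "\<And>x. x \<notin> K \<Longrightarrow> \<eta> x = 0"
    "\<And>x i. x \<notin> K \<Longrightarrow> partial_deriv i \<eta> x = 0"
    using test_function_support[OF \<eta>] by metis
  note sm = \<psi> test_function_smooth[OF \<eta>]
  note c = sm[THEN smooth_continuous] sm[THEN smooth_partial_deriv_continuous]
  let ?g' = "\<lambda>x h. \<psi> x * frechet_derivative \<eta> (at x) h + frechet_derivative \<psi> (at x) h * \<eta> x"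
  have "(LINT x|lborel. ?g' x (axis i 1)) = 0"
  proof (rule integral_directional_derivative_eq_0[OF _ K(1)])
    show "((\<lambda>x. \<psi> x * \<eta> x) has_derivative ?g' x) (at x)" for x
      by (intro has_derivative_mult smooth_has_derivative sm)
    show "continuous_on UNIV (\<lambda>x. ?g' x (axis i 1))"
      using c by (auto simp: partial_deriv_def intro!: continuous_intros)
  qed (use K in auto)
  moreover have "(LINT x|lebesgue_on \<Omega>. \<psi> x * partial_deriv i \<eta> x + partial_deriv i \<psi> x * \<eta> x) =
    (LINT x|lborel. ?g' x (axis i 1))"
    unfolding partial_deriv_def[symmetric]
    by (rule integrable_lebesgue_on_compact_support(2)[OF \<Omega>m _ K(1)])
       (use K c in \<open>auto intro!: continuous_intros\<close>)
  moreover have "integrable (lebesgue_on \<Omega>) (\<lambda>x. \<psi> x * partial_deriv i \<eta> x)"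
    by (rule integrable_lebesgue_on_compact_support(1)[OF \<Omega>m _ K(1)])
       (use K c in \<open>auto intro!: continuous_intros\<close>)
  moreover have "integrable (lebesgue_on \<Omega>) (\<lambda>x. partial_deriv i \<psi> x * \<eta> x)"
    by (rule integrable_lebesgue_on_compact_support(1)[OF \<Omega>m _ K(1)])
       (use K c in \<open>auto intro!: continuous_intros\<close>)
  ultimately show ?thesis by (simp add: eq_neg_iff_add_eq_0)
qed

text \<open>Bumps that tend to the indicator of a box convert the hypothesis into vanishing
  integrals over boxes. Countably many closed boxes cover \<open>\<Omega>\<close>, and the null sets
  add up to a null set.\<close>

lemma AE_0_if_test_integrals_0:
  fixes G :: "real^'n \<Rightarrow> complex"
  assumes \<Omega>: "open \<Omega>" and G: "locally_integrable \<Omega> G"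
    and 0: "\<And>\<eta>. \<eta> \<in> test_functions \<Omega> \<Longrightarrow> (LINT x|lebesgue_on \<Omega>. G x * \<eta> x) = 0"
  shows "AE x in lebesgue_on \<Omega>. G x = 0"
proof -
  have box0: "(LINT x:box a b|lebesgue. G x) = 0" if ab: "cbox a b \<subseteq> \<Omega>" for a b
  proof -
    have i: "integrable lebesgue (\<lambda>x. indicator (cbox a b) x *\<^sub>R G x)"
      using G ab unfolding locally_integrable_def set_integrable_def by auto
    note m = borel_measurable_integrable[OF i]
    have b: "box_bump a b k \<in> borel_measurable lebesgue" for k
      using borel_measurable_lebesgue_on_continuous[OF smooth_continuous[OF test_function_smooth[OF box_bump_test[OF subset_UNIV]]], where \<Omega> = UNIV]
      by (simp add: lebesgue_on_UNIV_eq)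
    have "(\<lambda>k. LINT x|lebesgue. (indicator (cbox a b) x *\<^sub>R G x) * box_bump a b k x) \<longlonglongrightarrow>
       (LINT x|lebesgue. (indicator (cbox a b) x *\<^sub>R G x) * indicator (box a b) x)"
    proof (rule integral_dominated_convergence)
      show "integrable lebesgue (\<lambda>x. norm (indicator (cbox a b) x *\<^sub>R G x))"
        by (rule integrable_norm[OF i])
      show "AE x in lebesgue. (\<lambda>k. indicator (cbox a b) x *\<^sub>R G x * box_bump a b k x) \<longlonglongrightarrow>
          indicator (cbox a b) x *\<^sub>R G x * indicator (box a b) x"
        by (intro AE_I2 tendsto_mult_left box_bump_tendsto)
      show "AE x in lebesgue. norm (indicator (cbox a b) x *\<^sub>R G x * box_bump a b k x) \<le> norm (indicator (cbox a b) x *\<^sub>R G x)" for k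
      proof (rule AE_I2)
        fix x
        show "norm (indicator (cbox a b) x *\<^sub>R G x * box_bump a b k x) \<le> norm (indicator (cbox a b) x *\<^sub>R G x)"
          unfolding norm_mult by (rule mult_left_le[OF norm_box_bump_le]) simp
      qed
      show "(\<lambda>x. indicator (cbox a b) x *\<^sub>R G x * indicator (box a b) x) \<in> borel_measurable lebesgue"
        by (rule borel_measurable_times[OF m borel_measurable_indicator]) simp
      show "(\<lambda>x. indicator (cbox a b) x *\<^sub>R G x * box_bump a b k x) \<in> borel_measurable lebesgue" for k
        by (rule borel_measurable_times[OF m b])
    qed
    moreover have "(LINT x|lebesgue. (indicator (cbox a b) x *\<^sub>R G x) * box_bump a b k x) = 0" for k
    proof -
      have "(LINT x|lebesgue. (indicator (cbox a b) x *\<^sub>R G x) * box_bump a b k x) =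
        (LINT x|lebesgue. indicator \<Omega> x *\<^sub>R (G x * box_bump a b k x))"
        by (rule Bochner_Integration.integral_cong[OF refl])
          (use ab box_subset_cbox[of a b] box_bump_outside[of _ a b k] in \<open>fastforce simp: indicator_def subset_iff\<close>)
      also have "\<dots> = (LINT x|lebesgue_on \<Omega>. G x * box_bump a b k x)"
        using \<Omega> by (subst integral_restrict_space) auto
      finally show ?thesis using 0 box_bump_test[OF ab] by simp
    qed
    moreover have "(LINT x|lebesgue. (indicator (cbox a b) x *\<^sub>R G x) * indicator (box a b) x) = (LINT x:box a b|lebesgue. G x)"
      unfolding set_lebesgue_integral_def
      by (rule Bochner_Integration.integral_cong[OF refl])
        (use box_subset_cbox[of a b] in \<open>auto simp: indicator_def\<close>)
    ultimately show ?thesis by (simp add: LIMSEQ_const_iff)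
  qed
  have cbox: "AE x in lebesgue. x \<in> cbox c d \<longrightarrow> G x = 0" if cd: "cbox c d \<subseteq> \<Omega>" for c d
  proof -
    have cd': "box c d \<subseteq> \<Omega>" using cd box_subset_cbox by blast
    define f where "f x = indicator (box c d) x *\<^sub>R G x" for x
    have "set_integrable lebesgue (cbox c d) G"
      using G cd by (simp add: locally_integrable_def)
    then have "set_integrable lebesgue (box c d) G"
      by (rule set_integrable_subset) (auto simp: box_subset_cbox)
    then have f: "integrable lebesgue f" by (simp add: set_integrable_def f_def[abs_def])
    have f0: "(LINT x:box a b|lebesgue. f x) = 0" for a b
    proof -
      \<comment> \<open>Two open boxes meet in an open box. If it is nonempty, its closure is a
        closed box inside \<open>cbox c d\<close>, hence inside \<open>\<Omega>\<close>, so the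
        preceding step applies to it.\<close>
      obtain a' b' where ab: "box a b \<inter> box c d = box a' b'"
        using box_Int_box[of a b c d] by blast
      have eq: "(LINT x:box a b|lebesgue. f x) = (LINT x:box a' b'|lebesgue. G x)"
        unfolding set_lebesgue_integral_def f_def ab[symmetric]
        by (rule Bochner_Integration.integral_cong) (auto simp: indicator_def)
      show ?thesis
      proof (cases "box a' b' = {}")
        case True then show ?thesis unfolding eq by (simp add: set_lebesgue_integral_def)
      next
        case False
        have "cbox a' b' = closure (box a' b')" using False closure_box by metis
        also have "\<dots> \<subseteq> closure (box c d)" using ab by (intro closure_mono) blast
        also have "\<dots> \<subseteq> cbox c d" by (rule closure_minimal[OF box_subset_cbox closed_cbox])
        finally show ?thesis using cd box0 eq by (metis order_trans)
      qed
    qed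
    have fb: "set_integrable lebesgue (box a b) f" for a b
      unfolding set_integrable_def using f by (intro integrable_mult_indicator) auto
    have "AE x in lebesgue. Re (f x) = 0"
    proof (rule AE_0_if_box_integrals_0[where c = c and d = d])
      show "integrable lebesgue (\<lambda>x. Re (f x))" using f by simp
      show "Re (f x) = 0" if "x \<notin> box c d" for x using that by (simp add: f_def)
      show "(LINT x:box a b|lebesgue. Re (f x)) = 0" for a b
        using integral_Re[OF fb[unfolded set_integrable_def], of a b] f0[of a b]
        by (simp add: set_lebesgue_integral_def)
    qed
    moreover have "AE x in lebesgue. Im (f x) = 0"
    proof (rule AE_0_if_box_integrals_0[where c = c and d = d])
      show "integrable lebesgue (\<lambda>x. Im (f x))" using f by simp
      show "Im (f x) = 0" if "x \<notin> box c d" for x using that by (simp add: f_def)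
      show "(LINT x:box a b|lebesgue. Im (f x)) = 0" for a b
        using integral_Im[OF fb[unfolded set_integrable_def], of a b] f0[of a b]
        by (simp add: set_lebesgue_integral_def)
    qed
    \<comment> \<open>The argument says nothing about the boundary of the box, which is a null
      set.\<close>
    moreover have "AE x in lebesgue. x \<notin> cbox c d - box c d"
      using negligible_frontier_interval[of c d]
      by (intro AE_not_in) (simp add: negligible_iff_null_sets)
    ultimately show ?thesis
      by eventually_elim (auto simp: f_def complex_eq_iff indicator_def split: if_splits)
  qed
  obtain \<D> where D: "countable \<D>" "\<D> \<subseteq> Pow \<Omega>" "\<And>X. X \<in> \<D> \<Longrightarrow> \<exists>a b. X = cbox a b" "\<Union>\<D> = \<Omega>"
    using open_countable_Union_open_cbox[OF \<Omega>] by metis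
  have "AE x in lebesgue. x \<in> X \<longrightarrow> G x = 0" if "X \<in> \<D>" for X
  proof -
    obtain a b where X: "X = cbox a b" using D(3) \<open>X \<in> \<D>\<close> by blast
    moreover have "X \<subseteq> \<Omega>" using D(2) \<open>X \<in> \<D>\<close> by blast
    ultimately show ?thesis using cbox[of a b] by simp
  qed
  then have "AE x in lebesgue. \<forall>X\<in>\<D>. x \<in> X \<longrightarrow> G x = 0"
    using D(1) by (subst AE_ball_countable) auto
  then have "AE x in lebesgue. x \<in> \<Omega> \<longrightarrow> G x = 0"
    by eventually_elim (use D(4) in blast)
  then show ?thesis using \<Omega> by (simp add: AE_restrict_space_iff)
qed

section \<open>Weak gradients in the closure of the test functions\<close>

definition jet :: "(real^'n \<Rightarrow> complex) \<Rightarrow> real^'n \<Rightarrow> complex \<times> (complex^'n)" where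
  "jet \<psi> x = (\<psi> x, \<chi> i. partial_deriv i \<psi> x)"

text \<open>A pair of a function and its gradient, as an \<open>L2\<close> limit of such pairs for test functions. By
  \<open>H10_jetD\<close> and \<open>H10_jetI\<close> this is membership in \<open>H10\<close>, without the choice involved in \<open>weak_grad\<close>.\<close>

definition H10_jet :: "(real^'n) set \<Rightarrow> (real^'n \<Rightarrow> complex \<times> (complex^'n)) \<Rightarrow> bool" where
  "H10_jet \<Omega> U \<longleftrightarrow> U \<in> L2 \<Omega> \<and>
     (\<forall>\<epsilon>>0. \<exists>\<psi>\<in>test_functions \<Omega>. (LINT x|lebesgue_on \<Omega>. (norm (U x - jet \<psi> x))\<^sup>2) < \<epsilon>)"

text \<open>Completeness of Lebesgue measure. It is what makes \<open>weak_grad\<close> measurable,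
  a choice that is known only up to null sets.\<close>

lemma borel_measurable_lebesgue_on_AE_cong:
  fixes f g :: "real^'n \<Rightarrow> 'b::euclidean_space"
  assumes \<Omega>: "\<Omega> \<in> sets lebesgue" and f: "f \<in> borel_measurable (lebesgue_on \<Omega>)"
    and eq: "AE x in lebesgue_on \<Omega>. g x = f x"
  shows "g \<in> borel_measurable (lebesgue_on \<Omega>)"
proof -
  have "(\<lambda>x. indicator \<Omega> x *\<^sub>R f x) \<in> borel_measurable lebesgue"
    using f \<Omega> by (subst (asm) borel_measurable_restrict_space_iff) auto
  moreover have "AE x in lebesgue. indicator \<Omega> x *\<^sub>R f x = indicator \<Omega> x *\<^sub>R g x"
    using eq \<Omega> by (auto simp: AE_restrict_space_iff indicator_def elim!: eventually_mono)
  ultimately have "(\<lambda>x. indicator \<Omega> x *\<^sub>R g x) \<in> borel_measurable lebesgue"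
    by (rule borel_measurable_AE)
  then show ?thesis
    using \<Omega> by (subst borel_measurable_restrict_space_iff) auto
qed

lemma L2_AE_cong:
  fixes f g :: "real^'n \<Rightarrow> 'b::euclidean_space"
  assumes "\<Omega> \<in> sets lebesgue" "f \<in> L2 \<Omega>" "AE x in lebesgue_on \<Omega>. g x = f x"
  shows "g \<in> L2 \<Omega>"
  using L2_AE_cong_measurable[OF assms(2) borel_measurable_lebesgue_on_AE_cong[OF assms(1) L2_measurable[OF assms(2)] assms(3)] assms(3)] .

lemma jet_continuous: "smooth \<psi> \<Longrightarrow> continuous_on UNIV (jet \<psi>)"
  unfolding jet_def
  by (intro continuous_intros smooth_continuous smooth_partial_deriv_continuous)

lemma jet_L2:
  assumes \<Omega>: "open \<Omega>" and \<psi>: "\<psi> \<in> test_functions \<Omega>"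
  shows "jet \<psi> \<in> L2 \<Omega>"
proof -
  obtain K where K: "compact K" "K \<subseteq> \<Omega>" "\<And>x. x \<notin> K \<Longrightarrow> \<psi> x = 0"
    "\<And>x i. x \<notin> K \<Longrightarrow> partial_deriv i \<psi> x = 0"
    using test_function_support[OF \<psi>] by metis
  note c = jet_continuous[OF test_function_smooth[OF \<psi>]]
  have "integrable (lebesgue_on \<Omega>) (\<lambda>x. (norm (jet \<psi> x))\<^sup>2)"
    by (rule integrable_lebesgue_on_compact_support(1)[OF _ _ K(1)])
      (use \<Omega> K in \<open>auto simp: jet_def zero_prod_def[symmetric] zero_vec_def[symmetric] intro!: continuous_intros c[unfolded jet_def]\<close>)
  then show ?thesis
    using borel_measurable_lebesgue_on_continuous[OF c] by (simp add: L2_def)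
qed

lemma jet_add:
  assumes "smooth f" "smooth g"
  shows "jet (\<lambda>x. f x + g x) x = jet f x + jet g x"
proof -
  have "f differentiable_on UNIV" "g differentiable_on UNIV"
    using assms smooth_differentiable by (auto simp: differentiable_on_def)
  from partial_deriv_add[OF this] show ?thesis
    by (simp add: jet_def vec_eq_iff)
qed

lemma H10_jet_L2: "H10_jet \<Omega> U \<Longrightarrow> U \<in> L2 \<Omega>"
  by (simp add: H10_jet_def)

lemma H10_jet_test:
  assumes "open \<Omega>" "\<psi> \<in> test_functions \<Omega>" shows "H10_jet \<Omega> (jet \<psi>)"
  unfolding H10_jet_def
proof (intro conjI allI impI)
  show "jet \<psi> \<in> L2 \<Omega>" by (rule jet_L2[OF assms])
  show "\<exists>\<eta>\<in>test_functions \<Omega>. (LINT x|lebesgue_on \<Omega>. (norm (jet \<psi> x - jet \<eta> x))\<^sup>2) < \<epsilon>" if "0 < \<epsilon>" for \<epsilon>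
    using assms(2) that by (intro bexI[of _ \<psi>]) auto
qed

lemma H10_jet_limit:
  assumes \<Omega>: "open \<Omega>" and V: "\<And>n. H10_jet \<Omega> (V n)" and U: "U \<in> L2 \<Omega>"
    and lim: "(\<lambda>n. LINT x|lebesgue_on \<Omega>. (norm (V n x - U x))\<^sup>2) \<longlonglongrightarrow> 0"
  shows "H10_jet \<Omega> U"
  unfolding H10_jet_def
proof (intro conjI allI impI U)
  fix \<epsilon> :: real assume e: "0 < \<epsilon>"
  \<comment> \<open>A quarter, because the squared triangle inequality doubles each of the two
    distances.\<close>
  have "\<forall>\<^sub>F n in sequentially. (LINT x|lebesgue_on \<Omega>. (norm (V n x - U x))\<^sup>2) < \<epsilon> / 4"
    using order_tendstoD(2)[OF lim, of "\<epsilon> / 4"] e by simp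
  then obtain n where n: "(LINT x|lebesgue_on \<Omega>. (norm (V n x - U x))\<^sup>2) < \<epsilon> / 4"
    by (auto simp: eventually_sequentially)
  obtain \<psi> where \<psi>: "\<psi> \<in> test_functions \<Omega>" "(LINT x|lebesgue_on \<Omega>. (norm (V n x - jet \<psi> x))\<^sup>2) < \<epsilon> / 4"
    using V[of n] e unfolding H10_jet_def by (meson divide_pos_pos zero_less_numeral)
  have "(LINT x|lebesgue_on \<Omega>. (norm (U x - jet \<psi> x))\<^sup>2) \<le>
    2 * (LINT x|lebesgue_on \<Omega>. (norm (U x - V n x))\<^sup>2) + 2 * (LINT x|lebesgue_on \<Omega>. (norm (V n x - jet \<psi> x))\<^sup>2)"
    by (rule L2_dist_triangle[OF U H10_jet_L2[OF V] jet_L2[OF \<Omega> \<psi>(1)]])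
  also have "\<dots> < \<epsilon>" using n \<psi>(2) by (simp add: norm_minus_commute)
  finally show "\<exists>\<psi>\<in>test_functions \<Omega>. (LINT x|lebesgue_on \<Omega>. (norm (U x - jet \<psi> x))\<^sup>2) < \<epsilon>"
    using \<psi>(1) by blast
qed

lemma H10_jet_dominated:
  assumes \<Omega>: "open \<Omega>" and V: "\<And>n. H10_jet \<Omega> (V n)" and U: "U \<in> borel_measurable (lebesgue_on \<Omega>)"
    and g: "g \<in> L2 \<Omega>" and le: "\<And>n. AE x in lebesgue_on \<Omega>. norm (V n x) \<le> C * norm (g x)"
    and lim: "AE x in lebesgue_on \<Omega>. (\<lambda>n. V n x) \<longlonglongrightarrow> U x"
  shows "H10_jet \<Omega> U"
  by (rule H10_jet_limit[OF \<Omega> V])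
    (use L2_dominated_convergence[OF L2_measurable[OF H10_jet_L2[OF V]] U g le lim] in auto)

text \<open>The constant sequence \<open>U\<close> converges to \<open>V\<close>, their distance
  being zero.\<close>

lemma H10_jet_AE_cong:
  assumes \<Omega>: "open \<Omega>" and U: "H10_jet \<Omega> U" and eq: "AE x in lebesgue_on \<Omega>. V x = U x"
  shows "H10_jet \<Omega> V"
proof (rule H10_jet_limit[OF \<Omega> U])
  show V: "V \<in> L2 \<Omega>" using L2_AE_cong[OF _ H10_jet_L2[OF U] eq] \<Omega> by auto
  have "(LINT x|lebesgue_on \<Omega>. (norm (U x - V x))\<^sup>2) = (LINT x|lebesgue_on \<Omega>. 0)"
    by (rule integral_cong_AE) (use eq L2_integrable[OF L2_diff[OF H10_jet_L2[OF U] V]] in auto)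
  then show "(\<lambda>n. LINT x|lebesgue_on \<Omega>. (norm (U x - V x))\<^sup>2) \<longlonglongrightarrow> 0" by simp
qed

lemma H10_jet_approx:
  assumes U: "H10_jet \<Omega> U"
  obtains \<psi> where "\<And>n::nat. \<psi> n \<in> test_functions \<Omega>"
    "(\<lambda>n. LINT x|lebesgue_on \<Omega>. (norm (jet (\<psi> n) x - U x))\<^sup>2) \<longlonglongrightarrow> 0"
proof -
  have "\<exists>\<psi>\<in>test_functions \<Omega>. (LINT x|lebesgue_on \<Omega>. (norm (U x - jet \<psi> x))\<^sup>2) < inverse (real (Suc n))" for n
    using U unfolding H10_jet_def by (meson inverse_positive_iff_positive of_nat_0_less_iff zero_less_Suc)
  then have "\<forall>n. \<exists>\<psi>. \<psi> \<in> test_functions \<Omega> \<and> (LINT x|lebesgue_on \<Omega>. (norm (U x - jet \<psi> x))\<^sup>2) < inverse (real (Suc n))"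
    by (simp only: Bex_def) blast
  from choice[OF this] obtain \<psi> where \<psi>: "\<And>n. \<psi> n \<in> test_functions \<Omega>"
    "\<And>n. (LINT x|lebesgue_on \<Omega>. (norm (U x - jet (\<psi> n) x))\<^sup>2) < inverse (real (Suc n))"
    by blast
  have "(\<lambda>n. LINT x|lebesgue_on \<Omega>. (norm (jet (\<psi> n) x - U x))\<^sup>2) \<longlonglongrightarrow> 0"
  proof (rule tendsto_sandwich[OF _ _ tendsto_const LIMSEQ_inverse_real_of_nat])
    show "\<forall>\<^sub>F n in sequentially. 0 \<le> (LINT x|lebesgue_on \<Omega>. (norm (jet (\<psi> n) x - U x))\<^sup>2)"
      by (auto intro!: always_eventually Bochner_Integration.integral_nonneg)
    show "\<forall>\<^sub>F n in sequentially. (LINT x|lebesgue_on \<Omega>. (norm (jet (\<psi> n) x - U x))\<^sup>2) \<le> inverse (real (Suc n))"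
      using \<psi>(2) by (auto intro!: always_eventually less_imp_le simp: norm_minus_commute)
  qed
  with \<psi>(1) show ?thesis by (rule that)
qed

lemma H10_jet_add:
  assumes \<Omega>: "open \<Omega>" and U: "H10_jet \<Omega> U" and V: "H10_jet \<Omega> V"
  shows "H10_jet \<Omega> (\<lambda>x. U x + V x)"
  unfolding H10_jet_def
proof (intro conjI allI impI)
  note L = H10_jet_L2[OF U] H10_jet_L2[OF V]
  show UV: "(\<lambda>x. U x + V x) \<in> L2 \<Omega>" by (rule L2_add[OF L])
  fix \<epsilon> :: real assume e: "0 < \<epsilon>"
  obtain \<psi> where \<psi>: "\<psi> \<in> test_functions \<Omega>" "(LINT x|lebesgue_on \<Omega>. (norm (U x - jet \<psi> x))\<^sup>2) < \<epsilon> / 4"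
    using U e unfolding H10_jet_def by (meson divide_pos_pos zero_less_numeral)
  obtain \<eta> where \<eta>: "\<eta> \<in> test_functions \<Omega>" "(LINT x|lebesgue_on \<Omega>. (norm (V x - jet \<eta> x))\<^sup>2) < \<epsilon> / 4"
    using V e unfolding H10_jet_def by (meson divide_pos_pos zero_less_numeral)
  note J = jet_L2[OF \<Omega> \<psi>(1)] jet_L2[OF \<Omega> \<eta>(1)]
  have "(LINT x|lebesgue_on \<Omega>. (norm (U x + V x - (jet \<psi> x + jet \<eta> x)))\<^sup>2) \<le>
    2 * (LINT x|lebesgue_on \<Omega>. (norm (U x + V x - (jet \<psi> x + V x)))\<^sup>2) +
    2 * (LINT x|lebesgue_on \<Omega>. (norm (jet \<psi> x + V x - (jet \<psi> x + jet \<eta> x)))\<^sup>2)"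
    by (rule L2_dist_triangle) (intro L2_add L J)+
  also have "\<dots> < \<epsilon>" using \<psi>(2) \<eta>(2) by simp
  finally show "\<exists>\<psi>\<in>test_functions \<Omega>. (LINT x|lebesgue_on \<Omega>. (norm (U x + V x - jet \<psi> x))\<^sup>2) < \<epsilon>"
    using test_function_add[OF \<psi>(1) \<eta>(1)] jet_add[OF \<psi>(1)[THEN test_function_smooth] \<eta>(1)[THEN test_function_smooth]]
    by (intro bexI[of _ "\<lambda>x. \<psi> x + \<eta> x"]) auto
qed

section \<open>From jets to weak gradients and back\<close>

lemma test_function_uminus:
  assumes "\<psi> \<in> test_functions \<Omega>" shows "(\<lambda>x. - \<psi> x) \<in> test_functions \<Omega>"
  using test_function_mult[OF assms smooth_const[of "-1"]] by simp

lemma jet_uminus: "smooth \<psi> \<Longrightarrow> jet (\<lambda>x. - \<psi> x) x = - jet \<psi> x"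
proof -
  assume "smooth \<psi>"
  from has_derivative_minus[OF smooth_has_derivative[OF this]]
  have "partial_deriv i (\<lambda>x. - \<psi> x) x = - partial_deriv i \<psi> x" for i
    by (subst partial_deriv_eq) (auto simp: partial_deriv_def)
  then show ?thesis by (simp add: jet_def vec_eq_iff)
qed

text \<open>On a compact set 1 is integrable, and the norm is at most 1 plus its square.\<close>

lemma locally_integrable_L2:
  fixes f :: "real^'n \<Rightarrow> 'b::euclidean_space"
  assumes \<Omega>: "open \<Omega>" and f: "f \<in> L2 \<Omega>" shows "locally_integrable \<Omega> f"
  unfolding locally_integrable_def
proof (intro allI impI, elim conjE)
  fix K assume K: "compact K" "K \<subseteq> \<Omega>"
  have \<Omega>m: "\<Omega> \<in> sets lebesgue" and Km: "K \<in> sets lebesgue"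
    using \<Omega> compact_imp_closed[OF K(1)] by auto
  have m: "(\<lambda>x. indicator \<Omega> x *\<^sub>R f x) \<in> borel_measurable lebesgue"
    using L2_measurable[OF f] \<Omega>m by (subst (asm) borel_measurable_restrict_space_iff) auto
  have i: "integrable lebesgue (\<lambda>x. indicator \<Omega> x *\<^sub>R (norm (f x))\<^sup>2)"
    using L2_integrable[OF f] \<Omega>m by (subst (asm) integrable_restrict_space) auto
  have k: "integrable lebesgue (indicat_real K)"
    using lmeasurable_compact[OF K(1)] by (simp add: lmeasurable_iff_integrable)
  show "f absolutely_integrable_on K"
    unfolding set_integrable_def
  proof (rule Bochner_Integration.integrable_bound[OF Bochner_Integration.integrable_add[OF k i]])
    have "(\<lambda>x. indicator K x *\<^sub>R f x) = (\<lambda>x. indicator K x *\<^sub>R (indicator \<Omega> x *\<^sub>R f x))"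
      using K(2) by (auto simp: fun_eq_iff indicator_def)
    also have "\<dots> \<in> borel_measurable lebesgue"
      by (rule borel_measurable_scaleR[OF borel_measurable_indicator[OF Km] m])
    finally show "(\<lambda>x. indicator K x *\<^sub>R f x) \<in> borel_measurable lebesgue" .
    have "norm (f x) \<le> 1 + (norm (f x))\<^sup>2" for x
      using norm_mult_le_sq[of 1 "norm (f x)"] by simp
    then show "AE x in lebesgue. norm (indicator K x *\<^sub>R f x) \<le> norm (indicat_real K x + indicator \<Omega> x *\<^sub>R (norm (f x))\<^sup>2)"
      using K(2) by (auto simp: indicator_def)
  qed
qed

text \<open>The integration by parts identity is a continuous linear condition on pairs. It holds
  for test functions with their gradients and therefore on the closure.\<close>

lemma H10_jet_weak_gradient:
  fixes u :: "real^'n \<Rightarrow> complex"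
  assumes \<Omega>: "open \<Omega>" and U: "H10_jet \<Omega> (\<lambda>x. (u x, G x))"
  shows "has_weak_gradient \<Omega> u G"
  unfolding has_weak_gradient_def
proof (intro conjI ballI allI)
  have L: "u \<in> L2 \<Omega>" "G \<in> L2 \<Omega>" using H10_jet_L2[OF U] by (auto simp: L2_Pair_iff)
  show "locally_integrable \<Omega> u" "locally_integrable \<Omega> G"
    using L by (auto intro: locally_integrable_L2[OF \<Omega>])
  fix \<eta> i assume \<eta>: "\<eta> \<in> test_functions \<Omega>"
  note J = jet_L2[OF \<Omega> \<eta>]
  have J': "\<eta> \<in> L2 \<Omega>" "(\<lambda>x. \<chi> i. partial_deriv i \<eta> x) \<in> L2 \<Omega>"
    using J unfolding jet_def by (auto simp: L2_Pair_iff)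
  define \<eta>' where "\<eta>' x = partial_deriv i \<eta> x" for x
  have \<eta>m: "\<eta> \<in> borel_measurable (lebesgue_on \<Omega>)" "\<eta>' \<in> borel_measurable (lebesgue_on \<Omega>)"
    unfolding \<eta>'_def
    by (intro borel_measurable_lebesgue_on_continuous smooth_continuous smooth_partial_deriv test_function_smooth[OF \<eta>])+
  have le: "norm (\<eta> x) \<le> norm (jet \<eta> x)" "norm (\<eta>' x) \<le> norm (jet \<eta> x)" for x
    unfolding jet_def \<eta>'_def
     apply (rule norm_fst_le)
    apply (rule order_trans[OF _ norm_snd_le])
    using Finite_Cartesian_Product.norm_nth_le[of "\<chi> i. partial_deriv i \<eta> x" i] by simp
  \<comment> \<open>The defect of the identity for the pair of \<open>v\<close> and
    \<open>H\<close>: linear in the pair, and zero when \<open>v\<close> is a test function with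
    gradient \<open>H\<close>.\<close>
  define l where "l v H = (LINT x|lebesgue_on \<Omega>. v x * \<eta>' x) + (LINT x|lebesgue_on \<Omega>. H x $ i * \<eta> x)" for v and H :: "real^'n \<Rightarrow> complex^'n"
  have vi: "integrable (lebesgue_on \<Omega>) (\<lambda>x. v x * \<eta>' x)" if "v \<in> L2 \<Omega>" for v
    by (rule integrable_L2_prod[OF that J, of _ 1])
      (use \<eta>m L2_measurable[OF that] le in \<open>auto simp: norm_mult intro!: borel_measurable_times mult_left_mono\<close>)
  have hm: "(\<lambda>x. H x $ i) \<in> borel_measurable (lebesgue_on \<Omega>)" if "H \<in> L2 \<Omega>" for H :: "real^'n \<Rightarrow> complex^'n"
    by (rule measurable_compose[OF L2_measurable[OF that]]) (intro borel_measurable_continuous_onI continuous_intros)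
  have hi: "integrable (lebesgue_on \<Omega>) (\<lambda>x. H x $ i * \<eta> x)" if "H \<in> L2 \<Omega>" for H :: "real^'n \<Rightarrow> complex^'n"
    by (rule integrable_L2_prod[OF that J, of _ 1])
      (use \<eta>m hm[OF that] le in \<open>auto simp: norm_mult intro!: borel_measurable_times mult_mono Finite_Cartesian_Product.norm_nth_le\<close>)
  let ?c = "LINT x|lebesgue_on \<Omega>. (norm (jet \<eta> x))\<^sup>2"
  have c: "?c \<ge> 0" by (rule Bochner_Integration.integral_nonneg) simp
  have bound: "norm (l u G) \<le> e * (1 + ?c)" if e: "0 < e" for e
  proof -
    obtain \<psi> where \<psi>: "\<psi> \<in> test_functions \<Omega>" "(LINT x|lebesgue_on \<Omega>. (norm ((u x, G x) - jet \<psi> x))\<^sup>2) < e\<^sup>2"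
      using U e unfolding H10_jet_def by (meson zero_less_power)
    let ?g = "\<lambda>x. \<chi> i. partial_deriv i \<psi> x"
    have L\<psi>: "\<psi> \<in> L2 \<Omega>" "?g \<in> L2 \<Omega>"
      using jet_L2[OF \<Omega> \<psi>(1)] unfolding jet_def by (auto simp: L2_Pair_iff)
    have "l \<psi> ?g = 0"
      using test_integration_by_parts[OF \<Omega> test_function_smooth[OF \<psi>(1)] \<eta>, of i] by (simp add: l_def \<eta>'_def)
    then have "l u G = l (\<lambda>x. u x - \<psi> x) (\<lambda>x. G x - ?g x)"
      using vi[OF L(1)] vi[OF L\<psi>(1)] hi[OF L(2)] hi[OF L\<psi>(2)]
      by (simp add: l_def left_diff_distrib add_eq_0_iff)
    also have "\<dots> = (LINT x|lebesgue_on \<Omega>. (u x - \<psi> x) * \<eta>' x + (G x - ?g x) $ i * \<eta> x)"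
      unfolding l_def
      by (rule Bochner_Integration.integral_add[symmetric, OF vi[OF L2_diff[OF L(1) L\<psi>(1)]] hi[OF L2_diff[OF L(2) L\<psi>(2)]]])
    also have "norm \<dots> \<le> (LINT x|lebesgue_on \<Omega>. (norm ((u x, G x) - jet \<psi> x))\<^sup>2 / e + e * (norm (jet \<eta> x))\<^sup>2)"
    proof (rule order_trans[OF integral_norm_bound], rule integral_mono)
      show "integrable (lebesgue_on \<Omega>) (\<lambda>x. norm ((u x - \<psi> x) * \<eta>' x + (G x - ?g x) $ i * \<eta> x))"
        by (intro integrable_norm Bochner_Integration.integrable_add vi hi L2_diff L L\<psi>)
      show "integrable (lebesgue_on \<Omega>) (\<lambda>x. (norm ((u x, G x) - jet \<psi> x))\<^sup>2 / e + e * (norm (jet \<eta> x))\<^sup>2)"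
        using L2_integrable[OF J] L2_integrable[OF L2_diff[OF H10_jet_L2[OF U] jet_L2[OF \<Omega> \<psi>(1)]]] by simp
      fix x
      let ?D = "norm ((u x, G x) - jet \<psi> x)" and ?j = "norm (jet \<eta> x)"
      have "norm (u x - \<psi> x) \<le> ?D" by (simp add: jet_def norm_fst_le)
      moreover have "norm ((G x - ?g x) $ i) \<le> ?D"
        using order_trans[OF Finite_Cartesian_Product.norm_nth_le[of "G x - ?g x" i] norm_snd_le] by (simp add: jet_def)
      ultimately have "norm ((u x - \<psi> x) * \<eta>' x + (G x - ?g x) $ i * \<eta> x) \<le> ?D * ?j + ?D * ?j"
        by (intro order_trans[OF norm_triangle_ineq] add_mono) (auto simp: norm_mult intro!: mult_mono le)
      \<comment> \<open>Young's inequality with weight \<open>e\<close>. The squared distance was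
        chosen below \<open>e\<^sup>2\<close>, so both resulting terms are of order \<open>e\<close>
        after integration.\<close>
      also have "\<dots> = 2 * (?D / sqrt e) * (sqrt e * ?j)" using e by simp
      also have "\<dots> \<le> (?D / sqrt e)\<^sup>2 + (sqrt e * ?j)\<^sup>2" by (rule sum_squares_bound)
      also have "\<dots> = ?D\<^sup>2 / e + e * ?j\<^sup>2" using e by (simp add: power_mult_distrib power_divide)
      finally show "norm ((u x - \<psi> x) * \<eta>' x + (G x - ?g x) $ i * \<eta> x) \<le> ?D\<^sup>2 / e + e * ?j\<^sup>2" .
    qed
    also have "\<dots> = (LINT x|lebesgue_on \<Omega>. (norm ((u x, G x) - jet \<psi> x))\<^sup>2) / e + e * ?c"
      using L2_integrable[OF J] L2_integrable[OF L2_diff[OF H10_jet_L2[OF U] jet_L2[OF \<Omega> \<psi>(1)]]] by simp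
    also have "\<dots> \<le> e\<^sup>2 / e + e * ?c"
      using e \<psi>(2) by (intro add_right_mono divide_right_mono) auto
    also have "\<dots> = e * (1 + ?c)" using e by (simp add: power2_eq_square algebra_simps)
    finally show ?thesis .
  qed
  have "norm (l u G) \<le> 0 + e" if "e > 0" for e
    using bound[of "e / (1 + ?c)"] that c by simp
  then have "norm (l u G) \<le> 0" by (rule field_le_epsilon)
  then show "(LINT x|lebesgue_on \<Omega>. u x * partial_deriv i \<eta> x) = - (LINT x|lebesgue_on \<Omega>. G x $ i * \<eta> x)"
    by (simp add: l_def \<eta>'_def eq_neg_iff_add_eq_0)
qed

lemma locally_integrable_component:
  fixes G :: "real^'n \<Rightarrow> complex^'n"
  assumes "locally_integrable \<Omega> G" shows "locally_integrable \<Omega> (\<lambda>x. G x $ i)"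
  unfolding locally_integrable_def set_integrable_def
proof (intro allI impI)
  fix K assume "compact K \<and> K \<subseteq> \<Omega>"
  then have "integrable lebesgue (\<lambda>x. indicator K x *\<^sub>R G x)"
    using assms by (auto simp: locally_integrable_def set_integrable_def)
  from integrable_bounded_linear[OF bounded_linear_vec_nth this, of i]
  show "integrable lebesgue (\<lambda>x. indicator K x *\<^sub>R G x $ i)" by simp
qed

lemma locally_integrable_diff:
  assumes "locally_integrable \<Omega> f" "locally_integrable \<Omega> g"
  shows "locally_integrable \<Omega> (\<lambda>x. f x - g x)"
  using assms by (auto simp: locally_integrable_def intro: set_integral_diff)

text \<open>The fundamental lemma is applied to each component of the difference. Splitting the
  integral of the difference needs both parts integrable, which holds because a test function is
  bounded with compact support.\<close>

lemma weak_gradient_unique: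
  fixes u :: "real^'n \<Rightarrow> complex"
  assumes \<Omega>: "open \<Omega>" and G: "has_weak_gradient \<Omega> u G" and H: "has_weak_gradient \<Omega> u H"
  shows "AE x in lebesgue_on \<Omega>. G x = H x"
proof -
  have int: "integrable (lebesgue_on \<Omega>) (\<lambda>x. F x $ i * \<eta> x)"
    if F: "locally_integrable \<Omega> F" and \<eta>: "\<eta> \<in> test_functions \<Omega>" for F :: "real^'n \<Rightarrow> complex^'n" and i \<eta>
  proof -
    obtain K where K: "compact K" "K \<subseteq> \<Omega>" "\<And>x. x \<notin> K \<Longrightarrow> \<eta> x = 0"
      using test_function_support[OF \<eta>] by metis
    note c = smooth_continuous[OF test_function_smooth[OF \<eta>]]
    have "compact (\<eta> ` K)" by (rule compact_continuous_image[OF continuous_on_subset[OF c] K(1)]) simp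
    then obtain B where B: "\<And>x. x \<in> K \<Longrightarrow> norm (\<eta> x) \<le> B"
      using compact_imp_bounded[of "\<eta> ` K"] unfolding bounded_iff by auto
    have i: "integrable lebesgue (\<lambda>x. indicator K x *\<^sub>R F x $ i)"
      using locally_integrable_component[OF F, of i] K by (auto simp: locally_integrable_def set_integrable_def)
    have em: "\<eta> \<in> borel_measurable lebesgue"
      using borel_measurable_lebesgue_on_continuous[OF c, of UNIV] by (simp add: lebesgue_on_UNIV_eq)
    have "integrable lebesgue (\<lambda>x. (indicator K x *\<^sub>R F x $ i) * \<eta> x)"
    proof (rule Bochner_Integration.integrable_bound[OF integrable_mult_right[OF integrable_norm[OF i], of B]])
      show "(\<lambda>x. (indicator K x *\<^sub>R F x $ i) * \<eta> x) \<in> borel_measurable lebesgue"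
        by (rule borel_measurable_times[OF borel_measurable_integrable[OF i] em])
      show "AE x in lebesgue. norm (indicat_real K x *\<^sub>R F x $ i * \<eta> x) \<le> norm (B * norm (indicat_real K x *\<^sub>R F x $ i))"
      proof (rule AE_I2)
        fix x
        show "norm (indicat_real K x *\<^sub>R F x $ i * \<eta> x) \<le> norm (B * norm (indicat_real K x *\<^sub>R F x $ i))"
          using B[of x] norm_ge_zero[of "\<eta> x"] mult_left_mono[of "norm (\<eta> x)" "\<bar>B\<bar>" "norm (F x $ i)"]
          by (cases "x \<in> K") (auto simp: norm_mult abs_mult mult.commute)
      qed
    qed
    moreover have "(\<lambda>x. (indicator K x *\<^sub>R F x $ i) * \<eta> x) = (\<lambda>x. indicator \<Omega> x *\<^sub>R (F x $ i * \<eta> x))"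
      using K(2,3) by (auto simp: fun_eq_iff indicator_def)
    ultimately show ?thesis using \<Omega> by (subst integrable_restrict_space) auto
  qed
  have "AE x in lebesgue_on \<Omega>. G x $ i - H x $ i = 0" for i
  proof (rule AE_0_if_test_integrals_0[OF \<Omega>])
    have li: "locally_integrable \<Omega> G" "locally_integrable \<Omega> H"
      using G H by (auto simp: has_weak_gradient_def)
    then show "locally_integrable \<Omega> (\<lambda>x. G x $ i - H x $ i)"
      by (intro locally_integrable_diff locally_integrable_component)
    fix \<eta> assume \<eta>: "\<eta> \<in> test_functions \<Omega>"
    have "(LINT x|lebesgue_on \<Omega>. G x $ i * \<eta> x) = (LINT x|lebesgue_on \<Omega>. H x $ i * \<eta> x)"
    proof -
      have "(LINT x|lebesgue_on \<Omega>. u x * partial_deriv i \<eta> x) = - (LINT x|lebesgue_on \<Omega>. F x $ i * \<eta> x)"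
        if "has_weak_gradient \<Omega> u F" for F
        using that \<eta> unfolding has_weak_gradient_def by blast
      from this[OF G] this[OF H] show ?thesis by simp
    qed
    then show "(LINT x|lebesgue_on \<Omega>. (G x $ i - H x $ i) * \<eta> x) = 0"
      using int[OF li(1) \<eta>, of i] int[OF li(2) \<eta>, of i] by (simp add: left_diff_distrib)
  qed
  then have "AE x in lebesgue_on \<Omega>. \<forall>i. G x $ i - H x $ i = 0"
    by (simp add: AE_all_countable)
  then show ?thesis by eventually_elim (simp add: vec_eq_iff)
qed

lemma weak_grad_AE_eq:
  assumes "open \<Omega>" "has_weak_gradient \<Omega> u G"
  shows "AE x in lebesgue_on \<Omega>. weak_grad \<Omega> u x = G x"
  unfolding weak_grad_def
  by (rule weak_gradient_unique[OF assms(1) someI[of "has_weak_gradient \<Omega> u"] assms(2)]) (rule assms(2))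

text \<open>\<open>H1_norm\<close> of \<open>u - \<psi>\<close> contains \<open>weak_grad\<close> of
  that difference, a choice unrelated to \<open>G\<close> and to the gradient of
  \<open>\<psi>\<close>. Uniqueness identifies it almost everywhere with the difference of the
  two.\<close>

lemma H10_jetD:
  assumes \<Omega>: "open \<Omega>" and U: "H10_jet \<Omega> (\<lambda>x. (u x, G x))"
  shows "u \<in> H10 \<Omega>" and "AE x in lebesgue_on \<Omega>. weak_grad \<Omega> u x = G x"
proof -
  have L: "u \<in> L2 \<Omega>" "G \<in> L2 \<Omega>" using H10_jet_L2[OF U] by (auto simp: L2_Pair_iff)
  note w = H10_jet_weak_gradient[OF \<Omega> U]
  show "AE x in lebesgue_on \<Omega>. weak_grad \<Omega> u x = G x" by (rule weak_grad_AE_eq[OF \<Omega> w])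
  show "u \<in> H10 \<Omega>"
    unfolding H10_def
  proof (intro CollectI conjI allI impI)
    show "u \<in> H1 \<Omega>" using L w by (auto simp: H1_def)
    fix e :: real assume e: "0 < e"
    obtain \<psi> where \<psi>: "\<psi> \<in> test_functions \<Omega>" "(LINT x|lebesgue_on \<Omega>. (norm ((u x, G x) - jet \<psi> x))\<^sup>2) < e\<^sup>2"
      using U e unfolding H10_jet_def by (meson zero_less_power)
    let ?g = "\<lambda>x. \<chi> i. partial_deriv i \<psi> x"
    have "H10_jet \<Omega> (\<lambda>x. (u x, G x) + jet (\<lambda>x. - \<psi> x) x)"
      by (intro H10_jet_add[OF \<Omega> U] H10_jet_test[OF \<Omega>] test_function_uminus \<psi>)
    then have D: "H10_jet \<Omega> (\<lambda>x. (u x - \<psi> x, G x - ?g x))"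
      by (simp add: jet_uminus[OF test_function_smooth[OF \<psi>(1)]] jet_def)
    then have Lg: "G \<in> L2 \<Omega>" "(\<lambda>x. u x - \<psi> x) \<in> L2 \<Omega>" "(\<lambda>x. G x - ?g x) \<in> L2 \<Omega>"
      using L H10_jet_L2[OF D] by (auto simp: L2_Pair_iff)
    note ae = weak_grad_AE_eq[OF \<Omega> H10_jet_weak_gradient[OF \<Omega> D]]
    have wm: "weak_grad \<Omega> (\<lambda>x. u x - \<psi> x) \<in> borel_measurable (lebesgue_on \<Omega>)"
      using \<Omega> by (intro borel_measurable_lebesgue_on_AE_cong[OF _ L2_measurable[OF Lg(3)] ae]) auto
    have "(LINT x|lebesgue_on \<Omega>. (norm (u x - \<psi> x))\<^sup>2 + (norm (weak_grad \<Omega> (\<lambda>x. u x - \<psi> x) x))\<^sup>2) =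
       (LINT x|lebesgue_on \<Omega>. (norm ((u x, G x) - jet \<psi> x))\<^sup>2)"
    proof (rule integral_cong_AE)
      show "(\<lambda>x. (norm (u x - \<psi> x))\<^sup>2 + (norm (weak_grad \<Omega> (\<lambda>x. u x - \<psi> x) x))\<^sup>2) \<in> borel_measurable (lebesgue_on \<Omega>)"
        using wm L2_measurable[OF Lg(2)] by measurable
      show "(\<lambda>x. (norm ((u x, G x) - jet \<psi> x))\<^sup>2) \<in> borel_measurable (lebesgue_on \<Omega>)"
        using L2_integrable[OF L2_diff[OF H10_jet_L2[OF U] jet_L2[OF \<Omega> \<psi>(1)]]] by simp
      show "AE x in lebesgue_on \<Omega>. (norm (u x - \<psi> x))\<^sup>2 + (norm (weak_grad \<Omega> (\<lambda>x. u x - \<psi> x) x))\<^sup>2 = (norm ((u x, G x) - jet \<psi> x))\<^sup>2"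
        using ae by eventually_elim (simp add: jet_def norm_Pair)
    qed
    then have "H1_norm \<Omega> (\<lambda>x. u x - \<psi> x) < sqrt (e\<^sup>2)"
      unfolding H1_norm_def using \<psi>(2) by (intro real_sqrt_less_mono) simp
    then show "\<exists>\<psi>\<in>test_functions \<Omega>. H1_norm \<Omega> (\<lambda>x. u x - \<psi> x) < e"
      using \<psi>(1) e by auto
  qed
qed

text \<open>Here \<open>u - \<psi>\<close> is not yet known to come from a jet, so its weak gradient
  is found from the definition by linearity. Uniqueness then converts the \<open>H1_norm\<close>
  distance into a distance of jets.\<close>

lemma H10_jetI:
  fixes u :: "real^'n \<Rightarrow> complex"
  assumes \<Omega>: "open \<Omega>" and u: "u \<in> H10 \<Omega>"
  shows "H10_jet \<Omega> (\<lambda>x. (u x, weak_grad \<Omega> u x))"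
proof -
  obtain G where G: "u \<in> L2 \<Omega>" "G \<in> L2 \<Omega>" "has_weak_gradient \<Omega> u G"
    using u by (auto simp: H10_def H1_def)
  have \<Omega>m: "\<Omega> \<in> sets lebesgue" using \<Omega> by simp
  note aeG = weak_grad_AE_eq[OF \<Omega> G(3)]
  have L: "(\<lambda>x. (u x, G x)) \<in> L2 \<Omega>" using G by (simp add: L2_Pair_iff)
  have "H10_jet \<Omega> (\<lambda>x. (u x, G x))"
    unfolding H10_jet_def
  proof (intro conjI allI impI L)
    fix \<epsilon> :: real assume e: "0 < \<epsilon>"
    then obtain \<psi> where \<psi>: "\<psi> \<in> test_functions \<Omega>" "H1_norm \<Omega> (\<lambda>x. u x - \<psi> x) < sqrt \<epsilon>"
      using u by (auto simp: H10_def) (meson real_sqrt_gt_0_iff)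
    let ?g = "\<lambda>x. \<chi> i. partial_deriv i \<psi> x"
    have L\<psi>: "\<psi> \<in> L2 \<Omega>" "?g \<in> L2 \<Omega>"
      using jet_L2[OF \<Omega> \<psi>(1)] unfolding jet_def by (auto simp: L2_Pair_iff)
    have w\<psi>: "has_weak_gradient \<Omega> \<psi> ?g"
      by (rule H10_jet_weak_gradient[OF \<Omega>]) (use H10_jet_test[OF \<Omega> \<psi>(1)] in \<open>simp add: jet_def[abs_def]\<close>)
    have "has_weak_gradient \<Omega> (\<lambda>x. u x - \<psi> x) (\<lambda>x. G x - ?g x)"
      unfolding has_weak_gradient_def
    proof (intro conjI ballI allI)
      show "locally_integrable \<Omega> (\<lambda>x. u x - \<psi> x)" "locally_integrable \<Omega> (\<lambda>x. G x - ?g x)"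
        using G(3) w\<psi> by (auto simp: has_weak_gradient_def intro!: locally_integrable_diff)
      fix \<eta> i assume \<eta>: "\<eta> \<in> test_functions \<Omega>"
      have J: "\<eta> \<in> L2 \<Omega>" "(\<lambda>x. \<chi> i. partial_deriv i \<eta> x) \<in> L2 \<Omega>"
        using jet_L2[OF \<Omega> \<eta>] unfolding jet_def by (auto simp: L2_Pair_iff)
      have c: "(\<lambda>x. H x $ i) \<in> L2 \<Omega>" if H: "H \<in> L2 \<Omega>" for H :: "real^'n \<Rightarrow> complex^'n"
      proof (rule L2_bound[OF H])
        show "(\<lambda>x. H x $ i) \<in> borel_measurable (lebesgue_on \<Omega>)"
          by (rule measurable_compose[OF L2_measurable[OF H]]) (intro borel_measurable_continuous_onI continuous_intros)
        show "AE x in lebesgue_on \<Omega>. norm (H x $ i) \<le> 1 * norm (H x)"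
          using Finite_Cartesian_Product.norm_nth_le by (intro AE_I2) auto
      qed
      have p: "integrable (lebesgue_on \<Omega>) (\<lambda>x. f x * g x)" if "f \<in> L2 \<Omega>" "g \<in> L2 \<Omega>" for f g :: "real^'n \<Rightarrow> complex"
        by (rule integrable_L2_prod[OF that borel_measurable_times[OF that[THEN L2_measurable]], of 1])
          (simp add: norm_mult)
      have P: "integrable (lebesgue_on \<Omega>) (\<lambda>x. f x * partial_deriv i \<eta> x)" if "f \<in> L2 \<Omega>" for f :: "real^'n \<Rightarrow> complex"
        using p[OF that c[OF J(2)]] by simp
      have Q: "integrable (lebesgue_on \<Omega>) (\<lambda>x. f x $ i * \<eta> x)" if "f \<in> L2 \<Omega>" for f :: "real^'n \<Rightarrow> complex^'n"
        using p[OF c[OF that] J(1)] by simp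
      have "(LINT x|lebesgue_on \<Omega>. u x * partial_deriv i \<eta> x) = - (LINT x|lebesgue_on \<Omega>. G x $ i * \<eta> x)"
           "(LINT x|lebesgue_on \<Omega>. \<psi> x * partial_deriv i \<eta> x) = - (LINT x|lebesgue_on \<Omega>. ?g x $ i * \<eta> x)"
        using G(3) w\<psi> \<eta> unfolding has_weak_gradient_def by blast+
      then show "(LINT x|lebesgue_on \<Omega>. (u x - \<psi> x) * partial_deriv i \<eta> x) = - (LINT x|lebesgue_on \<Omega>. (G x - ?g x) $ i * \<eta> x)"
        using P[OF G(1)] P[OF L\<psi>(1)] Q[OF G(2)] Q[OF L\<psi>(2)] by (simp add: left_diff_distrib)
    qed
    note ae = weak_grad_AE_eq[OF \<Omega> this]
    have wm: "weak_grad \<Omega> (\<lambda>x. u x - \<psi> x) \<in> borel_measurable (lebesgue_on \<Omega>)"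
      by (rule borel_measurable_lebesgue_on_AE_cong[OF \<Omega>m L2_measurable[OF L2_diff[OF G(2) L\<psi>(2)]] ae])
    have "(LINT x|lebesgue_on \<Omega>. (norm ((u x, G x) - jet \<psi> x))\<^sup>2) =
      (LINT x|lebesgue_on \<Omega>. (norm (u x - \<psi> x))\<^sup>2 + (norm (weak_grad \<Omega> (\<lambda>x. u x - \<psi> x) x))\<^sup>2)"
    proof (rule integral_cong_AE)
      show "(\<lambda>x. (norm (u x - \<psi> x))\<^sup>2 + (norm (weak_grad \<Omega> (\<lambda>x. u x - \<psi> x) x))\<^sup>2) \<in> borel_measurable (lebesgue_on \<Omega>)"
        using wm L2_measurable[OF L2_diff[OF G(1) L\<psi>(1)]] by measurable
      show "(\<lambda>x. (norm ((u x, G x) - jet \<psi> x))\<^sup>2) \<in> borel_measurable (lebesgue_on \<Omega>)"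
        using L2_integrable[OF L2_diff[OF L jet_L2[OF \<Omega> \<psi>(1)]]] by simp
      show "AE x in lebesgue_on \<Omega>. (norm ((u x, G x) - jet \<psi> x))\<^sup>2 = (norm (u x - \<psi> x))\<^sup>2 + (norm (weak_grad \<Omega> (\<lambda>x. u x - \<psi> x) x))\<^sup>2"
        using ae by eventually_elim (simp add: jet_def norm_Pair)
    qed
    moreover have "sqrt (LINT x|lebesgue_on \<Omega>. (norm (u x - \<psi> x))\<^sup>2 + (norm (weak_grad \<Omega> (\<lambda>x. u x - \<psi> x) x))\<^sup>2) < sqrt \<epsilon>"
      using \<psi>(2) by (simp only: H1_norm_def)
    ultimately have "(LINT x|lebesgue_on \<Omega>. (norm ((u x, G x) - jet \<psi> x))\<^sup>2) < \<epsilon>" by simp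
    with \<psi>(1) show "\<exists>\<psi>\<in>test_functions \<Omega>. (LINT x|lebesgue_on \<Omega>. (norm ((u x, G x) - jet \<psi> x))\<^sup>2) < \<epsilon>"
      by (rule_tac bexI)
  qed
  then show ?thesis
    by (rule H10_jet_AE_cong[OF \<Omega>]) (use aeG in auto)
qed

section \<open>Chain rule for radial functions\<close>

text \<open>Every real linear map of the complex plane has the form \<open>h \<mapsto> p * h + q * cnj h\<close>. So \<open>rlin\<close> is the
  shape of the chain rule for a real differentiable outer function \<open>z \<mapsto> k z * z\<close>, and \<open>mlt\<close> maps the
  pair of a function and its gradient to that of the composition.\<close>

definition rlin :: "complex \<Rightarrow> complex \<Rightarrow> complex^'n \<Rightarrow> complex^'n" where
  "rlin p q g = (\<chi> i. p * g $ i + q * cnj (g $ i))"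

definition mlt :: "complex \<Rightarrow> complex \<Rightarrow> complex \<Rightarrow> complex \<times> (complex^'n) \<Rightarrow> complex \<times> (complex^'n)" where
  "mlt k p q U = (k * fst U, rlin p q (snd U))"

lemma norm_rlin_le: "norm (rlin p q g) \<le> (norm p + norm q) * norm g"
proof -
  have "norm (rlin p q g) \<le> norm ((norm p + norm q) *\<^sub>R g)"
    unfolding norm_vec_def
  proof (rule L2_set_mono)
    show "norm (rlin p q g $ i) \<le> norm (((norm p + norm q) *\<^sub>R g) $ i)" for i
      using norm_triangle_ineq[of "p * g $ i" "q * cnj (g $ i)"]
      unfolding vector_scaleR_component norm_scaleR
      by (simp add: rlin_def norm_mult distrib_right)
  qed simp
  then show ?thesis by simp
qed

lemma norm_mlt_le:
  assumes "norm k \<le> L" "norm p + norm q \<le> L"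
  shows "norm (mlt k p q U) \<le> 2 * L * norm U"
proof -
  have "norm (mlt k p q U) \<le> norm (k * fst U) + norm (rlin p q (snd U))"
    by (simp add: mlt_def norm_Pair sqrt_sum_squares_le_sum)
  also have "norm (k * fst U) \<le> L * norm U"
    unfolding norm_mult using assms(1) norm_fst_le[of "fst U" "snd U"]
    by (intro mult_mono) (auto intro: order_trans[OF norm_ge_zero])
  also have "norm (rlin p q (snd U)) \<le> L * norm U"
    by (rule order_trans[OF norm_rlin_le mult_mono[OF assms(2)]])
      (use assms(2) norm_snd_le[of "snd U" "fst U"] order_trans[OF norm_ge_zero assms(1)] in auto)
  finally show ?thesis by simp
qed

lemma mlt_diff: "mlt k p q (U - V) = mlt k p q U - mlt k p q V"
  by (simp add: mlt_def rlin_def vec_eq_iff algebra_simps)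

lemma continuous_mlt: "continuous_on UNIV (\<lambda>(k, p, q, U). mlt k p q U)"
  unfolding mlt_def rlin_def case_prod_beta
  by (intro continuous_intros)

lemma tendsto_mlt:
  assumes "(k \<longlongrightarrow> k') F" "(p \<longlongrightarrow> p') F" "(q \<longlongrightarrow> q') F" "(U \<longlongrightarrow> U') F"
  shows "((\<lambda>n. mlt (k n) (p n) (q n) (U n)) \<longlongrightarrow> mlt k' p' q' U') F"
  unfolding mlt_def rlin_def using assms
  by (intro tendsto_intros)

lemma borel_measurable_mlt:
  fixes U :: "'a \<Rightarrow> complex \<times> (complex^'n)"
  assumes "k \<in> borel_measurable M" "p \<in> borel_measurable M" "q \<in> borel_measurable M" "U \<in> borel_measurable M"
  shows "(\<lambda>x. mlt (k x) (p x) (q x) (U x)) \<in> borel_measurable M"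
proof -
  have "(\<lambda>x. (k x, p x, q x, U x)) \<in> borel_measurable M"
    using assms by (intro borel_measurable_Pair)
  from measurable_compose[OF this borel_measurable_continuous_onI[OF continuous_mlt]]
  show ?thesis by simp
qed

lemma borel_measurable_fst:
  fixes U :: "'a \<Rightarrow> complex \<times> (complex^'n)"
  assumes "U \<in> borel_measurable M" shows "(\<lambda>x. fst (U x)) \<in> borel_measurable M"
  by (rule measurable_compose[OF assms]) (intro borel_measurable_continuous_onI continuous_intros)

lemma borel_measurable_mlt_fst:
  fixes U :: "'a \<Rightarrow> complex \<times> (complex^'n)"
  assumes "k \<in> borel_measurable borel" "p \<in> borel_measurable borel" "q \<in> borel_measurable borel"
    "U \<in> borel_measurable M"
  shows "(\<lambda>x. mlt (k (fst (U x))) (p (fst (U x))) (q (fst (U x))) (U x)) \<in> borel_measurable M"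
  using assms measurable_compose[OF borel_measurable_fst[OF assms(4)]]
  by (intro borel_measurable_mlt) auto

text \<open>The limit in the outer function with the inner one fixed. The coefficients have to
  converge only where \<open>U\<close> is nonzero; this admits outer functions without a derivative
  at the origin, once gradients are known to vanish on zero sets.\<close>

lemma H10_jet_mlt_limit:
  fixes U :: "real^'n \<Rightarrow> complex \<times> (complex^'n)"
  assumes \<Omega>: "open \<Omega>" and U: "U \<in> L2 \<Omega>"
    and V: "\<And>n. H10_jet \<Omega> (\<lambda>x. mlt (kn n (fst (U x))) (pn n (fst (U x))) (qn n (fst (U x))) (U x))"
    and bound: "\<And>n x. norm (kn n (fst (U x))) \<le> L"
       "\<And>n x. norm (pn n (fst (U x))) + norm (qn n (fst (U x))) \<le> L"
    and m: "k \<in> borel_measurable borel" "p \<in> borel_measurable borel" "q \<in> borel_measurable borel"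
    and lim: "AE x in lebesgue_on \<Omega>. U x = 0 \<or>
       ((\<lambda>n. kn n (fst (U x))) \<longlonglongrightarrow> k (fst (U x)) \<and> (\<lambda>n. pn n (fst (U x))) \<longlonglongrightarrow> p (fst (U x))
         \<and> (\<lambda>n. qn n (fst (U x))) \<longlonglongrightarrow> q (fst (U x)))"
  shows "H10_jet \<Omega> (\<lambda>x. mlt (k (fst (U x))) (p (fst (U x))) (q (fst (U x))) (U x))"
proof (rule H10_jet_dominated[OF \<Omega> V _ U])
  show "(\<lambda>x. mlt (k (fst (U x))) (p (fst (U x))) (q (fst (U x))) (U x)) \<in> borel_measurable (lebesgue_on \<Omega>)"
    by (rule borel_measurable_mlt_fst[OF m L2_measurable[OF U]])
  show "AE x in lebesgue_on \<Omega>. norm (mlt (kn n (fst (U x))) (pn n (fst (U x))) (qn n (fst (U x))) (U x)) \<le> (2 * L) * norm (U x)" for n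
    using bound by (intro AE_I2 norm_mlt_le)
  show "AE x in lebesgue_on \<Omega>. (\<lambda>n. mlt (kn n (fst (U x))) (pn n (fst (U x))) (qn n (fst (U x))) (U x))
     \<longlonglongrightarrow> mlt (k (fst (U x))) (p (fst (U x))) (q (fst (U x))) (U x)"
    using lim
  proof eventually_elim
    case (elim x)
    have z: "mlt k p q 0 = 0" for k p q
      by (simp add: mlt_def rlin_def zero_prod_def vec_eq_iff)
    show ?case using elim by (cases "U x = 0") (auto intro!: tendsto_mlt simp: z)
  qed
qed

text \<open>The limit in the inner function with the outer one fixed. The error splits into
  coefficients at \<open>\<psi> n\<close> applied to \<open>jet (\<psi> n) - U\<close>, controlled
  by their bound, and a difference of coefficients applied to \<open>U\<close>, controlled by
  dominated convergence along an almost everywhere convergent subsequence.\<close>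

lemma H10_jet_mlt:
  fixes U :: "real^'n \<Rightarrow> complex \<times> (complex^'n)"
  assumes \<Omega>: "open \<Omega>" and U: "H10_jet \<Omega> U"
    and test: "\<And>\<psi>. \<psi> \<in> test_functions \<Omega> \<Longrightarrow> H10_jet \<Omega> (\<lambda>x. mlt (k (\<psi> x)) (p (\<psi> x)) (q (\<psi> x)) (jet \<psi> x))"
    and cont: "continuous_on UNIV k" "continuous_on UNIV p" "continuous_on UNIV q"
    and bound: "\<And>z. norm (k z) \<le> L" "\<And>z. norm (p z) + norm (q z) \<le> L"
  shows "H10_jet \<Omega> (\<lambda>x. mlt (k (fst (U x))) (p (fst (U x))) (q (fst (U x))) (U x))" (is "H10_jet \<Omega> ?V")
proof -
  note LU = H10_jet_L2[OF U]
  note m = cont[THEN borel_measurable_continuous_onI]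
  have L0: "0 \<le> L" using bound(1)[of 0] norm_ge_zero order_trans by blast
  have LV: "(\<lambda>x. mlt (k (fst (W x))) (p (fst (W x))) (q (fst (W x))) (U x)) \<in> L2 \<Omega>"
    if "W \<in> L2 \<Omega>" for W :: "real^'n \<Rightarrow> complex \<times> (complex^'n)"
    by (rule L2_bound[OF LU, of _ "2 * L"])
      (use measurable_compose[OF borel_measurable_fst[OF L2_measurable[OF that]]] m L2_measurable[OF LU] bound in
        \<open>auto intro!: borel_measurable_mlt AE_I2 norm_mlt_le\<close>)
  obtain \<psi>0 where \<psi>0: "\<And>n::nat. \<psi>0 n \<in> test_functions \<Omega>"
    "(\<lambda>n. LINT x|lebesgue_on \<Omega>. (norm (jet (\<psi>0 n) x - U x))\<^sup>2) \<longlonglongrightarrow> 0"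
    using H10_jet_approx[OF U] by blast
  obtain r where r: "strict_mono r" "AE x in lebesgue_on \<Omega>. (\<lambda>n. jet (\<psi>0 (r n)) x) \<longlonglongrightarrow> U x"
    using L2_AE_subseq[OF jet_L2[OF \<Omega> \<psi>0(1)] LU \<psi>0(2)] by blast
  define \<psi> where "\<psi> n = \<psi>0 (r n)" for n
  have \<psi>: "\<psi> n \<in> test_functions \<Omega>" for n by (simp add: \<psi>_def \<psi>0(1))
  note LJ = jet_L2[OF \<Omega> \<psi>]
  have lim: "(\<lambda>n. LINT x|lebesgue_on \<Omega>. (norm (jet (\<psi> n) x - U x))\<^sup>2) \<longlonglongrightarrow> 0"
    using LIMSEQ_subseq_LIMSEQ[OF \<psi>0(2) r(1)] by (simp add: \<psi>_def o_def)
  have ae: "AE x in lebesgue_on \<Omega>. (\<lambda>n. jet (\<psi> n) x) \<longlonglongrightarrow> U x"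
    using r(2) by (simp add: \<psi>_def)
  let ?M = "\<lambda>n x. mlt (k (\<psi> n x)) (p (\<psi> n x)) (q (\<psi> n x))"
  have fj: "fst (jet \<psi> x) = \<psi> x" for \<psi> :: "real^'n \<Rightarrow> complex" and x by (simp add: jet_def)
  have LMU: "(\<lambda>x. ?M n x (U x)) \<in> L2 \<Omega>" for n
    using LV[OF LJ[of n]] by (simp add: fj)
  have lim2: "(\<lambda>n. LINT x|lebesgue_on \<Omega>. (norm (?M n x (U x) - ?V x))\<^sup>2) \<longlonglongrightarrow> 0"
  proof (rule L2_dominated_convergence(1)[OF L2_measurable[OF LMU] L2_measurable[OF LV[OF LU]] LU])
    show "AE x in lebesgue_on \<Omega>. norm (?M n x (U x)) \<le> (2 * L) * norm (U x)" for n
      using bound by (intro AE_I2 norm_mlt_le)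
    show "AE x in lebesgue_on \<Omega>. (\<lambda>n. ?M n x (U x)) \<longlonglongrightarrow> ?V x"
      using ae
    proof eventually_elim
      case (elim x)
      have "(\<lambda>n. \<psi> n x) \<longlonglongrightarrow> fst (U x)"
        using tendsto_fst[OF elim] by (simp add: fj)
      then show ?case
        using cont by (intro tendsto_mlt tendsto_const) (auto intro: continuous_on_tendsto_compose)
    qed
  qed
  show ?thesis
  proof (rule H10_jet_limit[OF \<Omega> test[OF \<psi>] LV[OF LU]])
    \<comment> \<open>The 8 is 2 from the triangle inequality times the square of the operator bound
      \<open>2 * L\<close>.\<close>
    have "(\<lambda>n. 8 * L\<^sup>2 * (LINT x|lebesgue_on \<Omega>. (norm (jet (\<psi> n) x - U x))\<^sup>2) +
       2 * (LINT x|lebesgue_on \<Omega>. (norm (?M n x (U x) - ?V x))\<^sup>2)) \<longlonglongrightarrow> 8 * L\<^sup>2 * 0 + 2 * 0"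
      by (intro tendsto_intros lim lim2)
    then have up: "(\<lambda>n. 8 * L\<^sup>2 * (LINT x|lebesgue_on \<Omega>. (norm (jet (\<psi> n) x - U x))\<^sup>2) +
       2 * (LINT x|lebesgue_on \<Omega>. (norm (?M n x (U x) - ?V x))\<^sup>2)) \<longlonglongrightarrow> 0" by simp
    show "(\<lambda>n. LINT x|lebesgue_on \<Omega>. (norm (?M n x (jet (\<psi> n) x) - ?V x))\<^sup>2) \<longlonglongrightarrow> 0"
    proof (rule tendsto_sandwich[OF _ _ tendsto_const up]; intro always_eventually allI)
      fix n
      show "0 \<le> (LINT x|lebesgue_on \<Omega>. (norm (?M n x (jet (\<psi> n) x) - ?V x))\<^sup>2)"
        by (rule Bochner_Integration.integral_nonneg) simp
      note LMJ = H10_jet_L2[OF test[OF \<psi>[of n]]]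
      have "(LINT x|lebesgue_on \<Omega>. (norm (?M n x (jet (\<psi> n) x) - ?V x))\<^sup>2) \<le>
         2 * (LINT x|lebesgue_on \<Omega>. (norm (?M n x (jet (\<psi> n) x) - ?M n x (U x)))\<^sup>2) +
         2 * (LINT x|lebesgue_on \<Omega>. (norm (?M n x (U x) - ?V x))\<^sup>2)"
        by (rule L2_dist_triangle[OF LMJ LMU LV[OF LU]])
      also have "(LINT x|lebesgue_on \<Omega>. (norm (?M n x (jet (\<psi> n) x) - ?M n x (U x)))\<^sup>2) \<le>
         (LINT x|lebesgue_on \<Omega>. 4 * L\<^sup>2 * (norm (jet (\<psi> n) x - U x))\<^sup>2)"
      proof (rule integral_mono[OF L2_integrable[OF L2_diff[OF LMJ LMU]]])
        show "integrable (lebesgue_on \<Omega>) (\<lambda>x. 4 * L\<^sup>2 * (norm (jet (\<psi> n) x - U x))\<^sup>2)"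
          using L2_integrable[OF L2_diff[OF LJ LU]] by simp
        fix x
        have "norm (?M n x (jet (\<psi> n) x - U x)) \<le> 2 * L * norm (jet (\<psi> n) x - U x)"
          by (intro norm_mlt_le bound)
        then have "(norm (?M n x (jet (\<psi> n) x - U x)))\<^sup>2 \<le> (2 * L * norm (jet (\<psi> n) x - U x))\<^sup>2"
          by (intro power_mono) auto
        then show "(norm (?M n x (jet (\<psi> n) x) - ?M n x (U x)))\<^sup>2 \<le> 4 * L\<^sup>2 * (norm (jet (\<psi> n) x - U x))\<^sup>2"
          by (simp add: mlt_diff power_mult_distrib)
      qed
      also have "\<dots> = 4 * L\<^sup>2 * (LINT x|lebesgue_on \<Omega>. (norm (jet (\<psi> n) x - U x))\<^sup>2)" by simp
      finally show "(LINT x|lebesgue_on \<Omega>. (norm (?M n x (jet (\<psi> n) x) - ?V x))\<^sup>2) \<le>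
         8 * L\<^sup>2 * (LINT x|lebesgue_on \<Omega>. (norm (jet (\<psi> n) x - U x))\<^sup>2) +
         2 * (LINT x|lebesgue_on \<Omega>. (norm (?M n x (U x) - ?V x))\<^sup>2)" by simp
    qed
  qed
qed

text \<open>The square of the modulus is differentiable everywhere, unlike the modulus itself. Its
  differential is \<open>\<psi>\<close> times the conjugate of \<open>d\<psi>\<close> plus the
  conjugate of \<open>\<psi>\<close> times \<open>d\<psi>\<close>, which distributes
  \<open>h'\<close> over the linear and the antilinear coefficient.\<close>

lemma jet_radial:
  fixes \<psi> :: "real^'n \<Rightarrow> complex"
  assumes \<psi>: "smooth \<psi>" and h: "(h has_real_derivative h' ((cmod (\<psi> x))\<^sup>2)) (at ((cmod (\<psi> x))\<^sup>2))"
  shows "jet (\<lambda>x. \<psi> x * of_real (h ((cmod (\<psi> x))\<^sup>2))) x =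
    mlt (of_real (h ((cmod (\<psi> x))\<^sup>2))) (of_real (h ((cmod (\<psi> x))\<^sup>2) + h' ((cmod (\<psi> x))\<^sup>2) * (cmod (\<psi> x))\<^sup>2))
      (of_real (h' ((cmod (\<psi> x))\<^sup>2)) * (\<psi> x)\<^sup>2) (jet \<psi> x)"
proof -
  let ?d = "frechet_derivative \<psi> (at x)"
  note d = smooth_has_derivative[OF \<psi>, of x]
  have "((\<lambda>x. (cmod (\<psi> x))\<^sup>2) has_derivative (\<lambda>v. 2 * (\<psi> x \<bullet> ?d v))) (at x)"
    unfolding power2_norm_eq_inner
    using has_derivative_inner[OF d d] by (simp add: inner_commute)
  from has_derivative_compose[OF this h[unfolded has_field_derivative_def]]
  have "((\<lambda>x. h ((cmod (\<psi> x))\<^sup>2)) has_derivative (\<lambda>v. h' ((cmod (\<psi> x))\<^sup>2) * (2 * (\<psi> x \<bullet> ?d v)))) (at x)" .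
  note D = has_derivative_mult[OF d has_derivative_of_real[OF this]]
  have in2: "complex_of_real (z \<bullet> w) = (z * cnj w + cnj z * w) / 2" for z w
    by (simp add: complex_eq_iff inner_complex_def)
  have sq: "complex_of_real (cmod z) * complex_of_real (cmod z) = z * cnj z" for z
    using complex_norm_square[of z] by (simp add: power2_eq_square)
  have "partial_deriv i (\<lambda>x. \<psi> x * of_real (h ((cmod (\<psi> x))\<^sup>2))) x =
     \<psi> x * of_real (h' ((cmod (\<psi> x))\<^sup>2) * (2 * (\<psi> x \<bullet> partial_deriv i \<psi> x))) + partial_deriv i \<psi> x * of_real (h ((cmod (\<psi> x))\<^sup>2))" for i
    by (subst partial_deriv_eq[OF D]) (simp add: partial_deriv_def)
  then show ?thesis
    by (simp add: jet_def mlt_def rlin_def vec_eq_iff in2 power2_eq_square sq algebra_simps)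
qed

lemma radial_polynomial_test:
  fixes \<psi> :: "real^'n \<Rightarrow> complex" and c :: "nat \<Rightarrow> real"
  assumes \<psi>: "\<psi> \<in> test_functions \<Omega>"
  shows "(\<lambda>x. \<psi> x * of_real (c0 + (\<Sum>i\<le>n. c i * ((cmod (\<psi> x))\<^sup>2) ^ Suc i))) \<in> test_functions \<Omega>"
proof (rule test_function_mult[OF \<psi>])
  note s = test_function_smooth[OF \<psi>]
  have "smooth (\<lambda>x. of_real c0 + (\<Sum>i\<le>n. of_real (c i) * (\<psi> x * cnj (\<psi> x)) ^ Suc i))"
    by (intro smooth_add smooth_sum smooth_mult smooth_power smooth_const smooth_cnj s)
  then show "smooth (\<lambda>x. complex_of_real (c0 + (\<Sum>i\<le>n. c i * ((cmod (\<psi> x))\<^sup>2) ^ Suc i)))"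
    by (simp add: complex_norm_square[symmetric])
qed

text \<open>Weierstrass approximation of the derivative, integrated term by term from the exact
  value \<open>h 0\<close>; the mean value inequality then gives the error
  \<open>e * R\<close>.\<close>

lemma C1_polynomial_approximation:
  fixes h h' :: "real \<Rightarrow> real"
  assumes R: "0 \<le> R" and h: "\<And>t. t \<in> {0..R} \<Longrightarrow> (h has_real_derivative h' t) (at t within {0..R})"
    and cont: "continuous_on {0..R} h'" and e: "0 < e"
  shows "\<exists>c n. \<forall>t\<in>{0..R}. \<bar>h 0 + (\<Sum>i\<le>n. c i / real (Suc i) * t ^ Suc i) - h t\<bar> \<le> e * R \<and>
     \<bar>(\<Sum>i\<le>n. c i * t ^ i) - h' t\<bar> \<le> e"
proof -
  have "\<exists>g. real_polynomial_function g \<and> (\<forall>x\<in>{0..R}. \<bar>h' x - g x\<bar> < e)"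
    using Stone_Weierstrass_real_polynomial_function[OF compact_Icc cont e] by metis
  then obtain c n where c: "\<forall>x\<in>{0..R}. \<bar>h' x - (\<Sum>i\<le>n. c i * x ^ i)\<bar> < e"
    by (auto simp: real_polynomial_function_iff_sum)
  have "\<bar>h 0 + (\<Sum>i\<le>n. c i / real (Suc i) * t ^ Suc i) - h t\<bar> \<le> e * R" if t: "t \<in> {0..R}" for t
  proof -
    let ?F = "\<lambda>t. (\<Sum>i\<le>n. c i / real (Suc i) * t ^ Suc i) - h t"
    have D: "(?F has_real_derivative (\<Sum>i\<le>n. c i * s ^ i) - h' s) (at s within {0..R})" if "s \<in> {0..R}" for s
    proof (intro DERIV_diff h that DERIV_sum)
      fix i
      have "((\<lambda>t. c i / real (Suc i) * t ^ Suc i) has_real_derivative c i / real (Suc i) * (real (Suc i) * s ^ i)) (at s within {0..R})"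
        using DERIV_power[OF DERIV_ident, where n = "Suc i"] by (intro DERIV_cmult) simp
      then show "((\<lambda>t. c i / real (Suc i) * t ^ Suc i) has_real_derivative c i * s ^ i) (at s within {0..R})"
        by (simp del: power_Suc of_nat_Suc)
    qed
    have "norm (?F t - ?F 0) \<le> e * norm (t - 0)"
      by (rule field_differentiable_bound[OF convex_real_interval(5) D])
        (use c t R in \<open>auto simp: abs_minus_commute less_imp_le\<close>)
    also have "\<dots> \<le> e * R" using t e by (intro mult_left_mono) auto
    finally show ?thesis by simp
  qed
  with c show ?thesis by (auto simp: abs_minus_commute less_imp_le intro!: exI[of _ c] exI[of _ n])
qed

text \<open>With \<open>h\<close> only continuously differentiable the composition need not be a
  test function. Polynomials approximating \<open>h\<close> together with its derivative on the
  bounded range of the squared modulus do give test functions.\<close>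

lemma H10_jet_radial_test:
  fixes \<psi> :: "real^'n \<Rightarrow> complex"
  assumes \<Omega>: "open \<Omega>" and \<psi>: "\<psi> \<in> test_functions \<Omega>"
    and h: "\<And>t. t \<ge> 0 \<Longrightarrow> (h has_real_derivative h' t) (at t within {0..})"
    and cont: "continuous_on {0..} h'"
  shows "H10_jet \<Omega> (\<lambda>x. mlt (of_real (h ((cmod (\<psi> x))\<^sup>2))) (of_real (h ((cmod (\<psi> x))\<^sup>2) + h' ((cmod (\<psi> x))\<^sup>2) * (cmod (\<psi> x))\<^sup>2))
      (of_real (h' ((cmod (\<psi> x))\<^sup>2)) * (\<psi> x)\<^sup>2) (jet \<psi> x))"
proof -
  obtain K where K: "compact K" "\<And>x. x \<notin> K \<Longrightarrow> \<psi> x = 0"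
    using test_function_support[OF \<psi>] by metis
  note sm = test_function_smooth[OF \<psi>]
  have "compact (\<psi> ` K)"
    by (rule compact_continuous_image[OF continuous_on_subset[OF smooth_continuous[OF sm]] K(1)]) simp
  then obtain B where B: "\<And>x. x \<in> K \<Longrightarrow> norm (\<psi> x) \<le> B"
    using compact_imp_bounded[of "\<psi> ` K"] unfolding bounded_iff by auto
  define R where "R = B\<^sup>2"
  have R0: "0 \<le> R" by (simp add: R_def)
  have R: "(cmod (\<psi> x))\<^sup>2 \<in> {0..R}" for x
    using B[of x] K(2)[of x] by (cases "x \<in> K") (auto simp: R_def intro: power_mono)
  have hR: "(h has_real_derivative h' t) (at t within {0..R})" if "t \<in> {0..R}" for t
    using that by (intro has_field_derivative_subset[OF h]) auto
  have cR: "continuous_on {0..R} h'" by (rule continuous_on_subset[OF cont]) auto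
  have chR: "continuous_on {0..R} h"
    using hR DERIV_continuous_on by blast
  have bdd: "\<exists>M\<ge>0. \<forall>t\<in>{0..R}. \<bar>f t\<bar> \<le> M" if f: "continuous_on {0..R} f" for f :: "real \<Rightarrow> real"
  proof -
    obtain M where "\<forall>t\<in>{0..R}. \<bar>f t\<bar> \<le> M"
      using compact_imp_bounded[OF compact_continuous_image[OF f compact_Icc]]
      unfolding bounded_iff by auto
    then show ?thesis by (intro exI[of _ "max 0 M"]) auto
  qed
  obtain M where M: "M \<ge> 0" "\<And>t. t \<in> {0..R} \<Longrightarrow> \<bar>h t\<bar> \<le> M" using bdd[OF chR] by auto
  obtain M' where M': "M' \<ge> 0" "\<And>t. t \<in> {0..R} \<Longrightarrow> \<bar>h' t\<bar> \<le> M'" using bdd[OF cR] by auto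
  define Q where "Q k c n \<longleftrightarrow> (\<forall>t\<in>{0..R}. \<bar>h 0 + (\<Sum>i\<le>n. c i / real (Suc i) * t ^ Suc i) - h t\<bar> \<le> inverse (real (Suc k)) * R \<and>
     \<bar>(\<Sum>i\<le>n. c i * t ^ i) - h' t\<bar> \<le> inverse (real (Suc k)))" for k n :: nat and c :: "nat \<Rightarrow> real"
  have "\<exists>c n. Q k c n" for k
    unfolding Q_def by (rule C1_polynomial_approximation[OF R0 hR cR]) auto
  then obtain c n where "\<And>k. Q k (c k) (n k)" by metis
  then have cn: "\<And>k t. t \<in> {0..R} \<Longrightarrow> \<bar>h 0 + (\<Sum>i\<le>n k. c k i / real (Suc i) * t ^ Suc i) - h t\<bar> \<le> inverse (real (Suc k)) * R"
     "\<And>k t. t \<in> {0..R} \<Longrightarrow> \<bar>(\<Sum>i\<le>n k. c k i * t ^ i) - h' t\<bar> \<le> inverse (real (Suc k))"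
    unfolding Q_def by blast+
  define H where "H k t = h 0 + (\<Sum>i\<le>n k. c k i / real (Suc i) * t ^ Suc i)" for k t
  define H' where "H' k t = (\<Sum>i\<le>n k. c k i * t ^ i)" for k t
  have HH: "\<bar>H k t - h t\<bar> \<le> inverse (real (Suc k)) * R" "\<bar>H' k t - h' t\<bar> \<le> inverse (real (Suc k))"
    if "t \<in> {0..R}" for k t
    using cn[OF that] by (auto simp: H_def H'_def)
  have HD: "(H k has_real_derivative H' k t) (at t)" for k t
  proof -
    have "((\<lambda>t. c k i / real (Suc i) * t ^ Suc i) has_real_derivative c k i * t ^ i) (at t)" for i
    proof -
      have "((\<lambda>t. c k i / real (Suc i) * t ^ Suc i) has_real_derivative c k i / real (Suc i) * (real (Suc i) * t ^ i)) (at t)"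
        using DERIV_power[OF DERIV_ident, where n = "Suc i"] by (intro DERIV_cmult) simp
      then show ?thesis by (simp del: power_Suc of_nat_Suc)
    qed
    then have "(H k has_real_derivative 0 + H' k t) (at t)"
      unfolding H_def[abs_def] H'_def by (intro DERIV_add DERIV_const DERIV_sum)
    then show ?thesis by simp
  qed
  have i1: "inverse (real (Suc k)) \<le> 1" for k by (simp add: field_simps)
  have HM: "\<bar>H k t\<bar> \<le> M + R" "\<bar>H' k t\<bar> \<le> M' + 1" if "t \<in> {0..R}" for k t
  proof -
    have "inverse (real (Suc k)) * R \<le> 1 * R" using R0 i1 by (intro mult_right_mono)
    then show "\<bar>H k t\<bar> \<le> M + R" using HH(1)[OF that, of k] M(2)[OF that] by linarith
    show "\<bar>H' k t\<bar> \<le> M' + 1" using HH(2)[OF that, of k] M'(2)[OF that] i1[of k] by linarith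
  qed
  have lims: "(\<lambda>k. H k t) \<longlonglongrightarrow> h t" "(\<lambda>k. H' k t) \<longlonglongrightarrow> h' t" if "t \<in> {0..R}" for t
  proof -
    have i0: "(\<lambda>k. inverse (real (Suc k)) * R) \<longlonglongrightarrow> 0"
      using tendsto_mult_right[OF LIMSEQ_inverse_real_of_nat, of R] by simp
    show "(\<lambda>k. H k t) \<longlonglongrightarrow> h t"
      by (rule LIM_zero_cancel, rule Lim_null_comparison[OF _ i0]) (use HH(1)[OF that] in auto)
    show "(\<lambda>k. H' k t) \<longlonglongrightarrow> h' t"
      by (rule LIM_zero_cancel, rule Lim_null_comparison[OF _ LIMSEQ_inverse_real_of_nat]) (use HH(2)[OF that] in auto)
  qed
  let ?J = "\<lambda>h h' x. mlt (of_real (h ((cmod (\<psi> x))\<^sup>2))) (of_real (h ((cmod (\<psi> x))\<^sup>2) + h' ((cmod (\<psi> x))\<^sup>2) * (cmod (\<psi> x))\<^sup>2))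
      (of_real (h' ((cmod (\<psi> x))\<^sup>2)) * (\<psi> x)\<^sup>2) (jet \<psi> x)"
  \<comment> \<open>\<open>M + R\<close> bounds the approximants and \<open>(M' + 1) * R\<close>
    bounds their derivatives times the argument; the latter term enters both the linear and the
    antilinear coefficient, hence the 2.\<close>
  define C where "C = M + R + 2 * ((M' + 1) * R)"
  show "H10_jet \<Omega> (?J h h')"
  proof (rule H10_jet_dominated[OF \<Omega> _ _ jet_L2[OF \<Omega> \<psi>]])
    fix k
    have "?J (H k) (H' k) = jet (\<lambda>x. \<psi> x * of_real (H k ((cmod (\<psi> x))\<^sup>2)))"
      using jet_radial[OF sm, where h = "H k" and h' = "H' k", OF HD] by (auto simp: fun_eq_iff)
    moreover have "(\<lambda>x. \<psi> x * of_real (H k ((cmod (\<psi> x))\<^sup>2))) \<in> test_functions \<Omega>"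
      unfolding H_def by (rule radial_polynomial_test[OF \<psi>])
    ultimately show "H10_jet \<Omega> (?J (H k) (H' k))"
      by (simp add: H10_jet_test[OF \<Omega>])
    have "norm (?J (H k) (H' k) x) \<le> 2 * C * norm (jet \<psi> x)" for x
    proof (rule norm_mlt_le)
      let ?t = "(cmod (\<psi> x))\<^sup>2"
      have a: "\<bar>H' k ?t * ?t\<bar> \<le> (M' + 1) * R"
        unfolding abs_mult using HM(2)[OF R] R[of x] M'(1) by (intro mult_mono) auto
      have MR: "0 \<le> (M' + 1) * R" using M'(1) R0 by simp
      show "norm (complex_of_real (H k ?t)) \<le> C"
        using HM(1)[OF R, of k x] MR by (simp add: C_def)
      have "norm (complex_of_real (H k ?t + H' k ?t * ?t)) \<le> M + R + (M' + 1) * R"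
        unfolding norm_of_real using a HM(1)[OF R, of k x] by linarith
      moreover have "norm (complex_of_real (H' k ?t) * (\<psi> x)\<^sup>2) \<le> (M' + 1) * R"
        using a by (simp add: norm_mult norm_power abs_mult)
      ultimately show "norm (complex_of_real (H k ?t + H' k ?t * ?t)) + norm (complex_of_real (H' k ?t) * (\<psi> x)\<^sup>2) \<le> C"
        by (simp add: C_def)
    qed
    then show "AE x in lebesgue_on \<Omega>. norm (?J (H k) (H' k) x) \<le> 2 * C * norm (jet \<psi> x)"
      by (intro AE_I2)
  next
    have cc: "continuous_on UNIV (\<lambda>x. f ((cmod (\<psi> x))\<^sup>2))" if "continuous_on {0..R} f" for f :: "real \<Rightarrow> real"
      by (rule continuous_on_compose2[OF that]) (use R smooth_continuous[OF sm] in \<open>auto intro!: continuous_intros\<close>)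
    have "continuous_on UNIV (?J h h')"
      unfolding mlt_def rlin_def
      by (intro continuous_intros cc[OF chR] cc[OF cR] jet_continuous[OF sm] smooth_continuous[OF sm])
    then show "?J h h' \<in> borel_measurable (lebesgue_on \<Omega>)"
      by (rule borel_measurable_lebesgue_on_continuous)
    show "AE x in lebesgue_on \<Omega>. (\<lambda>k. ?J (H k) (H' k) x) \<longlonglongrightarrow> ?J h h' x"
      by (intro AE_I2 tendsto_mlt tendsto_intros lims R)
  qed
qed

text \<open>The weight \<open>t\<close> in the second bound is the natural one: the derivative of z
  h(|z|^2) has coefficients h + h' |z|^2 and h' z^2, whose moduli add up to at most
  \<open>3 * L\<close>.\<close>

lemma H10_jet_radial:
  fixes U :: "real^'n \<Rightarrow> complex \<times> (complex^'n)"
  assumes \<Omega>: "open \<Omega>" and U: "H10_jet \<Omega> U"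
    and h: "\<And>t. t \<ge> 0 \<Longrightarrow> (h has_real_derivative h' t) (at t within {0..})"
    and cont: "continuous_on {0..} h'"
    and bound: "\<And>t. t \<ge> 0 \<Longrightarrow> \<bar>h t\<bar> \<le> L" "\<And>t. t \<ge> 0 \<Longrightarrow> \<bar>h' t * t\<bar> \<le> L"
  shows "H10_jet \<Omega> (\<lambda>x. mlt (of_real (h ((cmod (fst (U x)))\<^sup>2)))
      (of_real (h ((cmod (fst (U x)))\<^sup>2) + h' ((cmod (fst (U x)))\<^sup>2) * (cmod (fst (U x)))\<^sup>2))
      (of_real (h' ((cmod (fst (U x)))\<^sup>2)) * (fst (U x))\<^sup>2) (U x))"
proof (rule H10_jet_mlt[OF \<Omega> U H10_jet_radial_test[OF \<Omega> _ h cont], where L = "3 * L"])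
  have ch: "continuous_on {0..} h" using h DERIV_continuous_on[of "{0..}" h h'] by auto
  have cc: "continuous_on UNIV (\<lambda>z. f ((cmod z)\<^sup>2))" if "continuous_on {0..} f" for f :: "real \<Rightarrow> real"
    by (rule continuous_on_compose2[OF that]) (auto intro!: continuous_intros)
  show "continuous_on UNIV (\<lambda>z. complex_of_real (h ((cmod z)\<^sup>2)))"
    by (intro continuous_intros cc[OF ch])
  show "continuous_on UNIV (\<lambda>z. complex_of_real (h ((cmod z)\<^sup>2) + h' ((cmod z)\<^sup>2) * (cmod z)\<^sup>2))"
    by (intro continuous_intros cc[OF ch] cc[OF cont])
  show "continuous_on UNIV (\<lambda>z. complex_of_real (h' ((cmod z)\<^sup>2)) * z\<^sup>2)"
    by (intro continuous_intros cc[OF cont])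
  fix z :: complex
  have b: "\<bar>h ((cmod z)\<^sup>2)\<bar> \<le> L" "\<bar>h' ((cmod z)\<^sup>2) * (cmod z)\<^sup>2\<bar> \<le> L"
    by (intro bound zero_le_power2)+
  then show "norm (complex_of_real (h ((cmod z)\<^sup>2))) \<le> 3 * L"
    by simp
  have "norm (complex_of_real (h ((cmod z)\<^sup>2) + h' ((cmod z)\<^sup>2) * (cmod z)\<^sup>2)) \<le> 2 * L"
    unfolding norm_of_real using b by linarith
  moreover have "norm (complex_of_real (h' ((cmod z)\<^sup>2)) * z\<^sup>2) \<le> L"
    using b(2) by (simp add: norm_mult norm_power abs_mult)
  ultimately show "norm (complex_of_real (h ((cmod z)\<^sup>2) + h' ((cmod z)\<^sup>2) * (cmod z)\<^sup>2)) + norm (complex_of_real (h' ((cmod z)\<^sup>2)) * z\<^sup>2) \<le> 3 * L"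
    by simp
qed

text \<open>The functions \<open>z / (1 + n * \<bar>z\<bar>\<^sup>2)\<close> tend to zero, while their derivatives tend to the identity at
  \<open>z = 0\<close> and to zero elsewhere.\<close>

lemma gradient_vanishes_on_zero_set:
  fixes U :: "real^'n \<Rightarrow> complex \<times> (complex^'n)"
  assumes \<Omega>: "open \<Omega>" and U: "H10_jet \<Omega> U"
  shows "AE x in lebesgue_on \<Omega>. fst (U x) = 0 \<longrightarrow> U x = 0"
proof -
  define h where "h n t = 1 / (1 + real n * t)" for n :: nat and t :: real
  define h' where "h' n t = - real n / (1 + real n * t)\<^sup>2" for n :: nat and t :: real
  define k where "k z = (if z = 0 then 1 else 0 :: complex)" for z :: complex
  have pos: "1 + real n * t > 0" if "t \<ge> 0" for n t using that by (simp add: add_pos_nonneg)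
  have hD: "(h n has_real_derivative h' n t) (at t within {0..})" if "t \<ge> 0" for n t
    unfolding h_def[abs_def] h'_def using pos[OF that, of n]
    by (auto intro!: derivative_eq_intros simp: power2_eq_square)
  have h'c: "continuous_on {0..} (h' n)" for n
    unfolding h'_def using pos by (intro continuous_intros) (auto simp: less_le)
  have hb: "\<bar>h n t\<bar> \<le> 1" if "t \<ge> 0" for n t
    using pos[OF that, of n] that by (simp add: h_def)
  have h'b: "\<bar>h' n t * t\<bar> \<le> 1" if "t \<ge> 0" for n t
  proof -
    have "real n * t \<le> (1 + real n * t) * 1" by simp
    also have "\<dots> \<le> (1 + real n * t) * (1 + real n * t)" using that by (intro mult_left_mono) auto
    finally show ?thesis using that pos[OF that, of n] by (simp add: h'_def abs_mult power2_eq_square)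
  qed
  have lh: "(\<lambda>n. h n t) \<longlonglongrightarrow> 0" "(\<lambda>n. h' n t) \<longlonglongrightarrow> 0" if "t > 0" for t
  proof -
    have "filterlim (\<lambda>n. 1 + real n * t) at_top sequentially"
      by (intro filterlim_tendsto_add_at_top[OF tendsto_const] filterlim_at_top_mult_tendsto_pos[OF tendsto_const that] filterlim_real_sequentially)
    note inv = tendsto_inverse_0_at_top[OF this]
    then show "(\<lambda>n. h n t) \<longlonglongrightarrow> 0" by (simp add: h_def inverse_eq_divide)
    have "(\<lambda>n. - (1 / t) * ((1 - inverse (1 + real n * t)) * inverse (1 + real n * t))) \<longlonglongrightarrow> - (1 / t) * ((1 - 0) * 0)"
      by (intro tendsto_intros inv)
    moreover have "- (1 / t) * ((1 - inverse (1 + real n * t)) * inverse (1 + real n * t)) = h' n t" for n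
      using that pos[of t n] by (simp add: h'_def field_simps power2_eq_square)
    ultimately show "(\<lambda>n. h' n t) \<longlonglongrightarrow> 0" by simp
  qed
  \<comment> \<open>The limit coefficients are 1 on the zero set and 0 elsewhere, so the gradient
    survives exactly on the zero set while the function component becomes zero.\<close>
  have W: "H10_jet \<Omega> (\<lambda>x. mlt (k (fst (U x))) (k (fst (U x))) 0 (U x))"
  proof (rule H10_jet_mlt_limit[OF \<Omega> H10_jet_L2[OF U] H10_jet_radial[OF \<Omega> U hD h'c hb h'b], where L = 3])
    show "norm (complex_of_real (h n ((cmod (fst (U x)))\<^sup>2))) \<le> 3" for n x
      using hb[of "(cmod (fst (U x)))\<^sup>2" n] by simp
    show "norm (complex_of_real (h n ((cmod (fst (U x)))\<^sup>2) + h' n ((cmod (fst (U x)))\<^sup>2) * (cmod (fst (U x)))\<^sup>2)) +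
       norm (complex_of_real (h' n ((cmod (fst (U x)))\<^sup>2)) * (fst (U x))\<^sup>2) \<le> 3" for n x
    proof -
      let ?t = "(cmod (fst (U x)))\<^sup>2"
      have "norm (complex_of_real (h n ?t + h' n ?t * ?t)) \<le> 2"
        unfolding norm_of_real using hb[of ?t n] h'b[of ?t n] by (smt (verit) zero_le_power2)
      moreover have "norm (complex_of_real (h' n ?t) * (fst (U x))\<^sup>2) \<le> 1"
        using h'b[of ?t n] by (simp add: norm_mult norm_power abs_mult)
      ultimately show ?thesis by simp
    qed
    show "k \<in> borel_measurable borel" unfolding k_def[abs_def] by measurable
    then show "k \<in> borel_measurable borel" .
    show "AE x in lebesgue_on \<Omega>. U x = 0 \<or>
        (\<lambda>n. complex_of_real (h n ((cmod (fst (U x)))\<^sup>2))) \<longlonglongrightarrow> k (fst (U x)) \<and>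
        (\<lambda>n. complex_of_real (h n ((cmod (fst (U x)))\<^sup>2) + h' n ((cmod (fst (U x)))\<^sup>2) * (cmod (fst (U x)))\<^sup>2)) \<longlonglongrightarrow> k (fst (U x)) \<and>
        (\<lambda>n. complex_of_real (h' n ((cmod (fst (U x)))\<^sup>2)) * (fst (U x))\<^sup>2) \<longlonglongrightarrow> 0"
    proof (intro AE_I2 disjI2)
      fix x
      let ?z = "fst (U x)" let ?t = "(cmod ?z)\<^sup>2"
      show "(\<lambda>n. complex_of_real (h n ?t)) \<longlonglongrightarrow> k ?z \<and>
        (\<lambda>n. complex_of_real (h n ?t + h' n ?t * ?t)) \<longlonglongrightarrow> k ?z \<and>
        (\<lambda>n. complex_of_real (h' n ?t) * ?z\<^sup>2) \<longlonglongrightarrow> 0"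
      proof (cases "?z = 0")
        case True
        then show ?thesis by (simp add: k_def h_def)
      next
        case False
        then have t: "?t > 0" by simp
        have "(\<lambda>n. complex_of_real (h n ?t)) \<longlonglongrightarrow> of_real 0"
          "(\<lambda>n. complex_of_real (h n ?t + h' n ?t * ?t)) \<longlonglongrightarrow> of_real (0 + 0 * ?t)"
          "(\<lambda>n. complex_of_real (h' n ?t) * ?z\<^sup>2) \<longlonglongrightarrow> of_real 0 * ?z\<^sup>2"
          by (intro tendsto_intros lh t)+
        with False show ?thesis by (simp add: k_def)
      qed
    qed
  qed simp_all
  have eq: "mlt (k (fst (U x))) (k (fst (U x))) 0 (U x) = (0, k (fst (U x)) *s snd (U x))" for x
    by (simp add: mlt_def rlin_def k_def vec_eq_iff)
  \<comment> \<open>The zero function thus has the restricted gradient as a weak gradient;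
    uniqueness against the weak gradient 0 makes it vanish.\<close>
  have w0: "has_weak_gradient \<Omega> (\<lambda>x. 0) (\<lambda>x. k (fst (U x)) *s snd (U x))"
    using W by (intro H10_jet_weak_gradient[OF \<Omega>]) (simp add: eq)
  have j0: "jet (\<lambda>x. 0) x = (0, 0)" for x :: "real^'n"
    using jet_uminus[OF smooth_const[of 0], of x] by (simp add: jet_def vec_eq_iff)
  have "has_weak_gradient \<Omega> (\<lambda>x. 0) (\<lambda>x::real^'n. 0)"
    using H10_jet_test[OF \<Omega> zero_test_function] by (intro H10_jet_weak_gradient[OF \<Omega>]) (simp add: j0[abs_def])
  from weak_gradient_unique[OF \<Omega> w0 this]
  show ?thesis
    by eventually_elim (auto simp: k_def prod_eq_iff)
qed

section \<open>Radial functions that are singular at the origin\<close>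

lemma borel_measurable_if_zero:
  fixes f :: "complex \<Rightarrow> complex"
  assumes "continuous_on (- {0}) f"
  shows "(\<lambda>z. if z = 0 then 0 else f z) \<in> borel_measurable borel"
proof -
  have "(\<lambda>z. indicator (- {0}) z *\<^sub>R f z) \<in> borel_measurable borel"
    using assms by (intro borel_measurable_continuous_on_indicator) auto
  also have "(\<lambda>z. indicator (- {0}) z *\<^sub>R f z) = (\<lambda>z. if z = 0 then 0 else f z)"
    by (auto simp: fun_eq_iff)
  finally show ?thesis .
qed

text \<open>The coefficients for \<open>z \<mapsto> f \<bar>z\<bar> * z / \<bar>z\<bar>\<close>. They need not have a limit at \<open>z = 0\<close>; the value there is
  irrelevant, because gradients vanish almost everywhere on zero sets.\<close>

definition radial_k :: "(real \<Rightarrow> real) \<Rightarrow> complex \<Rightarrow> complex" where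
  "radial_k f z = (if z = 0 then 0 else of_real (f (cmod z) / cmod z))"

definition radial_p :: "(real \<Rightarrow> real) \<Rightarrow> (real \<Rightarrow> real) \<Rightarrow> complex \<Rightarrow> complex" where
  "radial_p f f' z = (if z = 0 then 0 else of_real ((f' (cmod z) + f (cmod z) / cmod z) / 2))"

definition radial_q :: "(real \<Rightarrow> real) \<Rightarrow> (real \<Rightarrow> real) \<Rightarrow> complex \<Rightarrow> complex" where
  "radial_q f f' z = (if z = 0 then 0 else of_real ((f' (cmod z) - f (cmod z) / cmod z) / 2) * (z / of_real (cmod z))\<^sup>2)"

text \<open>The modulus is replaced by r = sqrt(|z|^2 + d), which stays positive, so f(r)/r is a
  continuously differentiable function of |z|^2 down to zero. Since |z|^2 / r^2 is at most 1, the
  bounds do not depend on d. Away from zero the coefficients converge; on the zero set the gradient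
  vanishes.\<close>

lemma H10_jet_radial_Lipschitz:
  fixes U :: "real^'n \<Rightarrow> complex \<times> (complex^'n)"
  assumes \<Omega>: "open \<Omega>" and U: "H10_jet \<Omega> U"
    and f: "\<And>t. t > 0 \<Longrightarrow> (f has_real_derivative f' t) (at t)"
    and cont: "continuous_on {0<..} f'"
    and bound: "\<And>t. t > 0 \<Longrightarrow> \<bar>f t\<bar> \<le> L * t" "\<And>t. t > 0 \<Longrightarrow> \<bar>f' t\<bar> \<le> L"
  shows "H10_jet \<Omega> (\<lambda>x. mlt (radial_k f (fst (U x))) (radial_p f f' (fst (U x))) (radial_q f f' (fst (U x))) (U x))"
proof -
  define d where "d n = inverse (real (Suc n))" for n
  have d: "d n > 0" for n by (simp add: d_def)
  define r where "r n t = sqrt (t + d n)" for n t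
  have r: "r n t > 0" "(r n t)\<^sup>2 = t + d n" if "t \<ge> 0" for n t
    using that d[of n] by (auto simp: r_def)
  define h where "h n t = f (r n t) / r n t" for n t
  define h' where "h' n t = (f' (r n t) / r n t - f (r n t) / (r n t)\<^sup>2) / (2 * r n t)" for n t
  have hD: "(h n has_real_derivative h' n t) (at t within {0..})" if t: "t \<ge> 0" for n t
  proof -
    have rD: "(r n has_real_derivative 1 / (2 * r n t)) (at t)"
      unfolding r_def[abs_def] using t d[of n]
      by (auto intro!: derivative_eq_intros simp: field_simps)
    have "((\<lambda>t. f (r n t)) has_real_derivative f' (r n t) * (1 / (2 * r n t))) (at t)"
      by (rule DERIV_chain2[OF f[OF r(1)[OF t]] rD])
    from DERIV_divide[OF this rD] r(1)[OF t, of n]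
    have "(h n has_real_derivative ((f' (r n t) * (1 / (2 * r n t))) * r n t - f (r n t) * (1 / (2 * r n t))) / (r n t * r n t)) (at t)"
      by (simp add: h_def[abs_def])
    also have "((f' (r n t) * (1 / (2 * r n t))) * r n t - f (r n t) * (1 / (2 * r n t))) / (r n t * r n t) = h' n t"
      using r(1)[OF t, of n] by (simp add: h'_def field_simps power2_eq_square)
    finally show ?thesis by (rule has_field_derivative_at_within)
  qed
  have contf: "continuous_on {0<..} f" using f by (intro continuous_at_imp_continuous_on) (auto intro: DERIV_isCont)
  have cr: "continuous_on {0..} (r n)" for n unfolding r_def by (intro continuous_intros)
  have h'c: "continuous_on {0..} (h' n)" for n
    unfolding h'_def using r(1)
    by (intro continuous_intros cr continuous_on_compose2[OF cont cr] continuous_on_compose2[OF contf cr]) (auto simp: less_le)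
  have fb: "\<bar>f s / s\<bar> \<le> L" if "s > 0" for s
    using bound(1)[OF that] that by (simp add: abs_divide field_simps)
  have L0: "0 \<le> L" using bound(2)[of 1] by simp
  have hb: "\<bar>h n t\<bar> \<le> L" if "t \<ge> 0" for n t
    unfolding h_def by (rule fb[OF r(1)[OF that]])
  have h'b: "\<bar>h' n t * t\<bar> \<le> L" if t: "t \<ge> 0" for n t
  proof -
    let ?r = "r n t"
    have "h' n t * t = (f' ?r - f ?r / ?r) * (t / ?r\<^sup>2) / 2"
      using r(1)[OF t, of n] by (simp add: h'_def field_simps power2_eq_square)
    also have "\<bar>\<dots>\<bar> = \<bar>f' ?r - f ?r / ?r\<bar> * (t / ?r\<^sup>2) / 2" using t by (simp add: abs_mult)
    also have "\<dots> \<le> (2 * L) * 1 / 2"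
    proof (intro divide_right_mono mult_mono)
      show "\<bar>f' ?r - f ?r / ?r\<bar> \<le> 2 * L"
        using bound(2)[OF r(1)[OF t, of n]] fb[OF r(1)[OF t, of n]] by linarith
      show "t / ?r\<^sup>2 \<le> 1" using r[OF t, of n] d[of n] t by simp
    qed (use L0 t in auto)
    finally show ?thesis by simp
  qed
  have rlim: "(\<lambda>n. r n t) \<longlonglongrightarrow> sqrt t" for t
  proof -
    have "(\<lambda>n. sqrt (t + d n)) \<longlonglongrightarrow> sqrt (t + 0)"
      unfolding d_def by (intro tendsto_intros LIMSEQ_inverse_real_of_nat)
    then show ?thesis by (simp add: r_def)
  qed
  have flim: "(\<lambda>n. g (r n t)) \<longlonglongrightarrow> g (sqrt t)" if "continuous_on {0<..} g" "t > 0" for g :: "real \<Rightarrow> real" and t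
  proof (rule continuous_on_tendsto_compose[OF that(1) rlim])
    show "sqrt t \<in> {0<..}" using that by simp
    show "\<forall>\<^sub>F n in sequentially. r n t \<in> {0<..}" using r(1) that by (auto intro!: always_eventually)
  qed
  show ?thesis
  proof (rule H10_jet_mlt_limit[OF \<Omega> H10_jet_L2[OF U] H10_jet_radial[OF \<Omega> U hD h'c hb h'b], where L = "3 * L"])
    fix n x
    let ?t = "(cmod (fst (U x)))\<^sup>2"
    show "norm (complex_of_real (h n ?t)) \<le> 3 * L"
      using hb[of ?t n] L0 by simp
    have "norm (complex_of_real (h n ?t + h' n ?t * ?t)) \<le> 2 * L"
      unfolding norm_of_real using hb[of ?t n] h'b[of ?t n] by (smt (verit) zero_le_power2)
    moreover have "norm (complex_of_real (h' n ?t) * (fst (U x))\<^sup>2) \<le> L"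
      using h'b[of ?t n] by (simp add: norm_mult norm_power abs_mult)
    ultimately show "norm (complex_of_real (h n ?t + h' n ?t * ?t)) + norm (complex_of_real (h' n ?t) * (fst (U x))\<^sup>2) \<le> 3 * L"
      by simp
  next
    have cc: "continuous_on (- {0}) (\<lambda>z. g (cmod z))" if "continuous_on {0<..} g" for g :: "real \<Rightarrow> real"
      by (rule continuous_on_compose2[OF that]) (auto intro!: continuous_intros)
    show "radial_k f \<in> borel_measurable borel"
      unfolding radial_k_def[abs_def]
      by (intro borel_measurable_if_zero continuous_intros cc[OF contf]) auto
    show "radial_p f f' \<in> borel_measurable borel"
      unfolding radial_p_def[abs_def]
      by (intro borel_measurable_if_zero continuous_intros cc[OF contf] cc[OF cont]) auto
    show "radial_q f f' \<in> borel_measurable borel"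
      unfolding radial_q_def[abs_def]
      by (intro borel_measurable_if_zero continuous_intros cc[OF contf] cc[OF cont]) auto
  next
    show "AE x in lebesgue_on \<Omega>. U x = 0 \<or>
        (\<lambda>n. complex_of_real (h n ((cmod (fst (U x)))\<^sup>2))) \<longlonglongrightarrow> radial_k f (fst (U x)) \<and>
        (\<lambda>n. complex_of_real (h n ((cmod (fst (U x)))\<^sup>2) + h' n ((cmod (fst (U x)))\<^sup>2) * (cmod (fst (U x)))\<^sup>2)) \<longlonglongrightarrow> radial_p f f' (fst (U x)) \<and>
        (\<lambda>n. complex_of_real (h' n ((cmod (fst (U x)))\<^sup>2)) * (fst (U x))\<^sup>2) \<longlonglongrightarrow> radial_q f f' (fst (U x))"
      using gradient_vanishes_on_zero_set[OF \<Omega> U]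
    proof eventually_elim
      case (elim x)
      show ?case
      proof (cases "fst (U x) = 0")
        case False
        let ?z = "fst (U x)" let ?t = "(cmod ?z)\<^sup>2" let ?s = "cmod ?z"
        have t: "?t > 0" and s: "?s > 0" and st: "sqrt ?t = ?s" using False by auto
        have lh: "(\<lambda>n. h n ?t) \<longlonglongrightarrow> f ?s / ?s"
          unfolding h_def using s by (intro tendsto_divide flim[OF contf t, unfolded st] rlim[of ?t, unfolded st]) auto
        have lh': "(\<lambda>n. h' n ?t) \<longlonglongrightarrow> (f' ?s / ?s - f ?s / ?s\<^sup>2) / (2 * ?s)"
          unfolding h'_def using s
          by (intro tendsto_intros flim[OF contf t, unfolded st] flim[OF cont t, unfolded st] rlim[of ?t, unfolded st]) auto
        have "(\<lambda>n. complex_of_real (h n ?t)) \<longlonglongrightarrow> of_real (f ?s / ?s)"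
          "(\<lambda>n. complex_of_real (h n ?t + h' n ?t * ?t)) \<longlonglongrightarrow> of_real (f ?s / ?s + (f' ?s / ?s - f ?s / ?s\<^sup>2) / (2 * ?s) * ?t)"
          "(\<lambda>n. complex_of_real (h' n ?t) * ?z\<^sup>2) \<longlonglongrightarrow> of_real ((f' ?s / ?s - f ?s / ?s\<^sup>2) / (2 * ?s)) * ?z\<^sup>2"
          by (intro tendsto_intros lh lh')+
        moreover have "f ?s / ?s + (f' ?s / ?s - f ?s / ?s\<^sup>2) / (2 * ?s) * ?t = (f' ?s + f ?s / ?s) / 2"
          using s by (simp add: field_simps power2_eq_square)
        moreover have "complex_of_real ((f' ?s / ?s - f ?s / ?s\<^sup>2) / (2 * ?s)) * ?z\<^sup>2 =
          of_real ((f' ?s - f ?s / ?s) / 2) * (?z / of_real ?s)\<^sup>2"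
        proof -
          have "(f' ?s / ?s - f ?s / ?s\<^sup>2) / (2 * ?s) = (f' ?s - f ?s / ?s) / 2 / ?s\<^sup>2"
            using s by (simp add: field_simps power2_eq_square)
          then show ?thesis by (simp add: power_divide)
        qed
        ultimately show ?thesis
          using False by (simp only: radial_k_def radial_p_def radial_q_def if_False) simp
      qed (use elim in simp)
    qed
  qed
qed

text \<open>For a test function \<open>\<psi>\<close> also \<open>\<bar>\<psi>\<bar>\<^sup>2\<close> is a test function, and the regularised modulus
  \<open>sqrt (\<bar>\<psi>\<bar>\<^sup>2 + d\<^sup>2) - d\<close> is a Lipschitz radial function of it.\<close>

lemma H10_jet_cmod:
  fixes U :: "real^'n \<Rightarrow> complex \<times> (complex^'n)"
  assumes \<Omega>: "open \<Omega>" and U: "H10_jet \<Omega> U"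
  shows "H10_jet \<Omega> (\<lambda>x. mlt (cnj (sgn (fst (U x)))) (cnj (sgn (fst (U x))) / 2) (sgn (fst (U x)) / 2) (U x))"
proof -
  define R where "R d z = sqrt ((cmod z)\<^sup>2 + d\<^sup>2)" for d :: real and z :: complex
  have R: "R d z > 0" "cmod z \<le> R d z" "(R d z)\<^sup>2 = (cmod z)\<^sup>2 + d\<^sup>2" if "d > 0" for d z
    using that by (auto simp: R_def add_nonneg_pos real_le_rsqrt)
  \<comment> \<open>Rationalising, R - d = |z|^2 / (R + d), which is \<open>k d z * z\<close>. The
    derivative of R is the conjugate of z times dz plus z times the conjugate of dz, divided by 2R,
    which gives \<open>p\<close> and \<open>q\<close>.\<close>
  define k where "k d z = cnj z / of_real (R d z + d)" for d z
  define p where "p d z = cnj z / of_real (2 * R d z)" for d z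
  define q where "q d z = z / of_real (2 * R d z)" for d z
  have cR: "continuous_on UNIV (R d)" for d unfolding R_def by (intro continuous_intros)
  have test: "H10_jet \<Omega> (\<lambda>x. mlt (k d (\<psi> x)) (p d (\<psi> x)) (q d (\<psi> x)) (jet \<psi> x))"
    if \<psi>: "\<psi> \<in> test_functions \<Omega>" and d: "d > 0" for \<psi> :: "real^'n \<Rightarrow> complex" and d
  proof -
    note sm = test_function_smooth[OF \<psi>]
    let ?\<chi> = "\<lambda>x. \<psi> x * cnj (\<psi> x)"
    have \<chi>: "?\<chi> \<in> test_functions \<Omega>" by (rule test_function_mult[OF \<psi> smooth_cnj[OF sm]])
    define f where "f t = sqrt (t + d\<^sup>2) - d" for t
    define f' where "f' t = 1 / (2 * sqrt (t + d\<^sup>2))" for t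
    have pos: "sqrt (t + d\<^sup>2) > 0" if "t \<ge> 0" for t using d that by (simp add: add_nonneg_pos)
    have dle: "d \<le> sqrt (t + d\<^sup>2)" if "t \<ge> 0" for t using that by (intro real_le_rsqrt) simp
    have ft: "f t * (sqrt (t + d\<^sup>2) + d) = t" if "t \<ge> 0" for t
      using that d by (simp add: f_def algebra_simps power2_eq_square[symmetric])
    have J: "H10_jet \<Omega> (\<lambda>x. mlt (radial_k f (fst (jet ?\<chi> x))) (radial_p f f' (fst (jet ?\<chi> x))) (radial_q f f' (fst (jet ?\<chi> x))) (jet ?\<chi> x))"
    proof (rule H10_jet_radial_Lipschitz[OF \<Omega> H10_jet_test[OF \<Omega> \<chi>]])
      show "(f has_real_derivative f' t) (at t)" if "t > 0" for t
      proof -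
        have "t + d\<^sup>2 > 0" using that by (simp add: add_pos_nonneg)
        then show ?thesis
          unfolding f_def[abs_def] f'_def by (auto intro!: derivative_eq_intros simp: field_simps)
      qed
      show "continuous_on {0<..} f'"
        unfolding f'_def using pos by (intro continuous_intros) (auto simp: less_le)
      show "\<bar>f t\<bar> \<le> 1 / d * t" if "t > 0" for t
      proof -
        have f0: "f t \<ge> 0" using dle[of t] that by (simp add: f_def)
        have "f t * d \<le> f t * (sqrt (t + d\<^sup>2) + d)" using f0 pos[of t] that by (intro mult_left_mono) auto
        with ft[of t] that f0 d show ?thesis by (simp add: field_simps)
      qed
      show "\<bar>f' t\<bar> \<le> 1 / d" if "t > 0" for t
        using dle[of t] pos[of t] d that by (simp add: f'_def divide_simps)
    qed
    have "mlt (radial_k f (fst (jet ?\<chi> x))) (radial_p f f' (fst (jet ?\<chi> x))) (radial_q f f' (fst (jet ?\<chi> x))) (jet ?\<chi> x) =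
       mlt (k d (\<psi> x)) (p d (\<psi> x)) (q d (\<psi> x)) (jet \<psi> x)" for x
    proof -
      have "\<psi> differentiable_on UNIV" "(\<lambda>x. cnj (\<psi> x)) differentiable_on UNIV"
        using sm smooth_cnj[OF sm] smooth_differentiable by (auto simp: differentiable_on_def)
      then have pd: "partial_deriv i ?\<chi> x = \<psi> x * cnj (partial_deriv i \<psi> x) + partial_deriv i \<psi> x * cnj (\<psi> x)" for i
        by (simp add: partial_deriv_mult partial_deriv_cnj)
      show ?thesis
      proof (cases "\<psi> x = 0")
        case True
        then show ?thesis
          by (simp add: mlt_def rlin_def jet_def pd vec_eq_iff radial_k_def radial_p_def radial_q_def k_def p_def q_def)
      next
        case False
        let ?s = "(cmod (\<psi> x))\<^sup>2"
        have s: "?s > 0" using False by simp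
        have \<chi>s: "\<psi> x * cnj (\<psi> x) = of_real ?s" by (simp add: complex_norm_square[symmetric])
        have Rs: "sqrt (?s + d\<^sup>2) = R d (\<psi> x)" by (simp add: R_def)
        have "radial_k f (of_real s) * of_real s = of_real (f s)" if "s > 0" for s
          using that by (simp add: radial_k_def)
        note rk = this[OF s]
        have "radial_p f f' (of_real s) + radial_q f f' (of_real s) = of_real (f' s)" if "s > 0" for s
          using that by (simp add: radial_p_def radial_q_def field_simps)
        note rp = this[OF s]
        have f's: "f' ?s = 1 / (2 * R d (\<psi> x))" by (simp add: f'_def Rs)
        have "f ?s * (R d (\<psi> x) + d) = ?s" using ft[of ?s] by (simp add: Rs)
        then have fs: "f ?s = ?s / (R d (\<psi> x) + d)" using R(1)[OF d, of "\<psi> x"] d by (simp add: field_simps)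
        have 1: "radial_k f (?\<chi> x) * ?\<chi> x = k d (\<psi> x) * \<psi> x"
          unfolding \<chi>s rk fs k_def using complex_norm_square[of "\<psi> x"] by (simp add: mult.commute)
        have 2: "radial_p f f' (?\<chi> x) * partial_deriv i ?\<chi> x + radial_q f f' (?\<chi> x) * cnj (partial_deriv i ?\<chi> x) =
           p d (\<psi> x) * partial_deriv i \<psi> x + q d (\<psi> x) * cnj (partial_deriv i \<psi> x)" for i
        proof -
          have "cnj (partial_deriv i ?\<chi> x) = partial_deriv i ?\<chi> x" by (simp add: pd)
          then have "radial_p f f' (?\<chi> x) * partial_deriv i ?\<chi> x + radial_q f f' (?\<chi> x) * cnj (partial_deriv i ?\<chi> x) =
            of_real (f' ?s) * partial_deriv i ?\<chi> x"
            unfolding \<chi>s rp[symmetric] by (simp add: distrib_right)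
          also have "\<dots> = p d (\<psi> x) * partial_deriv i \<psi> x + q d (\<psi> x) * cnj (partial_deriv i \<psi> x)"
            unfolding pd f's p_def q_def by (simp add: algebra_simps add_divide_distrib)
          finally show ?thesis .
        qed
        show ?thesis using 1 2 by (simp add: mlt_def rlin_def jet_def vec_eq_iff)
      qed
    qed
    with J show ?thesis by simp
  qed
  \<comment> \<open>As a function of the squared modulus the regularisation has Lipschitz constant
    of order 1/d. As a function of z its coefficients are bounded by 1, so d may tend to
    zero.\<close>
  have bd: "norm (k d z) \<le> 1" "norm (p d z) + norm (q d z) \<le> 1" if d: "d > 0" for d z
  proof -
    have "norm (k d z) = cmod z / (R d z + d)"
      unfolding k_def norm_divide norm_of_real using R(1)[OF d, of z] d by simp
    also have "\<dots> \<le> 1" using R(1,2)[OF d, of z] d by (simp add: divide_simps)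
    finally show "norm (k d z) \<le> 1" .
    have "norm (p d z) = cmod z / (2 * R d z)" "norm (q d z) = cmod z / (2 * R d z)"
      unfolding p_def q_def norm_divide norm_of_real using R(1)[OF d, of z] by simp_all
    then have "norm (p d z) + norm (q d z) = cmod z / R d z" by simp
    also have "\<dots> \<le> 1" using R(1,2)[OF d, of z] by (simp add: divide_simps)
    finally show "norm (p d z) + norm (q d z) \<le> 1" .
  qed
  define dn where "dn n = inverse (real (Suc n))" for n
  have dn: "dn n > 0" for n by (simp add: dn_def)
  have Rlim: "(\<lambda>n. R (dn n) z) \<longlonglongrightarrow> cmod z" for z
  proof -
    have "(\<lambda>n. sqrt ((cmod z)\<^sup>2 + (dn n)\<^sup>2)) \<longlonglongrightarrow> sqrt ((cmod z)\<^sup>2 + 0\<^sup>2)"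
      unfolding dn_def by (intro tendsto_intros LIMSEQ_inverse_real_of_nat)
    then show ?thesis by (simp add: R_def)
  qed
  have J: "H10_jet \<Omega> (\<lambda>x. mlt (k (dn n) (fst (U x))) (p (dn n) (fst (U x))) (q (dn n) (fst (U x))) (U x))" for n
  proof (rule H10_jet_mlt[OF \<Omega> U test[OF _ dn]])
    have nz: "complex_of_real (R (dn n) z + dn n) \<noteq> 0" "complex_of_real (2 * R (dn n) z) \<noteq> 0" for z
      using R(1)[OF dn[of n], of z] dn[of n] unfolding of_real_eq_0_iff by linarith+
    show "continuous_on UNIV (k (dn n))" "continuous_on UNIV (p (dn n))" "continuous_on UNIV (q (dn n))"
      unfolding k_def p_def q_def by (intro continuous_intros cR ballI nz)+
  qed (use bd[OF dn] in auto)
  show ?thesis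
  proof (rule H10_jet_mlt_limit[OF \<Omega> H10_jet_L2[OF U] J, where k = "\<lambda>z. cnj (sgn z)" and p = "\<lambda>z. cnj (sgn z) / 2" and q = "\<lambda>z. sgn z / 2" and L = 1])
    have "(\<lambda>z. if z = 0 then 0 else sgn z) \<in> borel_measurable (borel :: complex measure)"
      by (rule borel_measurable_if_zero) (intro continuous_intros continuous_on_sgn, auto)
    also have "(\<lambda>z::complex. if z = 0 then 0 else sgn z) = sgn" by (auto simp: fun_eq_iff)
    finally have m: "sgn \<in> borel_measurable (borel :: complex measure)" .
    have cm: "cnj \<in> borel_measurable borel"
      by (intro borel_measurable_continuous_onI continuous_intros)
    show "(\<lambda>z. cnj (sgn z)) \<in> borel_measurable borel" "(\<lambda>z. cnj (sgn z) / 2) \<in> borel_measurable borel"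
       "(\<lambda>z. sgn z / 2) \<in> borel_measurable (borel :: complex measure)"
      using m measurable_compose[OF m cm] by (auto intro: borel_measurable_divide)
    show "AE x in lebesgue_on \<Omega>. U x = 0 \<or>
       ((\<lambda>n. k (dn n) (fst (U x))) \<longlonglongrightarrow> cnj (sgn (fst (U x))) \<and>
        (\<lambda>n. p (dn n) (fst (U x))) \<longlonglongrightarrow> cnj (sgn (fst (U x))) / 2 \<and>
        (\<lambda>n. q (dn n) (fst (U x))) \<longlonglongrightarrow> sgn (fst (U x)) / 2)"
    proof (intro AE_I2 disjI2)
      fix x
      let ?z = "fst (U x)"
      show "(\<lambda>n. k (dn n) ?z) \<longlonglongrightarrow> cnj (sgn ?z) \<and> (\<lambda>n. p (dn n) ?z) \<longlonglongrightarrow> cnj (sgn ?z) / 2 \<and>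
        (\<lambda>n. q (dn n) ?z) \<longlonglongrightarrow> sgn ?z / 2"
      proof (cases "?z = 0")
        case True then show ?thesis by (simp add: k_def p_def q_def)
      next
        case False
        have dl: "dn \<longlonglongrightarrow> 0" unfolding dn_def by (rule LIMSEQ_inverse_real_of_nat)
        have "(\<lambda>n. k (dn n) ?z) \<longlonglongrightarrow> cnj ?z / of_real (cmod ?z + 0)"
          "(\<lambda>n. p (dn n) ?z) \<longlonglongrightarrow> cnj ?z / of_real (2 * cmod ?z)"
          "(\<lambda>n. q (dn n) ?z) \<longlonglongrightarrow> ?z / of_real (2 * cmod ?z)"
          unfolding k_def p_def q_def using False by (intro tendsto_intros Rlim dl; simp)+
        then show ?thesis by (simp add: sgn_eq mult.commute)
      qed
    qed
  qed (use bd[OF dn] in auto)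
qed

section \<open>The scalar function\<close>

lemma positive_inverse:
  fixes f f' :: "real \<Rightarrow> real"
  assumes f: "\<And>s. s > 0 \<Longrightarrow> (f has_real_derivative f' s) (at s)"
    and pos: "\<And>s. s > 0 \<Longrightarrow> f' s > 0" and img: "f ` {0<..} = {0<..}" and t: "t > 0"
  defines "g \<equiv> inv_into {0<..} f"
  shows "g t > 0" and "f (g t) = t" and "(g has_real_derivative 1 / f' (g t)) (at t)"
    and "\<And>s. s > 0 \<Longrightarrow> g (f s) = s" and "\<And>s u. 0 < s \<Longrightarrow> s < u \<Longrightarrow> f s < f u"
proof -
  show mono: "f s < f u" if "0 < s" "s < u" for s u
  proof (rule DERIV_pos_imp_increasing[OF that(2)])
    fix x assume "s \<le> x" "x \<le> u"
    then have "x > 0" using that by simp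
    then show "\<exists>y. (f has_real_derivative y) (at x) \<and> 0 < y" using f pos by blast
  qed
  have inj: "inj_on f {0<..}"
    by (rule linorder_inj_onI) (use mono in \<open>force+\<close>)
  have gpos: "g t > 0" "f (g t) = t" if "t > 0" for t
  proof -
    have "t \<in> f ` {0<..}" using that img by simp
    then show "g t > 0" "f (g t) = t" unfolding g_def
      using inv_into_into[of t f "{0<..}"] f_inv_into_f[of t f "{0<..}"] by auto
  qed
  show gf: "g (f s) = s" if "s > 0" for s unfolding g_def using inj that by simp
  show "g t > 0" "f (g t) = t" by (rule gpos[OF t])+
  have "isCont g (f (g t))"
  proof (rule isCont_inverse_function[where f = f and x = "g t" and d = "g t / 2"])
    show "0 < g t / 2" using gpos[OF t] by simp
    fix z assume "\<bar>z - g t\<bar> \<le> g t / 2"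
    then have "z > 0" using gpos[OF t] by (simp add: abs_if split: if_splits)
    then show "g (f z) = z" "isCont f z" using gf DERIV_isCont[OF f] by auto
  qed
  then have c: "isCont g t" by (simp add: gpos[OF t])
  have "(g has_real_derivative inverse (f' (g t))) (at t)"
  proof (rule DERIV_inverse_function[where a = 0 and b = "t + 1" and f = f])
    show "(f has_real_derivative f' (g t)) (at (g t))" by (rule f[OF gpos(1)[OF t]])
    show "f' (g t) \<noteq> 0" using pos[OF gpos(1)[OF t]] by simp
    show "f (g y) = y" if "0 < y" "y < t + 1" for y using gpos that by simp
  qed (use t c in auto)
  then show "(g has_real_derivative 1 / f' (g t)) (at t)" by (simp add: inverse_eq_divide)
qed

locale phi_function =
  fixes \<phi> :: "real \<Rightarrow> real"
  assumes phi_conditions: "phi_conditions \<phi>"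
begin

definition b :: "real \<Rightarrow> real" where "b s = s * \<phi> s"
definition b' :: "real \<Rightarrow> real" where "b' s = \<phi> s + s * deriv \<phi> s"
text \<open>The elasticity s b'(s)/b(s) of \<open>b\<close>, also equal to 1 + s
  \<open>\<phi>\<close>'(s)/\<open>\<phi>\<close>(s). Every quantity below, \<open>Lambda\<close>
  included, is rational in \<open>p\<close>, \<open>\<phi>\<close>, its root and
  \<open>s\<close>.\<close>

definition p :: "real \<Rightarrow> real" where "p s = b' s / \<phi> s"

section \<open>Elementary consequences of the conditions\<close>

lemma phi_pos: "s > 0 \<Longrightarrow> \<phi> s > 0"
  using phi_conditions by (auto simp: phi_conditions_def)

lemma phi_DERIV: "s > 0 \<Longrightarrow> (\<phi> has_real_derivative deriv \<phi> s) (at s)"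
  and deriv_phi_continuous: "continuous_on {0<..} (deriv \<phi>)"
proof -
  obtain D where D: "\<And>s. s > 0 \<Longrightarrow> (\<phi> has_vector_derivative D s) (at s)" "continuous_on {0<..} D"
    using phi_conditions by (auto simp: phi_conditions_def C1_differentiable_on_def)
  have D': "(\<phi> has_real_derivative D s) (at s)" if "s > 0" for s
    using D(1)[OF that] by (simp add: has_real_derivative_iff_has_vector_derivative)
  then have eq: "deriv \<phi> s = D s" if "s > 0" for s using that by (simp add: DERIV_imp_deriv)
  show "(\<phi> has_real_derivative deriv \<phi> s) (at s)" if "s > 0" using D'[OF that] eq[OF that] by simp
  show "continuous_on {0<..} (deriv \<phi>)" using D(2) eq by (simp cong: continuous_on_cong_simp)
qed

lemma phi_continuous: "continuous_on {0<..} \<phi>"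
  using phi_DERIV by (intro continuous_at_imp_continuous_on) (auto intro: DERIV_isCont)

lemma b_DERIV: "s > 0 \<Longrightarrow> (b has_real_derivative b' s) (at s)"
  unfolding b_def[abs_def] b'_def using phi_DERIV
  by (auto intro!: derivative_eq_intros)

lemma deriv_b: "s > 0 \<Longrightarrow> deriv (\<lambda>s. s * \<phi> s) s = b' s"
  using DERIV_imp_deriv[OF b_DERIV] by (simp add: b_def[abs_def])

lemma b'_pos: "s > 0 \<Longrightarrow> b' s > 0"
  using phi_conditions deriv_b by (auto simp: phi_conditions_def)

lemma b_pos: "s > 0 \<Longrightarrow> b s > 0"
  using phi_pos by (simp add: b_def)

lemma b_image: "b ` {0<..} = {0<..}"
  using phi_conditions by (simp add: phi_conditions_def b_def[abs_def])

lemma b_mono: "0 < s \<Longrightarrow> s < u \<Longrightarrow> b s < b u"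
  using positive_inverse(5)[OF b_DERIV b'_pos b_image zero_less_one] by simp

lemma b'_continuous: "continuous_on {0<..} b'"
  unfolding b'_def[abs_def] by (intro continuous_intros phi_continuous deriv_phi_continuous)

lemma p_pos: "s > 0 \<Longrightarrow> p s > 0"
  using b'_pos phi_pos by (simp add: p_def)

lemma p_continuous: "continuous_on {0<..} p"
  unfolding p_def[abs_def] using phi_pos
  by (intro continuous_intros phi_continuous b'_continuous) (auto simp: less_le)

lemma b'_eq: "s > 0 \<Longrightarrow> b' s = p s * \<phi> s"
  using phi_pos[of s] by (simp add: p_def)

text \<open>Integrating the power bounds for \<open>b'\<close> from zero places \<open>b\<close>
  between multiples of s^(r+1); dividing s \<open>b'\<close> by \<open>b\<close> then bounds
  \<open>p\<close> on both sides. The integration is done by comparing monotone differences on an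
  interval from \<open>x\<close> to \<open>s\<close>, with \<open>x\<close> close to zero.\<close>

lemma p_bounds_near_0:
  obtains \<kappa> K s0 where "\<kappa> > 0" "s0 > 0" "\<And>s. 0 < s \<Longrightarrow> s < s0 \<Longrightarrow> \<kappa> \<le> p s \<and> p s \<le> K"
    "\<exists>s1>s0. (\<forall>s\<ge>s1. deriv \<phi> s \<ge> 0) \<or> (\<forall>s\<ge>s1. deriv \<phi> s \<le> 0)"
proof -
  obtain C1 C2 r s0 where *: "C1 > 0 \<and> C2 > 0 \<and> r > -1 \<and> s0 > 0 \<and>
      (\<forall>s\<in>{0<..<s0}. C1 * s powr r \<le> deriv (\<lambda>s. s * \<phi> s) s \<and> deriv (\<lambda>s. s * \<phi> s) s \<le> C2 * s powr r) \<and>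
      (r = 0 \<longrightarrow> (\<exists>\<phi>0>0. (\<phi> \<longlongrightarrow> \<phi>0) (at_right 0)) \<and> ((\<lambda>s. s * deriv \<phi> s) \<longlongrightarrow> 0) (at_right 0)) \<and>
      (\<exists>s1>s0. (\<forall>s\<ge>s1. deriv \<phi> s \<ge> 0) \<or> (\<forall>s\<ge>s1. deriv \<phi> s \<le> 0))"
    using phi_conditions[unfolded phi_conditions_def, THEN conjunct2, THEN conjunct2, THEN conjunct2, THEN conjunct2]
    by (elim exE) (rule that)
  note C = *[THEN conjunct1] *[THEN conjunct2, THEN conjunct1] *[THEN conjunct2, THEN conjunct2, THEN conjunct1]
    *[THEN conjunct2, THEN conjunct2, THEN conjunct2, THEN conjunct1]
  note tail = *[THEN conjunct2, THEN conjunct2, THEN conjunct2, THEN conjunct2]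
  note le0 = tail[THEN conjunct1] and s1 = tail[THEN conjunct2, THEN conjunct2]
  have le: "C1 * s powr r \<le> b' s \<and> b' s \<le> C2 * s powr r" if "0 < s" "s < s0" for s
    using bspec[OF le0, of s] that unfolding deriv_b[OF that(1)] by simp
  have r: "r + 1 > 0" using C by simp
  \<comment> \<open>The antiderivative of s^r that vanishes at zero, available because r >
    -1.\<close>
  define w where "w s = s powr (r + 1) / (r + 1)" for s
  have wD: "(w has_real_derivative s powr r) (at s)" if "s > 0" for s
  proof -
    have "((\<lambda>s. s powr (r + 1)) has_real_derivative (r + 1) * s powr (r + 1 - 1)) (at s)"
      by (rule has_real_derivative_powr[OF that])
    from DERIV_cdivide[OF this, of "r + 1"] show ?thesis using r by (simp add: w_def[abs_def])
  qed
  have wpos: "w s > 0" if "s > 0" for s using that r by (simp add: w_def)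
  have small: "\<exists>x>0. x < s \<and> w x \<le> e" if "s > 0" "e > 0" for s e
  proof -
    define x where "x = min (s / 2) ((e * (r + 1)) powr (1 / (r + 1)))"
    have x: "x > 0" "x < s" using that r by (auto simp: x_def)
    have "x powr (r + 1) \<le> ((e * (r + 1)) powr (1 / (r + 1))) powr (r + 1)"
      using x r by (intro powr_mono2) (auto simp: x_def)
    also have "\<dots> = e * (r + 1)" using that r by (simp add: powr_powr)
    finally have "w x \<le> e" using r by (simp add: w_def divide_le_eq)
    with x show ?thesis by blast
  qed
  have lower: "C1 * w s \<le> b s" if s: "0 < s" "s < s0" for s
  proof (rule field_le_epsilon)
    fix e :: real assume e: "e > 0"
    obtain x where x: "0 < x" "x < s" "w x \<le> e / C1" using small[of s "e / C1"] s e C by auto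
    have "b x - C1 * w x \<le> b s - C1 * w s"
    proof (rule DERIV_nonneg_imp_nondecreasing[OF less_imp_le[OF x(2)]])
      fix y assume "x \<le> y" "y \<le> s"
      then have y: "0 < y" "y < s0" using x s by auto
      have "((\<lambda>s. b s - C1 * w s) has_real_derivative b' y - C1 * y powr r) (at y)"
        by (intro DERIV_diff b_DERIV DERIV_cmult wD y)
      then show "\<exists>D. ((\<lambda>s. b s - C1 * w s) has_real_derivative D) (at y) \<and> 0 \<le> D"
        using le[OF y] by (intro exI[of _ "b' y - C1 * y powr r"]) auto
    qed
    moreover have "C1 * w x \<le> e" using x C by (simp add: field_simps)
    ultimately show "C1 * w s \<le> b s + e" using b_pos[OF x(1)] by linarith
  qed
  have upper: "b s \<le> C2 * w s" if s: "0 < s" "s < s0" for s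
  proof (rule field_le_epsilon)
    fix e :: real assume e: "e > 0"
    \<comment> \<open>That \<open>b\<close> becomes arbitrarily small comes from its range; taking
      at most half of \<open>b s\<close> forces the preimage to lie to the left of
      \<open>s\<close>.\<close>
    have "min e (b s / 2) \<in> b ` {0<..}" using b_image e b_pos[OF s(1)] by simp
    then obtain x where x: "0 < x" "b x = min e (b s / 2)" by auto
    have xs: "x < s"
    proof (rule ccontr)
      assume "\<not> x < s"
      then have "b s \<le> b x" using b_mono[OF s(1), of x] by (cases "s = x") auto
      then show False using x(2) b_pos[OF s(1)] by linarith
    qed
    have "C2 * w x - b x \<le> C2 * w s - b s"
    proof (rule DERIV_nonneg_imp_nondecreasing[OF less_imp_le[OF xs]])
      fix y assume "x \<le> y" "y \<le> s"
      then have y: "0 < y" "y < s0" using x s by auto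
      have "((\<lambda>s. C2 * w s - b s) has_real_derivative C2 * y powr r - b' y) (at y)"
        by (intro DERIV_diff b_DERIV DERIV_cmult wD y)
      then show "\<exists>D. ((\<lambda>s. C2 * w s - b s) has_real_derivative D) (at y) \<and> 0 \<le> D"
        using le[OF y] by (intro exI[of _ "C2 * y powr r - b' y"]) auto
    qed
    moreover have "0 \<le> C2 * w x" using wpos[OF x(1)] C by simp
    ultimately show "b s \<le> C2 * w s + e" using x(2) by linarith
  qed
  show ?thesis
  proof (rule that[of "C1 * (r + 1) / C2" s0 "C2 * (r + 1) / C1"])
    fix s assume s: "0 < s" "s < s0"
    have ps: "p s = s * b' s / b s" using s by (simp add: p_def b_def)
    have sw: "s * s powr r = (r + 1) * w s" using s r by (simp add: w_def powr_add)
    have bs: "b s > 0" using b_pos s by simp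
    have "C1 * (r + 1) / C2 * b s \<le> C1 * (r + 1) / C2 * (C2 * w s)"
      using upper[OF s] C r by (intro mult_left_mono) auto
    also have "\<dots> = s * (C1 * s powr r)" using C sw by (simp add: mult.left_commute)
    also have "\<dots> \<le> s * b' s" using le[OF s] s by (intro mult_left_mono) auto
    finally have 1: "C1 * (r + 1) / C2 \<le> p s" using bs by (simp add: ps le_divide_eq)
    have "s * b' s \<le> s * (C2 * s powr r)" using le[OF s] s by (intro mult_left_mono) auto
    also have "\<dots> = C2 * (r + 1) / C1 * (C1 * w s)" using C sw by (simp add: mult.left_commute)
    also have "\<dots> \<le> C2 * (r + 1) / C1 * b s"
      using lower[OF s] C r by (intro mult_left_mono) auto
    finally have 2: "p s \<le> C2 * (r + 1) / C1" using bs by (simp add: ps divide_le_eq)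
    from 1 2 show "C1 * (r + 1) / C2 \<le> p s \<and> p s \<le> C2 * (r + 1) / C1" ..
  qed (use C r s1 in auto)
qed

text \<open>The only place where the growth conditions (iv) and (v) are used.\<close>

lemma key_bound_exists:
  "\<exists>C. \<forall>s>0. (1 + p s) * (1 + \<phi> s) \<le> C * (1 + p s * \<phi> s)"
proof -
  obtain \<kappa> K s0 where k: "\<kappa> > 0" "s0 > 0" "\<And>s. 0 < s \<Longrightarrow> s < s0 \<Longrightarrow> \<kappa> \<le> p s \<and> p s \<le> K"
    "\<exists>s1>s0. (\<forall>s\<ge>s1. deriv \<phi> s \<ge> 0) \<or> (\<forall>s\<ge>s1. deriv \<phi> s \<le> 0)"
    using p_bounds_near_0 by metis
  obtain s1 where s1: "s1 > s0" "(\<forall>s\<ge>s1. deriv \<phi> s \<ge> 0) \<or> (\<forall>s\<ge>s1. deriv \<phi> s \<le> 0)" using k(4) by blast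
  have den: "1 + p s * \<phi> s > 0" if "s > 0" for s
    using p_pos[OF that] phi_pos[OF that] by (simp add: add_pos_pos)
  let ?R = "\<lambda>s. (1 + p s) * (1 + \<phi> s) / (1 + p s * \<phi> s)"
  have K0: "\<kappa> \<le> K" using k(3)[of "s0 / 2"] k(2) by auto
  \<comment> \<open>With \<open>p\<close> at least \<open>\<kappa>\<close>, the denominator is at
    least \<open>min 1 \<kappa>\<close> times 1 + \<open>\<phi>\<close>, and the other factor 1 +
    \<open>p\<close> is at most 1 + K.\<close>
  have near: "(1 + p s) * (1 + \<phi> s) \<le> (1 + K) / min 1 \<kappa> * (1 + p s * \<phi> s)" if s: "0 < s" "s < s0" for s
  proof -
    have "min 1 \<kappa> * (1 + \<phi> s) \<le> 1 + p s * \<phi> s"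
    proof -
      have "min 1 \<kappa> * \<phi> s \<le> p s * \<phi> s" using k(3)[OF s] phi_pos[OF s(1)] by (intro mult_right_mono) auto
      moreover have "min 1 \<kappa> * (1 + \<phi> s) = min 1 \<kappa> + min 1 \<kappa> * \<phi> s" by (simp add: distrib_left)
      ultimately show ?thesis by linarith
    qed
    then have "1 + \<phi> s \<le> (1 + p s * \<phi> s) / min 1 \<kappa>" using k(1) by (simp add: le_divide_eq mult.commute)
    moreover have "1 + p s \<le> 1 + K" using k(3)[OF s] by simp
    ultimately have "(1 + p s) * (1 + \<phi> s) \<le> (1 + K) * ((1 + p s * \<phi> s) / min 1 \<kappa>)"
      using phi_pos[OF s(1)] k(1) K0 by (intro mult_mono) auto
    then show ?thesis by simp
  qed
  have "\<exists>B. \<forall>s\<in>{s0 / 2..s1}. \<bar>?R s\<bar> \<le> B"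
  proof -
    have sub: "{s0 / 2..s1} \<subseteq> {0<..}" using k(2) by auto
    have "continuous_on {s0 / 2..s1} ?R"
      using den sub
      by (intro continuous_intros continuous_on_subset[OF p_continuous sub] continuous_on_subset[OF phi_continuous sub]) (force simp: less_le)
    from compact_imp_bounded[OF compact_continuous_image[OF this compact_Icc]]
    show ?thesis unfolding bounded_iff by auto
  qed
  then obtain B where "\<And>s. s \<in> {s0 / 2..s1} \<Longrightarrow> \<bar>?R s\<bar> \<le> B" by blast
  then have mid: "(1 + p s) * (1 + \<phi> s) \<le> B * (1 + p s * \<phi> s)" if "s0 \<le> s" "s \<le> s1" for s
    using that den[of s] k(2) by (force simp: abs_le_iff divide_le_eq)
  have pd: "p s = 1 + s * deriv \<phi> s / \<phi> s" if "s > 0" for s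
    using phi_pos[OF that] by (simp add: p_def b'_def add_divide_distrib)
  have s10: "s1 > 0" using s1 k by linarith
  \<comment> \<open>If \<open>\<phi>\<close> increases, then \<open>p\<close> is at least 1 and
    \<open>\<phi>\<close> is bounded below, so \<open>p * \<phi>\<close> alone controls the product.
    If it decreases, then \<open>p\<close> is at most 1 and \<open>\<phi>\<close> is bounded above,
    so the product is bounded outright.\<close>
  obtain B' where far: "\<And>s. s \<ge> s1 \<Longrightarrow> (1 + p s) * (1 + \<phi> s) \<le> B' * (1 + p s * \<phi> s)"
  proof (cases "\<forall>s\<ge>s1. deriv \<phi> s \<ge> 0")
    case True
    let ?m = "\<phi> s1"
    have m: "?m > 0" by (rule phi_pos[OF s10])
    have "(1 + p s) * (1 + \<phi> s) \<le> (2 * (1 / ?m + 1)) * (1 + p s * \<phi> s)" if s: "s \<ge> s1" for s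
    proof -
      have s0': "s > 0" using s s10 by simp
      have "?m \<le> \<phi> s"
      proof (rule DERIV_nonneg_imp_nondecreasing[OF s])
        fix x assume "s1 \<le> x" "x \<le> s"
        then have "x > 0" "deriv \<phi> x \<ge> 0" using True s10 by auto
        then show "\<exists>y. (\<phi> has_real_derivative y) (at x) \<and> 0 \<le> y" using phi_DERIV by blast
      qed
      then have "1 \<le> \<phi> s / ?m" using m by simp
      then have 1: "1 + \<phi> s \<le> (1 / ?m + 1) * \<phi> s" by (simp add: distrib_right)
      have "1 \<le> p s" using True s s0' phi_pos[OF s0'] by (simp add: pd)
      then have "(1 + p s) * (1 + \<phi> s) \<le> (2 * p s) * ((1 / ?m + 1) * \<phi> s)"
        using 1 phi_pos[OF s0'] by (intro mult_mono) auto
      also have "\<dots> = (2 * (1 / ?m + 1)) * (p s * \<phi> s)" by simp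
      also have "\<dots> \<le> (2 * (1 / ?m + 1)) * (1 + p s * \<phi> s)" using m by (intro mult_left_mono) auto
      finally show ?thesis .
    qed
    then show ?thesis by (rule that)
  next
    case False
    then have neg: "\<forall>s\<ge>s1. deriv \<phi> s \<le> 0" using s1(2) by blast
    let ?m = "\<phi> s1"
    have m: "?m > 0" by (rule phi_pos[OF s10])
    have "(1 + p s) * (1 + \<phi> s) \<le> (2 * (1 + ?m)) * (1 + p s * \<phi> s)" if s: "s \<ge> s1" for s
    proof -
      have s0': "s > 0" using s s10 by simp
      have 1: "\<phi> s \<le> ?m"
      proof (rule DERIV_nonpos_imp_nonincreasing[OF s])
        fix x assume "s1 \<le> x" "x \<le> s"
        then have "x > 0" "deriv \<phi> x \<le> 0" using neg s10 by auto
        then show "\<exists>y. (\<phi> has_real_derivative y) (at x) \<and> y \<le> 0" using phi_DERIV by blast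
      qed
      have "p s \<le> 1" using neg s s0' phi_pos[OF s0'] by (simp add: pd divide_le_0_iff mult_nonneg_nonpos)
      then have "(1 + p s) * (1 + \<phi> s) \<le> 2 * (1 + ?m)"
        using 1 phi_pos[OF s0'] p_pos[OF s0'] m by (intro mult_mono) auto
      also have "\<dots> \<le> (2 * (1 + ?m)) * (1 + p s * \<phi> s)"
        using m phi_pos[OF s0'] p_pos[OF s0'] by (simp add: mult_le_cancel_left1)
      finally show ?thesis .
    qed
    then show ?thesis by (rule that)
  qed
  let ?C = "max ((1 + K) / min 1 \<kappa>) (max B B')"
  have "(1 + p s) * (1 + \<phi> s) \<le> ?C * (1 + p s * \<phi> s)" if s: "s > 0" for s
  proof -
    have le: "x * (1 + p s * \<phi> s) \<le> ?C * (1 + p s * \<phi> s)" if "x \<le> ?C" for x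
      using den[OF s] that by (intro mult_right_mono) auto
    consider "s < s0" | "s0 \<le> s" "s \<le> s1" | "s1 \<le> s" by linarith
    then show ?thesis
    proof cases
      case 1 show ?thesis by (rule order_trans[OF near[OF s 1] le]) simp
    next
      case 2 show ?thesis by (rule order_trans[OF mid[OF 2] le]) simp
    next
      case 3 show ?thesis by (rule order_trans[OF far[OF 3] le]) simp
    qed
  qed
  then show ?thesis by blast
qed

definition key_const :: real where
  "key_const = (SOME C. \<forall>s>0. (1 + p s) * (1 + \<phi> s) \<le> C * (1 + p s * \<phi> s))"

lemma key_bound: "s > 0 \<Longrightarrow> (1 + p s) * (1 + \<phi> s) \<le> key_const * (1 + p s * \<phi> s)"
  using someI_ex[OF key_bound_exists] unfolding key_const_def by blast

lemma key_const_ge_1: "key_const \<ge> 1"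
proof -
  have pq: "p 1 > 0" "\<phi> 1 > 0" "p 1 * \<phi> 1 > 0" using p_pos[of 1] phi_pos[of 1] by auto
  have "1 * (1 + p 1 * \<phi> 1) \<le> (1 + p 1) * (1 + \<phi> 1)" using pq by (simp add: algebra_simps)
  also have "\<dots> \<le> key_const * (1 + p 1 * \<phi> 1)" by (rule key_bound) simp
  finally show ?thesis using pq by (simp add: mult_le_cancel_right)
qed

text \<open>With s = |u|, \<open>\<tau> s\<close> is |v| and \<open>\<mu> s\<close> is the modulus m
  of the sum w. Their inverses are \<open>zeta \<phi>\<close> and \<open>a\<close>. The logarithmic
  derivative of \<open>\<tau>\<close> with respect to log s is (1 + p)/2.\<close>

definition \<tau> :: "real \<Rightarrow> real" where "\<tau> s = s * sqrt (\<phi> s)"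
definition \<tau>' :: "real \<Rightarrow> real" where "\<tau>' s = sqrt (\<phi> s) * (1 + p s) / 2"
definition \<mu> :: "real \<Rightarrow> real" where "\<mu> s = s + b s"
definition a :: "real \<Rightarrow> real" where "a = inv_into {0<..} \<mu>"

section \<open>The changes of modulus and their inverses\<close>

lemma \<tau>_DERIV: "s > 0 \<Longrightarrow> (\<tau> has_real_derivative \<tau>' s) (at s)"
proof -
  assume s: "s > 0"
  note ph = phi_pos[OF s]
  have "(\<tau> has_real_derivative (sqrt (\<phi> s) + s * (deriv \<phi> s / (2 * sqrt (\<phi> s))))) (at s)"
    unfolding \<tau>_def[abs_def] using ph
    by (auto intro!: derivative_eq_intros phi_DERIV[OF s] simp: field_simps)
  also have "sqrt (\<phi> s) + s * (deriv \<phi> s / (2 * sqrt (\<phi> s))) = \<tau>' s"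
  proof -
    have "sqrt (\<phi> s) * sqrt (\<phi> s) = \<phi> s" using ph by simp
    then show ?thesis using ph unfolding \<tau>'_def p_def b'_def
      by (simp add: field_simps)
  qed
  finally show ?thesis .
qed

lemma \<tau>'_pos: "s > 0 \<Longrightarrow> \<tau>' s > 0"
  using phi_pos[of s] p_pos[of s] by (simp add: \<tau>'_def)

lemma \<tau>_pos: "s > 0 \<Longrightarrow> \<tau> s > 0"
  using phi_pos by (simp add: \<tau>_def)

lemma \<tau>_sq: "s > 0 \<Longrightarrow> (\<tau> s)\<^sup>2 = s * b s"
  using phi_pos[of s] by (simp add: \<tau>_def b_def power_mult_distrib power2_eq_square)

lemma \<mu>_DERIV: "s > 0 \<Longrightarrow> (\<mu> has_real_derivative (1 + b' s)) (at s)"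
  unfolding \<mu>_def[abs_def] by (intro DERIV_add DERIV_ident b_DERIV)

lemma \<mu>'_pos: "s > 0 \<Longrightarrow> 1 + b' s > 0"
  using b'_pos[of s] by simp

lemma image_by_IVT:
  fixes f :: "real \<Rightarrow> real"
  assumes cont: "continuous_on {0<..} f" and pos: "\<And>s. s > 0 \<Longrightarrow> f s > 0"
    and x: "\<And>t. t > 0 \<Longrightarrow> \<exists>x>0. f x \<le> t" "\<And>t. t > 0 \<Longrightarrow> \<exists>y>0. t \<le> f y"
  shows "f ` {0<..} = {0<..}"
proof (intro equalityI subsetI)
  fix t :: real assume "t \<in> {0<..}"
  then have t: "t > 0" by simp
  obtain u v where uv: "u > 0" "f u \<le> t" "v > 0" "t \<le> f v" using x t by meson
  have conn: "connected (f ` {0<..})"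
    by (rule connected_continuous_image[OF cont]) simp
  show "t \<in> f ` {0<..}"
    using connectedD_interval[OF conn, of "f u" "f v" t] uv by auto
qed (use pos in auto)

lemma \<mu>_image: "\<mu> ` {0<..} = {0<..}"
proof (rule image_by_IVT)
  show "continuous_on {0<..} \<mu>"
    using \<mu>_DERIV by (intro continuous_at_imp_continuous_on) (auto intro: DERIV_isCont)
  show "\<mu> s > 0" if "s > 0" for s using b_pos that by (simp add: \<mu>_def add_pos_pos)
  fix t :: real assume t: "t > 0"
  have "t / 2 \<in> b ` {0<..}" using b_image t by simp
  then obtain u where u: "u > 0" "b u = t / 2" by auto
  have "b (min u (t / 2)) \<le> b u" using b_mono[of "min u (t / 2)" u] u t by (cases "u \<le> t / 2") auto
  then show "\<exists>x>0. \<mu> x \<le> t" using u t by (intro exI[of _ "min u (t / 2)"]) (auto simp: \<mu>_def)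
  show "\<exists>y>0. t \<le> \<mu> y" using b_pos[OF t] t by (intro exI[of _ t]) (auto simp: \<mu>_def)
qed

text \<open>The square of \<open>\<tau>\<close> is the product of the increasing functions
  \<open>s\<close> and \<open>b s\<close>. If \<open>b u = t\<close>, both factors are at most
  \<open>t\<close> at \<open>min u t\<close> and at least \<open>t\<close> at
  \<open>max u t\<close>.\<close>

lemma \<tau>_image: "\<tau> ` {0<..} = {0<..}"
proof (rule image_by_IVT)
  show "continuous_on {0<..} \<tau>"
    using \<tau>_DERIV by (intro continuous_at_imp_continuous_on) (auto intro: DERIV_isCont)
  show "\<tau> s > 0" if "s > 0" for s using \<tau>_pos that .
  fix t :: real assume t: "t > 0"
  have "t \<in> b ` {0<..}" using b_image t by simp
  then obtain u where u: "u > 0" "b u = t" by auto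
  have le: "b x \<le> b y" if "0 < x" "x \<le> y" for x y using b_mono[of x y] that by (cases "x = y") auto
  have lo: "(\<tau> (min u t))\<^sup>2 \<le> t\<^sup>2"
    using u t le[of "min u t" u] b_pos[of "min u t"] unfolding power2_eq_square[of t]
    by (subst \<tau>_sq) (auto intro!: mult_mono)
  have hi: "t\<^sup>2 \<le> (\<tau> (max u t))\<^sup>2"
    using u t le[of u "max u t"] unfolding power2_eq_square[of t]
    by (subst \<tau>_sq) (auto intro!: mult_mono)
  show "\<exists>x>0. \<tau> x \<le> t" using u t power2_le_imp_le[OF lo] by (intro exI[of _ "min u t"]) auto
  have "0 \<le> \<tau> (max u t)" using \<tau>_pos[of "max u t"] t by (simp add: less_imp_le)
  from power2_le_imp_le[OF hi this] show "\<exists>y>0. t \<le> \<tau> y" using t by (intro exI[of _ "max u t"]) auto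
qed

lemma a_props:
  "t > 0 \<Longrightarrow> a t > 0" "t > 0 \<Longrightarrow> \<mu> (a t) = t"
  "t > 0 \<Longrightarrow> (a has_real_derivative 1 / (1 + b' (a t))) (at t)"
  "s > 0 \<Longrightarrow> a (\<mu> s) = s" "0 < s \<Longrightarrow> s < u \<Longrightarrow> \<mu> s < \<mu> u"
  unfolding a_def
  by (auto intro!: positive_inverse[where f = \<mu> and f' = "\<lambda>s. 1 + b' s"] \<mu>_DERIV \<mu>'_pos \<mu>_image zero_less_one)

lemma zeta_eq: "zeta \<phi> = inv_into {0<..} \<tau>"
  by (simp add: zeta_def \<tau>_def[abs_def])

lemma zeta_props:
  "t > 0 \<Longrightarrow> zeta \<phi> t > 0" "t > 0 \<Longrightarrow> \<tau> (zeta \<phi> t) = t"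
  "t > 0 \<Longrightarrow> (zeta \<phi> has_real_derivative 1 / \<tau>' (zeta \<phi> t)) (at t)"
  "s > 0 \<Longrightarrow> zeta \<phi> (\<tau> s) = s" "0 < s \<Longrightarrow> s < u \<Longrightarrow> \<tau> s < \<tau> u"
  unfolding zeta_eq
  by (auto intro!: positive_inverse[where f = \<tau> and f' = \<tau>'] \<tau>_DERIV \<tau>'_pos \<tau>_image zero_less_one)

lemma zeta_continuous: "continuous_on {0<..} (zeta \<phi>)"
  using zeta_props(3) by (intro continuous_at_imp_continuous_on) (auto intro: DERIV_isCont)

lemma a_continuous: "continuous_on {0<..} a"
  using a_props(3) by (intro continuous_at_imp_continuous_on) (auto intro: DERIV_isCont)

text \<open>\<open>Lambda\<close> is the logarithmic derivative of \<open>zeta \<phi>\<close> minus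
  1, since \<open>Theta\<close> divides by t. The logarithmic derivative of an inverse is the
  reciprocal one, here 2/(1 + p).\<close>

lemma Lambda_eq:
  assumes t: "t > 0"
  shows "Lambda \<phi> t = (1 - p (zeta \<phi> t)) / (1 + p (zeta \<phi> t))"
proof -
  define s where "s = zeta \<phi> t"
  have s: "s > 0" "\<tau> s = t" using zeta_props(1,2)[OF t] by (simp_all add: s_def)
  note pp = p_pos[OF s(1)] phi_pos[OF s(1)]
  have "(Theta \<phi> has_real_derivative (1 / \<tau>' s * t - s) / (t * t)) (at t)"
    unfolding Theta_def[abs_def] s_def
    using DERIV_divide[OF zeta_props(3)[OF t] DERIV_ident] t by simp
  then have "deriv (Theta \<phi>) t = (1 / \<tau>' s * t - s) / (t * t)" by (rule DERIV_imp_deriv)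
  then have "Lambda \<phi> t = t / (s * \<tau>' s) - 1"
    unfolding Lambda_def using t s \<tau>'_pos[OF s(1)] by (simp add: Theta_def s_def[symmetric] field_simps)
  also have "t / (s * \<tau>' s) = 2 / (1 + p s)"
  proof -
    have "x * y / (x * (y * z / 2)) = 2 / z" if "x > 0" "y > 0" for x y z :: real
      using that by (simp add: divide_simps)
    from this[OF s(1), of "sqrt (\<phi> s)" "1 + p s"] show ?thesis
      using pp unfolding s(2)[symmetric] \<tau>_def \<tau>'_def by simp
  qed
  also have "2 / (1 + p s) - 1 = (1 - p s) / (1 + p s)" using pp by (simp add: field_simps)
  finally show ?thesis by (simp add: s_def)
qed

lemma Lambda_continuous: "continuous_on {0<..} (Lambda \<phi>)"
proof -
  have "continuous_on {0<..} (\<lambda>t. p (zeta \<phi> t))"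
    by (rule continuous_on_compose2[OF p_continuous zeta_continuous]) (use zeta_props(1) in auto)
  moreover have "1 + p (zeta \<phi> t) \<noteq> 0" if "t > 0" for t
    using p_pos[OF zeta_props(1)[OF that]] by simp
  ultimately have "continuous_on {0<..} (\<lambda>t. (1 - p (zeta \<phi> t)) / (1 + p (zeta \<phi> t)))"
    by (intro continuous_intros) auto
  then show ?thesis using Lambda_eq by (simp cong: continuous_on_cong_simp)
qed

lemma abs_Lambda_le: "t \<ge> 0 \<Longrightarrow> \<bar>Lambda \<phi> t\<bar> \<le> 1"
proof (cases "t = 0")
  case True then show ?thesis by (simp add: Lambda_def)
next
  case False
  assume "t \<ge> 0"
  with False have t: "t > 0" by simp
  show ?thesis using p_pos[OF zeta_props(1)[OF t]] by (simp add: Lambda_eq[OF t] divide_simps)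
qed

text \<open>With s = |u|, the left sides are the products of the radial factors 1, \<open>b'\<close>
  and the angular factors s, \<open>b\<close> of u and its multiple; the right sides are those that
  the \<open>Lambda\<close> integrand produces for v. All rest on 1 + l = 2/(1 + p) and 1 - l =
  2p/(1 + p).\<close>

lemma Lambda_identities:
  assumes s: "s > 0"
  defines "l \<equiv> Lambda \<phi> (\<tau> s)"
  shows "b' s = (1 - l\<^sup>2) * (\<tau>' s)\<^sup>2" "b s = (1 + l) * \<tau>' s * \<tau> s"
    "s * b' s = (1 - l) * \<tau>' s * \<tau> s" "s * b s = (\<tau> s)\<^sup>2"
proof -
  have pp: "p s > 0" "\<phi> s > 0" using p_pos s phi_pos by auto
  have l: "l = (1 - p s) / (1 + p s)"
    unfolding l_def using Lambda_eq[OF \<tau>_pos[OF s]] zeta_props(4)[OF s] by simp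
  have l1: "1 + l = 2 / (1 + p s)" "1 - l = 2 * p s / (1 + p s)" using pp by (simp_all add: l field_simps)
  have l2: "1 - l\<^sup>2 = (1 + l) * (1 - l)" by (simp add: power2_eq_square algebra_simps)
  have sq: "sqrt (\<phi> s) * sqrt (\<phi> s) = \<phi> s" using pp by simp
  have np: "1 + p s \<noteq> 0" using pp by simp
  have t2: "(\<tau>' s)\<^sup>2 = \<phi> s * (1 + p s)\<^sup>2 / 4"
    using pp by (simp add: \<tau>'_def power_mult_distrib power_divide)
  have tt: "\<tau>' s * \<tau> s = s * \<phi> s * (1 + p s) / 2"
    unfolding \<tau>'_def \<tau>_def using sq by (simp add: algebra_simps)
  show "b' s = (1 - l\<^sup>2) * (\<tau>' s)\<^sup>2"
    unfolding l2 l1 t2 b'_eq[OF s] using np by (simp add: power2_eq_square)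
  show "b s = (1 + l) * \<tau>' s * \<tau> s" "s * b' s = (1 - l) * \<tau>' s * \<tau> s"
    unfolding l1 mult.assoc tt b'_eq[OF s] b_def using np by simp_all
  show "s * b s = (\<tau> s)\<^sup>2" by (simp add: \<tau>_sq[OF s])
qed

definition a' :: "real \<Rightarrow> real" where "a' m = 1 / (1 + b' (a m))"

lemma a_DERIV: "m > 0 \<Longrightarrow> (a has_real_derivative a' m) (at m)"
  unfolding a'_def by (rule a_props(3))

lemma b_a: "m > 0 \<Longrightarrow> b (a m) = m - a m"
  using a_props(2)[of m] by (simp add: \<mu>_def)

lemma a_less: "m > 0 \<Longrightarrow> a m < m"
  using b_a[of m] b_pos[OF a_props(1)[of m]] by simp

lemma a'_bounds: "m > 0 \<Longrightarrow> 0 < a' m \<and> a' m < 1"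
  using b'_pos[OF a_props(1)[of m]] by (simp add: a'_def)

lemma a'_compl: "m > 0 \<Longrightarrow> 1 - a' m = b' (a m) * a' m"
  using b'_pos[OF a_props(1)[of m]] by (simp add: a'_def field_simps)

lemma b'_a_continuous: "continuous_on {0<..} (\<lambda>m. b' (a m))"
  by (rule continuous_on_compose2[OF b'_continuous a_continuous]) (use a_props(1) in auto)

lemma a'_continuous: "continuous_on {0<..} a'"
  unfolding a'_def[abs_def] using \<mu>'_pos[OF a_props(1)]
  by (intro continuous_intros b'_a_continuous) (auto simp: less_le)

lemma \<tau>'_continuous: "continuous_on {0<..} \<tau>'"
  unfolding \<tau>'_def[abs_def] by (intro continuous_intros phi_continuous p_continuous) auto

text \<open>Since m = s(1 + \<open>\<phi>\<close>) and \<open>a'\<close> = 1/(1 + p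
  \<open>\<phi>\<close>), the first three ratios are parts of the quotient in
  \<open>key_bound\<close>; the third also uses that the root of \<open>\<phi>\<close> is at most 1
  + \<open>\<phi>\<close>. The first two bound the logarithmic derivatives of the two moduli in m,
  which the approximation argument needs; the last two make |v| Lipschitz in m.\<close>

lemma a'_weighted_bounds:
  assumes m: "m > 0"
  shows "m * a' m \<le> key_const * a m" "m * (1 - a' m) \<le> key_const * (m - a m)" "\<tau>' (a m) * a' m \<le> key_const" "\<tau> (a m) \<le> m"
proof -
  define s where "s = a m"
  have s: "s > 0" using a_props(1)[OF m] by (simp add: s_def)
  note pp = p_pos[OF s] phi_pos[OF s]
  have pq: "p s * \<phi> s > 0" using pp by simp
  have ms: "m = s * (1 + \<phi> s)" using a_props(2)[OF m] by (simp add: s_def[symmetric] \<mu>_def b_def distrib_left)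
  have a': "a' m = 1 / (1 + p s * \<phi> s)" by (simp add: a'_def s_def[symmetric] b'_eq[OF s])
  have ca: "1 - a' m = p s * \<phi> s / (1 + p s * \<phi> s)" using pq by (simp add: a' field_simps)
  have kb: "(1 + p s) * (1 + \<phi> s) / (1 + p s * \<phi> s) \<le> key_const"
    using key_bound[OF s] pq by (simp add: divide_le_eq)
  have "(1 + \<phi> s) / (1 + p s * \<phi> s) \<le> (1 + p s) * (1 + \<phi> s) / (1 + p s * \<phi> s)"
    using pp pq by (intro divide_right_mono) (auto simp: mult_le_cancel_right1)
  then have 1: "(1 + \<phi> s) / (1 + p s * \<phi> s) \<le> key_const" using kb by simp
  have "p s * (1 + \<phi> s) / (1 + p s * \<phi> s) \<le> (1 + p s) * (1 + \<phi> s) / (1 + p s * \<phi> s)"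
    using pp pq by (intro divide_right_mono mult_right_mono) auto
  then have 2: "p s * (1 + \<phi> s) / (1 + p s * \<phi> s) \<le> key_const" using kb by simp
  have "m * a' m = s * ((1 + \<phi> s) / (1 + p s * \<phi> s))"
    unfolding a' unfolding ms by simp
  also have "\<dots> \<le> s * key_const" using 1 s by (intro mult_left_mono) auto
  finally show "m * a' m \<le> key_const * a m" by (simp add: s_def mult.commute)
  have "m * (1 - a' m) = (s * \<phi> s) * (p s * (1 + \<phi> s) / (1 + p s * \<phi> s))"
    unfolding ca unfolding ms by simp
  also have "\<dots> \<le> (s * \<phi> s) * key_const" using 2 s pp by (intro mult_left_mono) auto
  also have "s * \<phi> s = m - a m" using b_a[OF m] by (simp add: b_def s_def)
  finally show "m * (1 - a' m) \<le> key_const * (m - a m)" by (simp add: mult.commute)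
  have sq: "sqrt (\<phi> s) \<le> 1 + \<phi> s"
    using norm_mult_le_sq[of 1 "sqrt (\<phi> s)"] pp by simp
  have "\<tau>' s * a' m = sqrt (\<phi> s) * (1 + p s) / (1 + p s * \<phi> s) / 2" by (simp add: \<tau>'_def a')
  also have "\<dots> \<le> (1 + \<phi> s) * (1 + p s) / (1 + p s * \<phi> s) / 2"
    using sq pp pq by (intro divide_right_mono mult_right_mono) auto
  also have "\<dots> \<le> key_const / 2"
    unfolding mult.commute[of "1 + \<phi> s" "1 + p s"] using kb by (rule divide_right_mono) simp
  also have "\<dots> \<le> key_const" using key_const_ge_1 by simp
  finally show "\<tau>' (a m) * a' m \<le> key_const" by (simp add: s_def)
  have "\<tau> s \<le> m"
    unfolding ms unfolding \<tau>_def using sq s by (intro mult_left_mono) auto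
  then show "\<tau> (a m) \<le> m" by (simp only: s_def)
qed

text \<open>The modulus m of the overview as a function of t = |v|.\<close>

definition mu_zeta :: "real \<Rightarrow> real" where "mu_zeta t = \<mu> (zeta \<phi> t)"
definition mu_zeta' :: "real \<Rightarrow> real" where "mu_zeta' t = (1 + b' (zeta \<phi> t)) / \<tau>' (zeta \<phi> t)"
text \<open>The mean \<open>m\<^sub>k\<close> of the introduction.\<close>

definition damped :: "real \<Rightarrow> real \<Rightarrow> real" where "damped k t = 1 / (1 / mu_zeta t + 1 / (k * t) + 1 / k)"
definition damped' :: "real \<Rightarrow> real \<Rightarrow> real" where
  "damped' k t = (damped k t)\<^sup>2 * (mu_zeta' t / (mu_zeta t)\<^sup>2 + 1 / (k * t\<^sup>2))"

section \<open>The damped mean and its logarithmic derivative\<close>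

lemma mu_zeta_pos: "t > 0 \<Longrightarrow> mu_zeta t > 0"
  using zeta_props(1)[of t] b_pos by (simp add: mu_zeta_def \<mu>_def add_pos_pos)

lemma a_mu_zeta: "t > 0 \<Longrightarrow> a (mu_zeta t) = zeta \<phi> t"
  unfolding mu_zeta_def by (rule a_props(4)[OF zeta_props(1)])

lemma mu_zeta_DERIV: "t > 0 \<Longrightarrow> (mu_zeta has_real_derivative mu_zeta' t) (at t)"
  unfolding mu_zeta_def[abs_def] mu_zeta'_def
  using DERIV_chain2[OF \<mu>_DERIV[OF zeta_props(1)] zeta_props(3)] by simp

lemma mu_zeta'_pos: "t > 0 \<Longrightarrow> mu_zeta' t > 0"
  using \<mu>'_pos[OF zeta_props(1)] \<tau>'_pos[OF zeta_props(1)] by (simp add: mu_zeta'_def)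

lemma mu_zeta_continuous: "continuous_on {0<..} mu_zeta"
  using mu_zeta_DERIV by (intro continuous_at_imp_continuous_on) (auto intro: DERIV_isCont)

lemma mu_zeta'_continuous: "continuous_on {0<..} mu_zeta'"
  unfolding mu_zeta'_def[abs_def] using \<tau>'_pos[OF zeta_props(1)] zeta_props(1)
  by (intro continuous_intros continuous_on_compose2[OF b'_continuous zeta_continuous]
      continuous_on_compose2[OF \<tau>'_continuous zeta_continuous]) (auto simp: less_le)

text \<open>At s = \<open>zeta \<phi> t\<close> the logarithmic derivative of \<open>mu_zeta\<close>
  is 2(1 + p \<open>\<phi>\<close>)/((1 + p)(1 + \<open>\<phi>\<close>)), and the denominator
  dominates on expansion.\<close>

lemma mu_zeta'_le:
  assumes t: "t > 0" shows "t * mu_zeta' t \<le> 2 * mu_zeta t"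
proof -
  define s where "s = zeta \<phi> t"
  have s: "s > 0" "t = \<tau> s" using zeta_props(1,2)[OF t] by (simp_all add: s_def)
  note pp = p_pos[OF s(1)] phi_pos[OF s(1)]
  have pq: "p s * \<phi> s > 0" using pp by simp
  have "x * y / (y * z / 2) = x * 2 / z" if "y > 0" "z > 0" for x y z :: real
    using that by (simp add: divide_simps)
  from this[of "sqrt (\<phi> s)" "1 + p s" s] have "\<tau> s / \<tau>' s = s * 2 / (1 + p s)"
    using pp by (simp add: \<tau>_def \<tau>'_def)
  then have ts: "t / \<tau>' s = s * 2 / (1 + p s)" by (simp add: s(2)[symmetric])
  have "t * mu_zeta' t = (t / \<tau>' s) * (1 + p s * \<phi> s)"
    unfolding mu_zeta'_def s_def[symmetric] b'_eq[OF s(1)] by simp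
  then have "t * mu_zeta' t = 2 * s * ((1 + p s * \<phi> s) / (1 + p s))" unfolding ts by simp
  also have "(1 + p s * \<phi> s) / (1 + p s) \<le> 1 + \<phi> s"
    using pp by (simp add: divide_le_eq algebra_simps)
  finally have "t * mu_zeta' t \<le> 2 * s * (1 + \<phi> s)" using s by (simp add: mult_left_mono)
  also have "\<dots> = 2 * mu_zeta t" by (simp add: mu_zeta_def s_def[symmetric] \<mu>_def b_def algebra_simps)
  finally show ?thesis .
qed

text \<open>Reciprocals add, so the mean lies below each of its members. Its logarithmic derivative
  is the average of theirs, weighted by the reciprocals; those of \<open>mu_zeta\<close>,
  \<open>k * t\<close> and the constant are at most 2, equal to 1 and equal to 0. Hence the bound 2,
  independent of \<open>k\<close>.\<close>

lemma damped_facts: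
  assumes k: "k \<ge> 1" and t: "t > 0"
  shows "damped k t > 0" "damped k t \<le> k * t" "damped k t \<le> mu_zeta t" "damped' k t > 0" "t * damped' k t \<le> 2 * damped k t"
proof -
  have pos: "1 / mu_zeta t > 0" "1 / (k * t) > 0" "1 / k > 0" using mu_zeta_pos[OF t] k t by auto
  show mkp: "damped k t > 0" using pos by (simp add: damped_def add_pos_pos)
  have inv: "1 / damped k t = 1 / mu_zeta t + 1 / (k * t) + 1 / k" by (simp add: damped_def)
  have "1 / damped k t \<ge> 1 / (k * t)" "1 / damped k t \<ge> 1 / mu_zeta t" unfolding inv using pos by linarith+
  then show "damped k t \<le> k * t" "damped k t \<le> mu_zeta t"
    using mkp mu_zeta_pos[OF t] k t by (auto simp: divide_simps split: if_splits)
  show "damped' k t > 0"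
    unfolding damped'_def using mkp mu_zeta'_pos[OF t] mu_zeta_pos[OF t] k t
    by (intro mult_pos_pos add_pos_nonneg) auto
  have "t * damped' k t = (damped k t)\<^sup>2 * ((t * mu_zeta' t) / (mu_zeta t)\<^sup>2 + 1 / (k * t))"
    using t k by (simp add: damped'_def field_simps power2_eq_square)
  also have "\<dots> \<le> (damped k t)\<^sup>2 * ((2 * mu_zeta t) / (mu_zeta t)\<^sup>2 + 1 / (k * t))"
    using mu_zeta'_le[OF t] by (intro mult_left_mono add_right_mono divide_right_mono) auto
  also have "(2 * mu_zeta t) / (mu_zeta t)\<^sup>2 = 2 * (1 / mu_zeta t)" using mu_zeta_pos[OF t] by (simp add: power2_eq_square)
  also have "(damped k t)\<^sup>2 * (2 * (1 / mu_zeta t) + 1 / (k * t)) \<le> (damped k t)\<^sup>2 * (2 * (1 / damped k t))"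
    unfolding inv distrib_left[of 2] using pos by (intro mult_left_mono) (linarith, simp)
  also have "\<dots> = 2 * damped k t" using mkp by (simp add: power2_eq_square)
  finally show "t * damped' k t \<le> 2 * damped k t" .
qed

lemma damped_DERIV:
  assumes k: "k \<ge> 1" and t: "t > 0"
  shows "(damped k has_real_derivative damped' k t) (at t)"
proof -
  have pos: "1 / mu_zeta t > 0" "1 / (k * t) > 0" "1 / k > 0" using mu_zeta_pos[OF t] k t by auto
  define D where "D t = 1 / mu_zeta t + 1 / (k * t) + 1 / k" for t
  have Dp: "D t > 0" unfolding D_def using pos by linarith
  have "(D has_real_derivative - (mu_zeta' t / (mu_zeta t)\<^sup>2 + 1 / (k * t\<^sup>2))) (at t)"
    unfolding D_def[abs_def] using mu_zeta_pos[OF t] k t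
    by (auto intro!: derivative_eq_intros mu_zeta_DERIV[OF t] simp: field_simps power2_eq_square)
  from DERIV_inverse_fun[OF this] Dp
  have "((\<lambda>t. inverse (D t)) has_real_derivative (mu_zeta' t / (mu_zeta t)\<^sup>2 + 1 / (k * t\<^sup>2)) * (inverse (D t))\<^sup>2) (at t)"
    by (simp add: power2_eq_square algebra_simps)
  moreover have "damped k = (\<lambda>t. inverse (D t))" by (simp add: fun_eq_iff damped_def D_def inverse_eq_divide)
  ultimately show ?thesis by (simp add: damped'_def mult.commute)
qed

lemma damped_continuous: "k \<ge> 1 \<Longrightarrow> continuous_on {0<..} (damped k)"
  using damped_DERIV by (intro continuous_at_imp_continuous_on) (auto intro: DERIV_isCont)

lemma damped'_continuous: "k \<ge> 1 \<Longrightarrow> continuous_on {0<..} (damped' k)"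
  unfolding damped'_def using mu_zeta_pos
  by (intro continuous_intros damped_continuous mu_zeta_continuous mu_zeta'_continuous) (auto simp: less_le)

text \<open>The moduli of \<open>u\<^sub>k\<close> and \<open>\<phi>(\<bar>u\<^sub>k\<bar>) u\<^sub>k\<close> as functions of \<open>t = \<bar>v\<bar>\<close>.\<close>

definition u_prof :: "real \<Rightarrow> real \<Rightarrow> real" where "u_prof k t = a (damped k t)"
definition u_prof' :: "real \<Rightarrow> real \<Rightarrow> real" where "u_prof' k t = a' (damped k t) * damped' k t"
definition w_prof :: "real \<Rightarrow> real \<Rightarrow> real" where "w_prof k t = damped k t - a (damped k t)"
definition w_prof' :: "real \<Rightarrow> real \<Rightarrow> real" where "w_prof' k t = (1 - a' (damped k t)) * damped' k t"

lemma profile_DERIV: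
  assumes k: "k \<ge> 1" and t: "t > 0"
  shows "(u_prof k has_real_derivative u_prof' k t) (at t)" "(w_prof k has_real_derivative w_prof' k t) (at t)"
proof -
  show 1: "(u_prof k has_real_derivative u_prof' k t) (at t)"
    unfolding u_prof_def[abs_def] u_prof'_def
    by (rule DERIV_chain2[OF a_DERIV[OF damped_facts(1)[OF k t]] damped_DERIV[OF k t]])
  have "((\<lambda>t. damped k t - u_prof k t) has_real_derivative damped' k t - u_prof' k t) (at t)"
    by (rule DERIV_diff[OF damped_DERIV[OF k t] 1])
  then show "(w_prof k has_real_derivative w_prof' k t) (at t)"
    by (simp add: w_prof_def[abs_def] u_prof_def w_prof'_def u_prof'_def left_diff_distrib)
qed

lemma profile_deriv_continuous:
  assumes k: "k \<ge> 1"
  shows "continuous_on {0<..} (u_prof' k)" "continuous_on {0<..} (w_prof' k)"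
  unfolding u_prof'_def[abs_def] w_prof'_def[abs_def] using damped_facts(1)[OF k]
  by (intro continuous_intros damped'_continuous[OF k] continuous_on_compose2[OF a'_continuous damped_continuous[OF k]]; auto)+

text \<open>Two kinds of bounds. Those with \<open>k\<close> make the profiles Lipschitz, so that
  the approximating functions lie in the space. Those without \<open>k\<close> dominate the
  integrands: logarithmic derivatives at most \<open>2 * key_const\<close>, with 2 from the damping
  and the rest from \<open>a\<close>, and a product of moduli at most t^2.\<close>

lemma profile_bounds:
  assumes k: "k \<ge> 1" and t: "t > 0"
  shows "0 < u_prof k t" "0 < w_prof k t" "u_prof k t \<le> k * t" "w_prof k t \<le> k * t"
    "0 < u_prof' k t" "0 < w_prof' k t" "t * u_prof' k t \<le> 2 * key_const * u_prof k t" "t * w_prof' k t \<le> 2 * key_const * w_prof k t"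
    "u_prof k t * w_prof k t \<le> t\<^sup>2" "u_prof' k t \<le> 2 * k" "w_prof' k t \<le> 2 * k"
proof -
  note m = damped_facts[OF k t]
  have f2b: "w_prof k t = b (u_prof k t)" by (simp add: u_prof_def w_prof_def b_a[OF m(1)])
  show p1: "0 < u_prof k t" unfolding u_prof_def by (rule a_props(1)[OF m(1)])
  show p2: "0 < w_prof k t" unfolding f2b by (rule b_pos[OF p1])
  have "u_prof k t + w_prof k t = damped k t" by (simp add: u_prof_def w_prof_def)
  with p1 p2 m(2) show "u_prof k t \<le> k * t" "w_prof k t \<le> k * t" by linarith+
  have ab: "0 < a' (damped k t)" "a' (damped k t) < 1" using a'_bounds[OF m(1)] by auto
  show p1': "0 < u_prof' k t" and p2': "0 < w_prof' k t" using ab m(4) by (auto simp: u_prof'_def w_prof'_def)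
  have C0: "key_const \<ge> 0" using key_const_ge_1 by simp
  have "t * u_prof' k t = a' (damped k t) * (t * damped' k t)" by (simp add: u_prof'_def)
  also have "\<dots> \<le> a' (damped k t) * (2 * damped k t)" using ab m(5) by (intro mult_left_mono) auto
  also have "\<dots> = 2 * (damped k t * a' (damped k t))" by simp
  also have "\<dots> \<le> 2 * (key_const * a (damped k t))" using a'_weighted_bounds(1)[OF m(1)] by simp
  finally show "t * u_prof' k t \<le> 2 * key_const * u_prof k t" by (simp add: u_prof_def)
  have "t * w_prof' k t = (1 - a' (damped k t)) * (t * damped' k t)" by (simp add: w_prof'_def)
  also have "\<dots> \<le> (1 - a' (damped k t)) * (2 * damped k t)" using ab m(5) by (intro mult_left_mono) auto
  also have "\<dots> = 2 * (damped k t * (1 - a' (damped k t)))" by simp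
  also have "\<dots> \<le> 2 * (key_const * (damped k t - a (damped k t)))" using a'_weighted_bounds(2)[OF m(1)] by simp
  finally show "t * w_prof' k t \<le> 2 * key_const * w_prof k t" by (simp add: w_prof_def)
  have mk2: "damped' k t \<le> 2 * k"
  proof -
    have "t * damped' k t \<le> 2 * (k * t)" using m(2,5) by linarith
    also have "\<dots> = t * (2 * k)" by simp
    finally have "t * damped' k t \<le> t * (2 * k)" .
    then show ?thesis using t by simp
  qed
  have "u_prof' k t \<le> 1 * damped' k t" "w_prof' k t \<le> 1 * damped' k t"
    unfolding u_prof'_def w_prof'_def using ab m(4) by (intro mult_right_mono; simp)+
  with mk2 show "u_prof' k t \<le> 2 * k" "w_prof' k t \<le> 2 * k" by auto
  \<comment> \<open>The mean lies below \<open>mu_zeta\<close> and \<open>\<mu>\<close> increases,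
    so damping lowers both moduli. Their undamped product is exactly t^2.\<close>
  have le: "u_prof k t \<le> zeta \<phi> t"
  proof (rule ccontr)
    assume "\<not> u_prof k t \<le> zeta \<phi> t"
    then have "\<mu> (zeta \<phi> t) < \<mu> (u_prof k t)" by (intro a_props(5) zeta_props(1)[OF t]) simp
    then have "mu_zeta t < damped k t" using a_props(2)[OF m(1)] by (simp add: mu_zeta_def u_prof_def)
    with m(3) show False by simp
  qed
  then have "b (u_prof k t) \<le> b (zeta \<phi> t)" using b_mono[OF p1, of "zeta \<phi> t"] by (cases "u_prof k t = zeta \<phi> t") auto
  then have "u_prof k t * w_prof k t \<le> zeta \<phi> t * b (zeta \<phi> t)"
    unfolding f2b using le p1 p2 f2b by (intro mult_mono) auto
  also have "\<dots> = t\<^sup>2" using \<tau>_sq[OF zeta_props(1)[OF t]] zeta_props(2)[OF t] by simp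
  finally show "u_prof k t * w_prof k t \<le> t\<^sup>2" .
qed

text \<open>The damping terms disappear and leave \<open>zeta \<phi>\<close> and \<open>b\<close>
  composed with it, together with their derivatives. The index \<open>Suc n\<close> keeps
  \<open>k\<close> at least 1.\<close>

lemma profile_limits:
  assumes t: "t > 0"
  defines "s \<equiv> zeta \<phi> t"
  shows "(\<lambda>n. u_prof (real (Suc n)) t) \<longlonglongrightarrow> s" "(\<lambda>n. w_prof (real (Suc n)) t) \<longlonglongrightarrow> b s"
    "(\<lambda>n. u_prof' (real (Suc n)) t) \<longlonglongrightarrow> 1 / \<tau>' s" "(\<lambda>n. w_prof' (real (Suc n)) t) \<longlonglongrightarrow> b' s / \<tau>' s"
proof -
  note inv = LIMSEQ_inverse_real_of_nat
  have s: "s > 0" using zeta_props(1)[OF t] by (simp add: s_def)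
  have M: "mu_zeta t > 0" by (rule mu_zeta_pos[OF t])
  have eq: "1 / (real (Suc n) * c) = inverse (real (Suc n)) * (1 / c)" for n c
    by (simp add: inverse_eq_divide)
  have "(\<lambda>n. 1 / (1 / mu_zeta t + inverse (real (Suc n)) * (1 / t) + inverse (real (Suc n)))) \<longlonglongrightarrow> 1 / (1 / mu_zeta t + 0 * (1 / t) + 0)"
    using M by (intro tendsto_intros inv) simp
  then have lm: "(\<lambda>n. damped (real (Suc n)) t) \<longlonglongrightarrow> mu_zeta t"
    unfolding damped_def eq by (simp add: inverse_eq_divide)
  have "(\<lambda>n. (damped (real (Suc n)) t)\<^sup>2 * (mu_zeta' t / (mu_zeta t)\<^sup>2 + inverse (real (Suc n)) * (1 / t\<^sup>2))) \<longlonglongrightarrow> (mu_zeta t)\<^sup>2 * (mu_zeta' t / (mu_zeta t)\<^sup>2 + 0 * (1 / t\<^sup>2))"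
    by (intro tendsto_intros inv lm)
  then have lm': "(\<lambda>n. damped' (real (Suc n)) t) \<longlonglongrightarrow> mu_zeta' t"
    unfolding damped'_def eq using M by simp
  have la: "(\<lambda>n. g (damped (real (Suc n)) t)) \<longlonglongrightarrow> g (mu_zeta t)" if "continuous_on {0<..} g" for g :: "real \<Rightarrow> real"
    by (rule continuous_on_tendsto_compose[OF that lm]) (use M damped_facts(1)[OF _ t] in \<open>auto intro!: always_eventually\<close>)
  have am: "a (mu_zeta t) = s" by (simp add: a_mu_zeta[OF t] s_def)
  have mhs: "mu_zeta t = s + b s" by (simp add: mu_zeta_def \<mu>_def s_def)
  show "(\<lambda>n. u_prof (real (Suc n)) t) \<longlonglongrightarrow> s"
    unfolding u_prof_def using la[OF a_continuous] by (simp add: am)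
  have "(\<lambda>n. w_prof (real (Suc n)) t) \<longlonglongrightarrow> mu_zeta t - a (mu_zeta t)"
    unfolding w_prof_def by (intro tendsto_intros lm la[OF a_continuous])
  then show "(\<lambda>n. w_prof (real (Suc n)) t) \<longlonglongrightarrow> b s"
    unfolding am unfolding mhs by simp
  have a'm: "a' (mu_zeta t) = 1 / (1 + b' s)" by (simp add: a'_def am)
  have mu_zeta's: "mu_zeta' t = (1 + b' s) / \<tau>' s" by (simp add: mu_zeta'_def s_def)
  have n0: "1 + b' s \<noteq> 0" using \<mu>'_pos[OF s] by simp
  have "(\<lambda>n. u_prof' (real (Suc n)) t) \<longlonglongrightarrow> a' (mu_zeta t) * mu_zeta' t"
    unfolding u_prof'_def by (intro tendsto_intros lm' la[OF a'_continuous])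
  then show "(\<lambda>n. u_prof' (real (Suc n)) t) \<longlonglongrightarrow> 1 / \<tau>' s" using n0 by (simp add: a'm mu_zeta's)
  have "(\<lambda>n. w_prof' (real (Suc n)) t) \<longlonglongrightarrow> (1 - a' (mu_zeta t)) * mu_zeta' t"
    unfolding w_prof'_def by (intro tendsto_intros lm' la[OF a'_continuous])
  moreover have "(1 - a' (mu_zeta t)) * mu_zeta' t = b' s / \<tau>' s"
  proof -
    have "1 - a' (mu_zeta t) = b' s / (1 + b' s)" using n0 by (simp add: a'm field_simps)
    then show ?thesis using n0 by (simp add: mu_zeta's)
  qed
  ultimately show "(\<lambda>n. w_prof' (real (Suc n)) t) \<longlonglongrightarrow> b' s / \<tau>' s" by simp
qed

end

section \<open>The sesquilinear form\<close>

definition sesq :: "complex^'n^'n \<Rightarrow> complex^'n \<Rightarrow> complex^'n \<Rightarrow> complex" where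
  "sesq A u w = (\<Sum>i\<in>UNIV. \<Sum>j\<in>UNIV. A $ i $ j * u $ j * cnj (w $ i))"

lemma herm_inner_eq_sesq: "herm_inner (A *v u) w = sesq A u w"
  by (simp add: herm_inner_def sesq_def matrix_vector_mult_def sum_distrib_right)

lemma sesq_add_left: "sesq A (u + v) w = sesq A u w + sesq A v w"
  by (simp add: sesq_def distrib_left distrib_right sum.distrib)

lemma sesq_add_right: "sesq A u (v + w) = sesq A u v + sesq A u w"
  by (simp add: sesq_def distrib_left distrib_right sum.distrib)

lemma sesq_scale_left: "sesq A (c *s u) w = c * sesq A u w"
  by (simp add: sesq_def sum_distrib_left algebra_simps)

lemma sesq_scale_right: "sesq A u (c *s w) = cnj c * sesq A u w"
  by (simp add: sesq_def sum_distrib_left algebra_simps)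

lemma sesq_diff_matrix: "sesq (A - B) u w = sesq A u w - sesq B u w"
  by (simp add: sesq_def left_diff_distrib sum_subtractf)

lemma sesq_adjoint: "sesq (adjoint_matrix A) u w = cnj (sesq A w u)"
proof -
  have "sesq (adjoint_matrix A) u w = (\<Sum>i\<in>UNIV. \<Sum>j\<in>UNIV. cnj (A $ j $ i) * u $ j * cnj (w $ i))"
    by (simp add: sesq_def adjoint_matrix_def map_matrix_def transpose_def)
  also have "\<dots> = (\<Sum>j\<in>UNIV. \<Sum>i\<in>UNIV. cnj (A $ j $ i) * u $ j * cnj (w $ i))" by (rule sum.swap)
  finally show ?thesis by (simp add: sesq_def algebra_simps)
qed

lemma norm_sesq_le:
  fixes A :: "complex^'n^'n"
  assumes "\<And>i j. norm (A $ i $ j) \<le> M" "M \<ge> 0"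
  shows "norm (sesq A u w) \<le> (real CARD('n))\<^sup>2 * M * (norm u * norm w)"
proof -
  have "norm (sesq A u w) \<le> (\<Sum>i\<in>UNIV. \<Sum>j\<in>UNIV. norm (A $ i $ j * u $ j * cnj (w $ i)))"
    unfolding sesq_def by (intro order_trans[OF norm_sum] sum_mono order_refl)
  also have "\<dots> \<le> (\<Sum>i\<in>(UNIV::'n set). \<Sum>j\<in>(UNIV::'n set). M * (norm u * norm w))"
  proof (intro sum_mono)
    fix i j
    have "norm (A $ i $ j) * (norm (u $ j) * norm (w $ i)) \<le> M * (norm u * norm w)"
      by (intro mult_mono assms Finite_Cartesian_Product.norm_nth_le) (auto simp: assms)
    then show "norm (A $ i $ j * u $ j * cnj (w $ i)) \<le> M * (norm u * norm w)"
      by (simp add: norm_mult mult.assoc)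
  qed
  finally show ?thesis by (simp add: power2_eq_square mult.assoc)
qed

definition re_vec :: "complex^'n \<Rightarrow> complex^'n" where "re_vec g = (\<chi> i. of_real (Re (g $ i)))"
definition im_vec :: "complex^'n \<Rightarrow> complex^'n" where "im_vec g = (\<chi> i. of_real (Im (g $ i)))"

text \<open>For \<open>g = cnj (sgn w) *s grad w\<close> the real part of \<open>g\<close> is the gradient of the modulus of \<open>w\<close> and the
  imaginary part is the modulus times the gradient of the phase. A radial function of \<open>w\<close>
  rescales the two parts independently.\<close>

definition stretch :: "real \<Rightarrow> real \<Rightarrow> complex^'n \<Rightarrow> complex^'n" where
  "stretch x y g = of_real x *s re_vec g + (\<i> * of_real y) *s im_vec g"

lemma norm_re_vec_le: "norm (re_vec g) \<le> norm g" and norm_im_vec_le: "norm (im_vec g) \<le> norm g"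
  unfolding norm_vec_def re_vec_def im_vec_def
  by (rule L2_set_mono; simp add: abs_Re_le_cmod abs_Im_le_cmod)+

text \<open>Index 1 stands for the real part of \<open>g\<close> and index 2 for the imaginary part,
  first for the left and then for the right argument. The mixed terms carry \<open>Im\<close>
  because of the factor \<open>\<i>\<close> in \<open>stretch\<close>, and opposite signs because
  the right argument is conjugated.\<close>

definition form :: "complex^'n^'n \<Rightarrow> complex^'n \<Rightarrow> real \<Rightarrow> real \<Rightarrow> real \<Rightarrow> real \<Rightarrow> real" where
  "form A g c11 c12 c21 c22 = c11 * Re (sesq A (re_vec g) (re_vec g)) + c22 * Re (sesq A (im_vec g) (im_vec g))
     + c12 * Im (sesq A (re_vec g) (im_vec g)) - c21 * Im (sesq A (im_vec g) (re_vec g))"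

lemma Re_sesq_stretch:
  "Re (sesq A (stretch x1 y1 g) (stretch x2 y2 g)) = form A g (x1 * x2) (x1 * y2) (y1 * x2) (y1 * y2)"
  by (simp add: stretch_def sesq_add_left sesq_add_right sesq_scale_left sesq_scale_right form_def algebra_simps)

lemma sesq_unit_scale:
  assumes "norm \<sigma> = 1" shows "sesq A (\<sigma> *s u) (\<sigma> *s w) = sesq A u w"
proof -
  have u: "\<sigma> * cnj \<sigma> = 1" using complex_norm_square[of \<sigma>] assms by simp
  have "sesq A (\<sigma> *s u) (\<sigma> *s w) = (\<sigma> * cnj \<sigma>) * sesq A u w"
    by (simp add: sesq_scale_left sesq_scale_right ac_simps)
  then show ?thesis by (simp add: u)
qed

text \<open>With gradient of v equal to \<open>\<sigma> *s stretch X Y g\<close>, the gradient of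
  |v| is X times the real part of \<open>g\<close>. The difference of \<open>A\<close> and its
  adjoint is skew Hermitian, so its term has no real contribution from the real part alone; on the
  mixed terms it turns the factor 1 into 1 + l and 1 - l. The squared \<open>l\<close> affects only
  the first coefficient.\<close>

lemma Re_Lambda_expression:
  assumes "norm \<sigma> = 1"
  shows "Re (sesq A (\<sigma> *s stretch X Y g) (\<sigma> *s stretch X Y g)
      + of_real l * sesq (A - adjoint_matrix A) (of_real X *s re_vec g) (cnj \<sigma> *s (\<sigma> *s stretch X Y g))
      - (of_real l)\<^sup>2 * sesq A (of_real X *s re_vec g) (of_real X *s re_vec g))
    = form A g ((1 - l\<^sup>2) * X\<^sup>2) ((1 + l) * X * Y) ((1 - l) * X * Y) (Y\<^sup>2)"
proof -
  have "cnj \<sigma> * \<sigma> = 1" using complex_norm_square[of \<sigma>] assms by (simp add: mult.commute)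
  then have u: "cnj \<sigma> *s (\<sigma> *s v) = v" for v :: "complex^'a" by (simp add: vector_smult_assoc)
  show ?thesis
    unfolding u sesq_unit_scale[OF assms]
    by (simp add: stretch_def sesq_add_left sesq_add_right sesq_scale_left sesq_scale_right
        sesq_diff_matrix sesq_adjoint form_def power2_eq_square algebra_simps)
qed

text \<open>Dividing by the phase diagonalises the chain rule: the sum of the two coefficients acts
  on the real part and their difference on the imaginary part, giving the factors f' and
  f/|z|.\<close>

lemma rlin_radial:
  assumes "z \<noteq> 0"
  shows "rlin (radial_p f f' z) (radial_q f f' z) G =
    sgn z *s stretch (f' (cmod z)) (f (cmod z) / cmod z) (cnj (sgn z) *s G)"
proof -
  define \<sigma> where "\<sigma> = sgn z"
  have u: "\<sigma> * cnj \<sigma> = 1"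
    using complex_norm_square[of \<sigma>] assms by (simp add: \<sigma>_def norm_sgn)
  have s: "z / of_real (cmod z) = \<sigma>" by (simp add: \<sigma>_def sgn_eq)
  have "of_real ((x + y) / 2) * G $ i + of_real ((x - y) / 2) * \<sigma>\<^sup>2 * cnj (G $ i) =
     \<sigma> * (of_real x * of_real (Re (cnj \<sigma> * G $ i)) + \<i> * of_real y * of_real (Im (cnj \<sigma> * G $ i)))"
    for i and x y :: real
  proof -
    have r: "of_real (Re w) = (w + cnj w) / 2" "\<i> * of_real (Im w) = (w - cnj w) / 2" for w
      by (simp_all add: complex_eq_iff)
    have "\<sigma> * (of_real x * of_real (Re (cnj \<sigma> * G $ i)) + of_real y * (\<i> * of_real (Im (cnj \<sigma> * G $ i)))) =
      of_real x * ((\<sigma> * cnj \<sigma>) * G $ i + \<sigma>\<^sup>2 * cnj (G $ i)) / 2 + of_real y * ((\<sigma> * cnj \<sigma>) * G $ i - \<sigma>\<^sup>2 * cnj (G $ i)) / 2"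
      unfolding r by (simp add: field_simps power2_eq_square)
    also have "\<dots> = of_real ((x + y) / 2) * G $ i + of_real ((x - y) / 2) * \<sigma>\<^sup>2 * cnj (G $ i)"
      unfolding u by (simp add: field_simps)
    finally show ?thesis by (simp add: mult.left_commute mult.assoc)
  qed
  then have vec: "rlin (of_real ((x + y) / 2)) (of_real ((x - y) / 2) * \<sigma>\<^sup>2) G = \<sigma> *s stretch x y (cnj \<sigma> *s G)" for x y :: real
    by (simp add: rlin_def stretch_def re_vec_def im_vec_def vec_eq_iff distrib_left mult.assoc)
  show ?thesis
    unfolding radial_p_def radial_q_def s \<sigma>_def[symmetric] by (simp only: assms if_False vec)
qed

text \<open>The coefficients are those of the modulus: they undo the phase and average with the
  conjugate, which extracts the real part.\<close>

lemma rlin_cmod_stretch: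
  assumes "norm \<sigma> = 1"
  shows "rlin (cnj \<sigma> / 2) (\<sigma> / 2) (\<sigma> *s stretch X Y g) = of_real X *s re_vec g"
proof -
  have u: "cnj \<sigma> * \<sigma> = 1" using complex_norm_square[of \<sigma>] assms by (simp add: mult.commute)
  have "cnj \<sigma> / 2 * (\<sigma> * w) + \<sigma> / 2 * cnj (\<sigma> * w) = (cnj \<sigma> * \<sigma>) * ((w + cnj w) / 2)" for w
    by (simp add: field_simps)
  also have "\<dots> w = of_real (Re w)" for w unfolding u by (simp add: complex_eq_iff)
  finally have *: "cnj \<sigma> / 2 * (\<sigma> * w) + \<sigma> / 2 * cnj (\<sigma> * w) = of_real (Re w)" for w .
  have "Re (stretch X Y g $ i) = X * Re (g $ i)" for i
    by (simp add: stretch_def re_vec_def im_vec_def)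
  then show ?thesis using * by (simp add: rlin_def vec_eq_iff re_vec_def)
qed

lemma stretch_1: "stretch 1 1 g = g"
  by (simp add: stretch_def re_vec_def im_vec_def vec_eq_iff complex_eq_iff)

lemma unit_scale_cancel: "norm \<sigma> = 1 \<Longrightarrow> \<sigma> *s (cnj \<sigma> *s g) = g"
  using complex_norm_square[of \<sigma>] by (simp add: vector_smult_assoc)

lemma norm_unit_scale: "norm \<sigma> = 1 \<Longrightarrow> norm (\<sigma> *s g) = norm (g :: complex^'n)"
  by (simp add: norm_vec_def norm_mult)

section \<open>Measurability and integrability of the form\<close>

lemma borel_measurable_component:
  fixes g :: "'a \<Rightarrow> complex^'n"
  assumes "g \<in> borel_measurable M" shows "(\<lambda>x. g x $ i) \<in> borel_measurable M"
  by (rule measurable_compose[OF assms]) (intro borel_measurable_continuous_onI continuous_intros)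

lemma Linfty_matrix_bound:
  fixes A :: "real^'n \<Rightarrow> complex^'n^'n"
  assumes "\<And>i j. (\<lambda>x. A x $ i $ j) \<in> Linfty \<Omega>"
  obtains M where "M \<ge> 0" "AE x in lebesgue_on \<Omega>. \<forall>i j. norm (A x $ i $ j) \<le> M"
proof -
  have "\<exists>C. AE x in lebesgue_on \<Omega>. norm (A x $ i $ j) \<le> C" for i j
    using assms[of i j] by (simp add: Linfty_def)
  then obtain C where C: "\<And>i j. AE x in lebesgue_on \<Omega>. norm (A x $ i $ j) \<le> C i j" by metis
  define M where "M = (\<Sum>i\<in>UNIV. \<Sum>j\<in>UNIV. \<bar>C i j\<bar>)"
  have le: "C i j \<le> M" for i j
  proof -
    have "C i j \<le> \<bar>C i j\<bar>" by simp
    also have "\<dots> \<le> (\<Sum>j\<in>UNIV. \<bar>C i j\<bar>)" by (rule member_le_sum) auto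
    also have "\<dots> \<le> M" unfolding M_def
      by (rule member_le_sum[of i UNIV "\<lambda>i. \<Sum>j\<in>UNIV. \<bar>C i j\<bar>"]) (auto intro: sum_nonneg)
    finally show ?thesis .
  qed
  have "AE x in lebesgue_on \<Omega>. \<forall>i j. norm (A x $ i $ j) \<le> C i j"
    using C by (simp add: AE_all_countable)
  then have "AE x in lebesgue_on \<Omega>. \<forall>i j. norm (A x $ i $ j) \<le> M"
    by eventually_elim (meson le order_trans)
  moreover have "M \<ge> 0" by (simp add: M_def sum_nonneg)
  ultimately show ?thesis using that by blast
qed

lemma sesq_measurable:
  assumes "\<And>i j. (\<lambda>x. A x $ i $ j) \<in> borel_measurable M" "g \<in> borel_measurable M" "h \<in> borel_measurable M"
  shows "(\<lambda>x. sesq (A x) (g x) (h x)) \<in> borel_measurable M"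
proof -
  have cm: "cnj \<in> borel_measurable borel" by (intro borel_measurable_continuous_onI continuous_intros)
  show ?thesis unfolding sesq_def
    by (intro borel_measurable_sum borel_measurable_times assms borel_measurable_component
        measurable_compose[OF borel_measurable_component[OF assms(3)] cm])
qed

lemma sesq_integrable:
  fixes A :: "real^'n \<Rightarrow> complex^'n^'n"
  assumes A: "\<And>i j. (\<lambda>x. A x $ i $ j) \<in> Linfty \<Omega>" and g: "g \<in> L2 \<Omega>" and h: "h \<in> L2 \<Omega>"
    and c: "c \<in> borel_measurable (lebesgue_on \<Omega>)" "\<And>x. norm (c x) \<le> 1"
  shows "integrable (lebesgue_on \<Omega>) (\<lambda>x. c x * sesq (A x) (g x) (h x))"
proof -
  obtain M where M: "M \<ge> 0" "AE x in lebesgue_on \<Omega>. \<forall>i j. norm (A x $ i $ j) \<le> M"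
    by (rule Linfty_matrix_bound[OF A])
  show ?thesis
  proof (rule integrable_L2_prod[OF g h])
    show "(\<lambda>x. c x * sesq (A x) (g x) (h x)) \<in> borel_measurable (lebesgue_on \<Omega>)"
      using A by (intro borel_measurable_times c(1) sesq_measurable L2_measurable[OF g] L2_measurable[OF h]) (simp add: Linfty_def)
    show "AE x in lebesgue_on \<Omega>. norm (c x * sesq (A x) (g x) (h x)) \<le> ((real CARD('n))\<^sup>2 * M) * (norm (g x) * norm (h x))"
      using M(2)
    proof eventually_elim
      case (elim x)
      have "norm (c x * sesq (A x) (g x) (h x)) \<le> 1 * norm (sesq (A x) (g x) (h x))"
        unfolding norm_mult by (intro mult_right_mono c) auto
      also have "\<dots> \<le> ((real CARD('n))\<^sup>2 * M) * (norm (g x) * norm (h x))"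
        using norm_sesq_le[of "A x" M] elim M(1) by simp
      finally show ?case .
    qed
  qed
qed

lemma adjoint_diff_Linfty:
  fixes A :: "real^'n \<Rightarrow> complex^'n^'n"
  assumes A: "\<And>i j. (\<lambda>x. A x $ i $ j) \<in> Linfty \<Omega>"
  shows "(\<lambda>x. (A x - adjoint_matrix (A x)) $ i $ j) \<in> Linfty \<Omega>"
proof -
  have e: "(A x - adjoint_matrix (A x)) $ i $ j = A x $ i $ j - cnj (A x $ j $ i)" for x
    by (simp add: adjoint_matrix_def map_matrix_def transpose_def)
  obtain M where M: "M \<ge> 0" "AE x in lebesgue_on \<Omega>. \<forall>i j. norm (A x $ i $ j) \<le> M"
    by (rule Linfty_matrix_bound[OF A])
  have m: "(\<lambda>x. A x $ i $ j) \<in> borel_measurable (lebesgue_on \<Omega>)" for i j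
    using A by (simp add: Linfty_def)
  have cm: "cnj \<in> borel_measurable borel" by (intro borel_measurable_continuous_onI continuous_intros)
  have "AE x in lebesgue_on \<Omega>. norm (A x $ i $ j - cnj (A x $ j $ i)) \<le> M + M"
    using M(2) by eventually_elim (intro order_trans[OF norm_triangle_ineq4] add_mono, auto)
  moreover have "(\<lambda>x. A x $ i $ j - cnj (A x $ j $ i)) \<in> borel_measurable (lebesgue_on \<Omega>)"
    by (intro borel_measurable_diff m measurable_compose[OF m cm])
  ultimately show ?thesis unfolding e Linfty_def by blast
qed

lemma sgn_measurable:
  fixes v :: "'a \<Rightarrow> complex"
  assumes "v \<in> borel_measurable M" shows "(\<lambda>x. sgn (v x)) \<in> borel_measurable M"
proof -
  have "(\<lambda>z. if z = 0 then 0 else sgn z) \<in> borel_measurable (borel :: complex measure)"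
    by (rule borel_measurable_if_zero) (intro continuous_intros continuous_on_sgn, auto)
  also have "(\<lambda>z::complex. if z = 0 then 0 else sgn z) = sgn" by (auto simp: fun_eq_iff)
  finally show ?thesis by (rule measurable_compose[OF assms])
qed

text \<open>Transfers the chain rule from jets to \<open>H10\<close> and \<open>weak_grad\<close>.
  Because \<open>sgn 0 = 0\<close>, the value of \<open>f\<close> at zero does not matter, and
  control on the positive half-line is enough.\<close>

lemma radial_gradient:
  fixes w :: "real^'n \<Rightarrow> complex"
  assumes \<Omega>: "open \<Omega>" and U: "H10_jet \<Omega> (\<lambda>x. (w x, G x))"
    and f: "\<And>t. t > 0 \<Longrightarrow> (f has_real_derivative f' t) (at t)"
    and cont: "continuous_on {0<..} f'"
    and bound: "\<And>t. t > 0 \<Longrightarrow> \<bar>f t\<bar> \<le> L * t" "\<And>t. t > 0 \<Longrightarrow> \<bar>f' t\<bar> \<le> L"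
    and v: "\<And>x. v x = of_real (f (cmod (w x))) * sgn (w x)"
  shows "v \<in> H10 \<Omega>"
    and "AE x in lebesgue_on \<Omega>. (w x \<noteq> 0 \<longrightarrow> weak_grad \<Omega> v x =
        sgn (w x) *s stretch (f' (cmod (w x))) (f (cmod (w x)) / cmod (w x)) (cnj (sgn (w x)) *s G x))
      \<and> (w x = 0 \<longrightarrow> weak_grad \<Omega> v x = 0)"
proof -
  have k: "radial_k f z * z = of_real (f (cmod z)) * sgn z" for z
    by (simp add: radial_k_def sgn_eq)
  have "H10_jet \<Omega> (\<lambda>x. (v x, rlin (radial_p f f' (w x)) (radial_q f f' (w x)) (G x)))"
    using H10_jet_radial_Lipschitz[OF \<Omega> U f cont bound] by (simp add: mlt_def k v)
  note D = H10_jetD[OF \<Omega> this]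
  show "v \<in> H10 \<Omega>" by (rule D(1))
  have z: "rlin (radial_p f f' 0) (radial_q f f' 0) g = 0" for g :: "complex^'n"
    by (simp add: rlin_def radial_p_def radial_q_def vec_eq_iff)
  show "AE x in lebesgue_on \<Omega>. (w x \<noteq> 0 \<longrightarrow> weak_grad \<Omega> v x =
        sgn (w x) *s stretch (f' (cmod (w x))) (f (cmod (w x)) / cmod (w x)) (cnj (sgn (w x)) *s G x))
      \<and> (w x = 0 \<longrightarrow> weak_grad \<Omega> v x = 0)"
    using D(2) by eventually_elim (auto simp: rlin_radial z)
qed

section \<open>Both implications\<close>

lemma borel_measurable_rlin:
  fixes g :: "'a \<Rightarrow> complex^'n"
  assumes "p \<in> borel_measurable M" "q \<in> borel_measurable M" "g \<in> borel_measurable M"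
  shows "(\<lambda>x. rlin (p x) (q x) (g x)) \<in> borel_measurable M"
proof -
  have "(\<lambda>x. mlt 0 (p x) (q x) (0, g x)) \<in> borel_measurable M"
    using assms by (intro borel_measurable_mlt borel_measurable_Pair borel_measurable_const)
  moreover have "(snd :: complex \<times> (complex^'n) \<Rightarrow> complex^'n) \<in> borel_measurable borel"
    by (intro borel_measurable_continuous_onI continuous_intros)
  ultimately show ?thesis using measurable_compose[of _ M borel snd borel] by (fastforce simp: mlt_def)
qed

lemma cnj_measurable:
  "f \<in> borel_measurable M \<Longrightarrow> (\<lambda>x. cnj (f x)) \<in> borel_measurable M"
  by (rule measurable_compose[where N = borel]) (assumption, intro borel_measurable_continuous_onI continuous_intros)

context phi_function
begin

text \<open>Replaces the chosen gradient of |v| by an explicit expression in that of v, and removes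
  the case distinction: on the zero set of v the gradient vanishes almost everywhere, so the formula
  gives zero there as well.\<close>

lemma Lambda_integrand_eq:
  fixes v :: "real^'n \<Rightarrow> complex"
  assumes \<Omega>: "open \<Omega>" and v: "v \<in> H10 \<Omega>"
  defines "\<sigma> \<equiv> \<lambda>x. sgn (v x)"
  defines "gm \<equiv> \<lambda>x. rlin (cnj (\<sigma> x) / 2) (\<sigma> x / 2) (weak_grad \<Omega> v x)"
  defines "l \<equiv> \<lambda>x. complex_of_real (Lambda \<phi> (cmod (v x)))"
  shows "AE x in lebesgue_on \<Omega>. Lambda_integrand \<Omega> A \<phi> v x =
      1 * sesq (A x) (weak_grad \<Omega> v x) (weak_grad \<Omega> v x)
      + l x * sesq (A x - adjoint_matrix (A x)) (gm x) (cnj (\<sigma> x) *s weak_grad \<Omega> v x)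
      - (l x)\<^sup>2 * sesq (A x) (gm x) (gm x)"
    and "gm \<in> L2 \<Omega>"
proof -
  note U = H10_jetI[OF \<Omega> v]
  have c: "cnj (sgn z) * z = of_real (cmod z)" for z
    using complex_norm_square[of z] by (cases "z = 0") (auto simp: sgn_eq power2_eq_square field_simps)
  have J: "H10_jet \<Omega> (\<lambda>x. (of_real (cmod (v x)), gm x))"
    using H10_jet_cmod[OF \<Omega> U] by (simp add: mlt_def c gm_def \<sigma>_def)
  from H10_jet_L2[OF this] show "gm \<in> L2 \<Omega>" by (simp add: L2_Pair_iff)
  show "AE x in lebesgue_on \<Omega>. Lambda_integrand \<Omega> A \<phi> v x =
      1 * sesq (A x) (weak_grad \<Omega> v x) (weak_grad \<Omega> v x)
      + l x * sesq (A x - adjoint_matrix (A x)) (gm x) (cnj (\<sigma> x) *s weak_grad \<Omega> v x)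
      - (l x)\<^sup>2 * sesq (A x) (gm x) (gm x)"
    using H10_jetD(2)[OF \<Omega> J] gradient_vanishes_on_zero_set[OF \<Omega> U]
  proof eventually_elim
    case (elim x)
    show ?case
    proof (cases "v x = 0")
      case True
      then have "weak_grad \<Omega> v x = 0" using elim(2) by (simp add: zero_prod_def)
      with True show ?thesis
        by (simp add: Lambda_integrand_def sesq_def gm_def rlin_def)
    next
      case False
      have "cnj (v x) / of_real (cmod (v x)) = cnj (\<sigma> x)" by (simp add: \<sigma>_def sgn_eq)
      with False elim(1) show ?thesis
        by (simp add: Lambda_integrand_def Let_def herm_inner_eq_sesq l_def)
    qed
  qed
qed

text \<open>Required for taking the real part under the integral, which otherwise would have its
  default value. \<open>Lambda\<close> and the phase have modulus at most 1, and all gradients are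
  square integrable.\<close>

lemma Lambda_integrand_integrable:
  fixes v :: "real^'n \<Rightarrow> complex"
  assumes \<Omega>: "open \<Omega>" and A: "\<And>i j. (\<lambda>x. A x $ i $ j) \<in> Linfty \<Omega>" and v: "v \<in> H10 \<Omega>"
  shows "integrable (lebesgue_on \<Omega>) (Lambda_integrand \<Omega> A \<phi> v)"
proof -
  define \<sigma> where "\<sigma> = (\<lambda>x. sgn (v x))"
  define gm where "gm = (\<lambda>x. rlin (cnj (\<sigma> x) / 2) (\<sigma> x / 2) (weak_grad \<Omega> v x))"
  define l where "l = (\<lambda>x. complex_of_real (Lambda \<phi> (cmod (v x))))"
  let ?E = "\<lambda>x. 1 * sesq (A x) (weak_grad \<Omega> v x) (weak_grad \<Omega> v x)
      + l x * sesq (A x - adjoint_matrix (A x)) (gm x) (cnj (\<sigma> x) *s weak_grad \<Omega> v x)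
      - (l x)\<^sup>2 * sesq (A x) (gm x) (gm x)"
  have ae: "AE x in lebesgue_on \<Omega>. Lambda_integrand \<Omega> A \<phi> v x = ?E x"
    using Lambda_integrand_eq(1)[OF \<Omega> v, of A] by (simp only: \<sigma>_def gm_def l_def)
  have gm: "gm \<in> L2 \<Omega>" using Lambda_integrand_eq(2)[OF \<Omega> v] by (simp only: \<sigma>_def gm_def)
  have vL: "v \<in> L2 \<Omega>" and gL: "weak_grad \<Omega> v \<in> L2 \<Omega>"
    using H10_jet_L2[OF H10_jetI[OF \<Omega> v]] by (auto simp: L2_Pair_iff)
  have \<sigma>m: "\<sigma> \<in> borel_measurable (lebesgue_on \<Omega>)"
    unfolding \<sigma>_def by (rule sgn_measurable[OF L2_measurable[OF vL]])
  have sg: "(\<lambda>x. cnj (\<sigma> x) *s weak_grad \<Omega> v x) \<in> L2 \<Omega>"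
  proof (rule L2_bound[OF gL, of _ 1])
    have eq: "c *s g = rlin c 0 g" for c and g :: "complex^'n" by (simp add: rlin_def vec_eq_iff)
    show "(\<lambda>x. cnj (\<sigma> x) *s weak_grad \<Omega> v x) \<in> borel_measurable (lebesgue_on \<Omega>)"
      unfolding eq by (intro borel_measurable_rlin cnj_measurable \<sigma>m borel_measurable_const L2_measurable[OF gL])
    have "norm (cnj (\<sigma> x) *s g) \<le> 1 * norm g" for x and g :: "complex^'n"
      unfolding eq by (rule order_trans[OF norm_rlin_le mult_right_mono]) (auto simp: \<sigma>_def norm_sgn)
    then show "AE x in lebesgue_on \<Omega>. norm (cnj (\<sigma> x) *s weak_grad \<Omega> v x) \<le> 1 * norm (weak_grad \<Omega> v x)"
      by (intro AE_I2)
  qed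
  have lm: "l \<in> borel_measurable (lebesgue_on \<Omega>)"
  proof -
    have "(\<lambda>z. if z = 0 then 0 else complex_of_real (Lambda \<phi> (cmod z))) \<in> borel_measurable borel"
      by (rule borel_measurable_if_zero)
        (intro continuous_intros continuous_on_compose2[OF Lambda_continuous], auto)
    \<comment> \<open>The factor \<open>t\<close> in its definition makes
      \<open>Lambda \<phi> 0\<close> equal to 0, so excluding the origin changes nothing.\<close>
    also have "(\<lambda>z. if z = 0 then 0 else complex_of_real (Lambda \<phi> (cmod z))) = (\<lambda>z. complex_of_real (Lambda \<phi> (cmod z)))"
      by (auto simp: fun_eq_iff Lambda_def)
    finally show ?thesis unfolding l_def by (rule measurable_compose[OF L2_measurable[OF vL]])
  qed
  have lb: "norm (l x) \<le> 1" for x using abs_Lambda_le by (simp add: l_def)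
  have E: "integrable (lebesgue_on \<Omega>) ?E"
  proof (intro Bochner_Integration.integrable_diff Bochner_Integration.integrable_add)
    show "integrable (lebesgue_on \<Omega>) (\<lambda>x. 1 * sesq (A x) (weak_grad \<Omega> v x) (weak_grad \<Omega> v x))"
      by (rule sesq_integrable[OF A gL gL]) auto
    show "integrable (lebesgue_on \<Omega>) (\<lambda>x. l x * sesq (A x - adjoint_matrix (A x)) (gm x) (cnj (\<sigma> x) *s weak_grad \<Omega> v x))"
      by (rule sesq_integrable[OF adjoint_diff_Linfty[OF A] gm sg lm lb])
    show "integrable (lebesgue_on \<Omega>) (\<lambda>x. (l x)\<^sup>2 * sesq (A x) (gm x) (gm x))"
      by (rule sesq_integrable[OF A gm gm]) (use lm lb in \<open>auto simp: norm_power power_le_one\<close>)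
  qed
  have "Lambda_integrand \<Omega> A \<phi> v \<in> borel_measurable (lebesgue_on \<Omega>)"
    using \<Omega> by (intro borel_measurable_lebesgue_on_AE_cong[OF _ borel_measurable_integrable[OF E] ae]) auto
  from integrable_cong_AE_imp[OF E this] ae show ?thesis by (simp add: eq_commute)
qed

text \<open>\<open>X\<close>, \<open>Y\<close> and \<open>g\<close> are quantified inside the almost
  everywhere statement because they depend on the point. One implication takes them from the
  representation of v through w, the other with \<open>X = Y = 1\<close>.\<close>

lemma Re_Lambda_integrand:
  fixes v :: "real^'n \<Rightarrow> complex"
  assumes \<Omega>: "open \<Omega>" and v: "v \<in> H10 \<Omega>"
  shows "AE x in lebesgue_on \<Omega>. \<forall>X Y g. v x \<noteq> 0 \<longrightarrow> weak_grad \<Omega> v x = sgn (v x) *s stretch X Y g \<longrightarrow>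
    Re (Lambda_integrand \<Omega> A \<phi> v x) = form (A x) g ((1 - (Lambda \<phi> (cmod (v x)))\<^sup>2) * X\<^sup>2)
      ((1 + Lambda \<phi> (cmod (v x))) * X * Y) ((1 - Lambda \<phi> (cmod (v x))) * X * Y) (Y\<^sup>2)"
  using Lambda_integrand_eq(1)[OF \<Omega> v, of A]
proof eventually_elim
  case (elim x)
  show ?case
  proof (intro allI impI)
    fix X Y and g :: "complex^'n"
    assume nz: "v x \<noteq> 0" and g: "weak_grad \<Omega> v x = sgn (v x) *s stretch X Y g"
    have n: "norm (sgn (v x)) = 1" using nz by (simp add: norm_sgn)
    show "Re (Lambda_integrand \<Omega> A \<phi> v x) = form (A x) g ((1 - (Lambda \<phi> (cmod (v x)))\<^sup>2) * X\<^sup>2)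
      ((1 + Lambda \<phi> (cmod (v x))) * X * Y) ((1 - Lambda \<phi> (cmod (v x))) * X * Y) (Y\<^sup>2)"
      unfolding elim g rlin_cmod_stretch[OF n] Re_Lambda_expression[OF n, symmetric] by simp
  qed
qed

lemma radial_phi_mult:
  assumes "f > 0" "norm \<sigma> = 1"
  shows "of_real (\<phi> (cmod (of_real f * \<sigma>))) * (of_real f * \<sigma>) = of_real (b f) * \<sigma>"
  using assms by (simp add: norm_mult b_def mult_ac)

proposition Lambda_condition_imp_dissipative:
  fixes \<Omega> :: "(real^'n) set"
  assumes \<Omega>: "open \<Omega>" and A: "\<And>i j. (\<lambda>x. A x $ i $ j) \<in> Linfty \<Omega>"
    and cond: "\<And>v. v \<in> H10 \<Omega> \<Longrightarrow> Re (LINT x|lebesgue_on \<Omega>. Lambda_integrand \<Omega> A \<phi> v x) \<ge> 0"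
  shows "L_Phi_dissipative \<Omega> A \<phi>"
  unfolding L_Phi_dissipative_def
proof (intro ballI impI)
  fix u assume u: "u \<in> H10 \<Omega>" and pu: "phi_mult \<phi> u \<in> H10 \<Omega>"
  define w where "w x = u x + phi_mult \<phi> u x" for x
  define G where "G x = weak_grad \<Omega> u x + weak_grad \<Omega> (phi_mult \<phi> u) x" for x
  have W: "H10_jet \<Omega> (\<lambda>x. (w x, G x))"
    using H10_jet_add[OF \<Omega> H10_jetI[OF \<Omega> u] H10_jetI[OF \<Omega> pu]] by (simp add: w_def G_def)
  define v where "v x = of_real (\<tau> (a (cmod (w x)))) * sgn (w x)" for x
  \<comment> \<open>Where \<open>u\<close> is nonzero, \<open>w\<close> is a positive multiple of
    it: the phase is the same and the moduli are related by \<open>\<mu>\<close>.\<close>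
  have wu: "cmod (w x) > 0 \<and> a (cmod (w x)) = cmod (u x) \<and> sgn (w x) = sgn (u x)" if "u x \<noteq> 0" for x
  proof -
    have up: "cmod (u x) > 0" using that by simp
    note ph = phi_pos[OF up]
    have wx: "w x = of_real (1 + \<phi> (cmod (u x))) * u x"
      using that by (simp add: w_def phi_mult_def distrib_right)
    have "cmod (w x) = \<bar>1 + \<phi> (cmod (u x))\<bar> * cmod (u x)"
      unfolding wx norm_mult norm_of_real ..
    then have cw: "cmod (w x) = \<mu> (cmod (u x))"
      using ph by (simp add: \<mu>_def b_def algebra_simps)
    have "sgn (w x) = sgn (complex_of_real (1 + \<phi> (cmod (u x)))) * sgn (u x)" unfolding wx by (rule sgn_mult)
    also have "sgn (complex_of_real (1 + \<phi> (cmod (u x)))) = 1"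
      unfolding sgn_of_real using ph by simp
    finally have "sgn (w x) = sgn (u x)" by simp
    moreover have "cmod (w x) > 0" unfolding cw \<mu>_def by (intro add_pos_pos up b_pos[OF up])
    ultimately show ?thesis by (simp add: cw a_props(4)[OF up])
  qed
  have w0: "w x = 0" if "u x = 0" for x using that by (simp add: w_def phi_mult_def)
  have u_eq: "u x = of_real (a (cmod (w x))) * sgn (w x)" for x
    using wu[of x] w0[of x] by (cases "u x = 0") (auto simp: sgn_eq)
  have pu_eq: "phi_mult \<phi> u x = of_real (cmod (w x) - a (cmod (w x))) * sgn (w x)" for x
  proof -
    have sgn: "of_real (cmod (w x)) * sgn (w x) = w x" by (cases "w x = 0") (auto simp: sgn_eq)
    have "phi_mult \<phi> u x = w x - u x" by (simp add: w_def)
    also have "\<dots> = of_real (cmod (w x)) * sgn (w x) - of_real (a (cmod (w x))) * sgn (w x)"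
      unfolding sgn u_eq[of x, symmetric] ..
    finally show ?thesis by (simp only: left_diff_distrib of_real_diff)
  qed
  have C1: "key_const \<ge> 1" by (rule key_const_ge_1)
  have au: "AE x in lebesgue_on \<Omega>. (w x \<noteq> 0 \<longrightarrow> weak_grad \<Omega> u x =
        sgn (w x) *s stretch (a' (cmod (w x))) (a (cmod (w x)) / cmod (w x)) (cnj (sgn (w x)) *s G x))
      \<and> (w x = 0 \<longrightarrow> weak_grad \<Omega> u x = 0)"
  proof (rule radial_gradient(2)[OF \<Omega> W a_DERIV a'_continuous _ _ u_eq])
    show "\<bar>a t\<bar> \<le> 1 * t" if "0 < t" for t using a_less[OF that] a_props(1)[OF that] by simp
    show "\<bar>a' t\<bar> \<le> 1" if "0 < t" for t using a'_bounds[OF that] by simp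
  qed
  have ap: "AE x in lebesgue_on \<Omega>. (w x \<noteq> 0 \<longrightarrow> weak_grad \<Omega> (phi_mult \<phi> u) x =
        sgn (w x) *s stretch (1 - a' (cmod (w x))) ((cmod (w x) - a (cmod (w x))) / cmod (w x)) (cnj (sgn (w x)) *s G x))
      \<and> (w x = 0 \<longrightarrow> weak_grad \<Omega> (phi_mult \<phi> u) x = 0)"
  proof (rule radial_gradient(2)[OF \<Omega> W _ _ _ _ pu_eq])
    show "((\<lambda>m. m - a m) has_real_derivative 1 - a' t) (at t)" if "0 < t" for t
      by (rule DERIV_diff[OF DERIV_ident a_DERIV[OF that]])
    show "continuous_on {0<..} (\<lambda>m. 1 - a' m)" by (intro continuous_intros a'_continuous)
    show "\<bar>t - a t\<bar> \<le> 1 * t" if "0 < t" for t using a_less[OF that] a_props(1)[OF that] by simp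
    show "\<bar>1 - a' t\<bar> \<le> 1" if "0 < t" for t using a'_bounds[OF that] by simp
  qed
  let ?T' = "\<lambda>m. \<tau>' (a m) * a' m"
  have T: "((\<lambda>m. \<tau> (a m)) has_real_derivative ?T' t) (at t)" if "0 < t" for t
    by (rule DERIV_chain2[OF \<tau>_DERIV[OF a_props(1)[OF that]] a_DERIV[OF that]])
  have Tc: "continuous_on {0<..} ?T'"
    by (intro continuous_intros a'_continuous continuous_on_compose2[OF \<tau>'_continuous a_continuous]) (use a_props(1) in auto)
  have Tb: "\<bar>\<tau> (a t)\<bar> \<le> key_const * t" "\<bar>?T' t\<bar> \<le> key_const" if t: "0 < t" for t
  proof -
    have "\<tau> (a t) \<le> 1 * t" using a'_weighted_bounds(4)[OF t] by simp
    also have "\<dots> \<le> key_const * t" using C1 t by (intro mult_right_mono) auto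
    finally show "\<bar>\<tau> (a t)\<bar> \<le> key_const * t" using \<tau>_pos[OF a_props(1)[OF t]] by simp
    have "?T' t > 0" using \<tau>'_pos[OF a_props(1)[OF t]] a'_bounds[OF t] by simp
    then show "\<bar>?T' t\<bar> \<le> key_const" using a'_weighted_bounds(3)[OF t] by simp
  qed
  have v: "v \<in> H10 \<Omega>" by (rule radial_gradient(1)[OF \<Omega> W T Tc Tb v_def])
  have av: "AE x in lebesgue_on \<Omega>. (w x \<noteq> 0 \<longrightarrow> weak_grad \<Omega> v x =
        sgn (w x) *s stretch (?T' (cmod (w x))) (\<tau> (a (cmod (w x))) / cmod (w x)) (cnj (sgn (w x)) *s G x))
      \<and> (w x = 0 \<longrightarrow> weak_grad \<Omega> v x = 0)"
    by (rule radial_gradient(2)[OF \<Omega> W T Tc Tb v_def])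
  let ?F = "\<lambda>x. herm_inner (A x *v weak_grad \<Omega> u x) (weak_grad \<Omega> (phi_mult \<phi> u) x)"
  have L: "weak_grad \<Omega> u \<in> L2 \<Omega>" "weak_grad \<Omega> (phi_mult \<phi> u) \<in> L2 \<Omega>"
    using H10_jet_L2[OF H10_jetI[OF \<Omega> u]] H10_jet_L2[OF H10_jetI[OF \<Omega> pu]] by (auto simp: L2_Pair_iff)
  have Fi: "integrable (lebesgue_on \<Omega>) ?F"
    using sesq_integrable[OF A L, of "\<lambda>_. 1"] by (simp add: herm_inner_eq_sesq)
  note Li = Lambda_integrand_integrable[OF \<Omega> A v]
  have "AE x in lebesgue_on \<Omega>. Re (?F x) = Re (Lambda_integrand \<Omega> A \<phi> v x)"
    using au ap av Re_Lambda_integrand[OF \<Omega> v, of A]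
  proof eventually_elim
    case (elim x)
    show ?case
    proof (cases "w x = 0")
      case True
      then have "v x = 0" by (simp add: v_def)
      with True elim(1) show ?thesis by (simp add: Lambda_integrand_def herm_inner_def)
    next
      case False
      define m where "m = cmod (w x)"
      define s where "s = a m"
      define g where "g = cnj (sgn (w x)) *s G x"
      have m: "m > 0" using False by (simp add: m_def)
      have s: "s > 0" unfolding s_def by (rule a_props(1)[OF m])
      have n: "norm (sgn (w x)) = 1" using False by (simp add: norm_sgn)
      have bs: "m - s = b s" by (simp add: s_def b_a[OF m])
      have a'c: "1 - a' m = b' s * a' m" unfolding s_def by (rule a'_compl[OF m])
      have vx: "v x = of_real (\<tau> s) * sgn (w x)" by (simp add: v_def s_def m_def)
      have cv: "cmod (v x) = \<tau> s" using \<tau>_pos[OF s] by (simp add: vx norm_mult n)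
      have sv: "sgn (v x) = sgn (w x)"
      proof -
        have "sgn (v x) = sgn (complex_of_real (\<tau> s)) * sgn (sgn (w x))" unfolding vx by (rule sgn_mult)
        also have "sgn (complex_of_real (\<tau> s)) = 1" using \<tau>_pos[OF s] by (simp add: sgn_of_real)
        finally show ?thesis by (simp add: sgn_sgn)
      qed
      have vnz: "v x \<noteq> 0" using cv \<tau>_pos[OF s] by auto
      have gu: "weak_grad \<Omega> u x = sgn (w x) *s stretch (a' m) (s / m) g"
        and gp: "weak_grad \<Omega> (phi_mult \<phi> u) x = sgn (w x) *s stretch (b' s * a' m) (b s / m) g"
        and gv: "weak_grad \<Omega> v x = sgn (v x) *s stretch (\<tau>' s * a' m) (\<tau> s / m) g"
        using elim(1-3) False
        unfolding m_def[symmetric] s_def[symmetric] g_def[symmetric] bs a'c sv by blast+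
      \<comment> \<open>Relative to \<open>w\<close>, the radial factors of u, its multiple and v
        are 1, \<open>b'\<close> and \<open>\<tau>'\<close> times the common \<open>a' m\<close>,
        and the angular factors are s, \<open>b\<close> and \<open>\<tau>\<close> over the common m.
        Pairwise products therefore reduce to \<open>Lambda_identities\<close>.\<close>
      let ?l = "Lambda \<phi> (\<tau> s)"
      note I = Lambda_identities[OF s]
      have "Re (?F x) = form (A x) g (a' m * (b' s * a' m)) (a' m * (b s / m)) (s / m * (b' s * a' m)) (s / m * (b s / m))"
        unfolding herm_inner_eq_sesq gu gp sesq_unit_scale[OF n] Re_sesq_stretch ..
      also have "a' m * (b' s * a' m) = (1 - ?l\<^sup>2) * (\<tau>' s * a' m)\<^sup>2"
        unfolding I(1) by (simp add: power_mult_distrib power2_eq_square)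
      also have "a' m * (b s / m) = (1 + ?l) * (\<tau>' s * a' m) * (\<tau> s / m)"
        unfolding I(2) by simp
      also have "s / m * (b' s * a' m) = (1 - ?l) * (\<tau>' s * a' m) * (\<tau> s / m)"
      proof -
        have "s / m * (b' s * a' m) = (s * b' s) * (a' m / m)" by simp
        also have "\<dots> = (1 - ?l) * (\<tau>' s * a' m) * (\<tau> s / m)" unfolding I(3) by simp
        finally show ?thesis .
      qed
      also have "s / m * (b s / m) = (\<tau> s / m)\<^sup>2"
        unfolding power_divide I(4)[symmetric] by (simp add: power2_eq_square)
      also have "form (A x) g ((1 - ?l\<^sup>2) * (\<tau>' s * a' m)\<^sup>2) ((1 + ?l) * (\<tau>' s * a' m) * (\<tau> s / m))
         ((1 - ?l) * (\<tau>' s * a' m) * (\<tau> s / m)) ((\<tau> s / m)\<^sup>2) = Re (Lambda_integrand \<Omega> A \<phi> v x)"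
        using elim(4) vnz gv unfolding cv[symmetric] by simp
      finally show ?thesis .
    qed
  qed
  then have "(LINT x|lebesgue_on \<Omega>. Re (?F x)) = (LINT x|lebesgue_on \<Omega>. Re (Lambda_integrand \<Omega> A \<phi> v x))"
    using Fi Li by (intro integral_cong_AE) auto
  then show "0 \<le> Re (LINT x|lebesgue_on \<Omega>. ?F x)"
    using cond[OF v] integral_Re[OF Fi] integral_Re[OF Li] by simp
qed

lemma form_bound:
  fixes A :: "complex^'n^'n"
  assumes "\<And>i j. norm (A $ i $ j) \<le> M" "M \<ge> 0"
    "\<bar>c11\<bar> \<le> K" "\<bar>c12\<bar> \<le> K" "\<bar>c21\<bar> \<le> K" "\<bar>c22\<bar> \<le> K"
  shows "\<bar>form A g c11 c12 c21 c22\<bar> \<le> 4 * K * ((real CARD('n))\<^sup>2 * M) * (norm g)\<^sup>2"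
proof -
  let ?N = "(real CARD('n))\<^sup>2 * M"
  have N0: "0 \<le> ?N" using assms(2) by simp
  have K0: "0 \<le> K" using assms(3) by linarith
  have s: "norm (sesq A u w) \<le> ?N * (norm g)\<^sup>2" if "norm u \<le> norm g" "norm w \<le> norm g" for u w
    by (rule order_trans[OF norm_sesq_le[OF assms(1,2)]])
      (use that N0 assms(2) in \<open>auto simp: power2_eq_square intro!: mult_left_mono mult_mono\<close>)
  have R: "\<bar>c * Re (sesq A u w)\<bar> \<le> K * (?N * (norm g)\<^sup>2)" "\<bar>c * Im (sesq A u w)\<bar> \<le> K * (?N * (norm g)\<^sup>2)"
    if "\<bar>c\<bar> \<le> K" "norm u \<le> norm g" "norm w \<le> norm g" for c u w
    unfolding abs_mult using that K0
    by (auto intro!: mult_mono order_trans[OF abs_Re_le_cmod s] order_trans[OF abs_Im_le_cmod s])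
  show ?thesis
    using R(1)[OF assms(3) norm_re_vec_le norm_re_vec_le] R(1)[OF assms(6) norm_im_vec_le norm_im_vec_le]
      R(2)[OF assms(4) norm_re_vec_le norm_im_vec_le] R(2)[OF assms(5) norm_im_vec_le norm_re_vec_le]
    unfolding form_def by linarith
qed

lemma form_tendsto:
  assumes "(c11 \<longlongrightarrow> d11) F" "(c12 \<longlongrightarrow> d12) F" "(c21 \<longlongrightarrow> d21) F" "(c22 \<longlongrightarrow> d22) F"
  shows "((\<lambda>n. form A g (c11 n) (c12 n) (c21 n) (c22 n)) \<longlongrightarrow> form A g d11 d12 d21 d22) F"
  unfolding form_def by (intro tendsto_intros assms)

proposition dissipative_imp_Lambda_condition:
  fixes \<Omega> :: "(real^'n) set"
  assumes \<Omega>: "open \<Omega>" and A: "\<And>i j. (\<lambda>x. A x $ i $ j) \<in> Linfty \<Omega>"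
    and diss: "L_Phi_dissipative \<Omega> A \<phi>" and v: "v \<in> H10 \<Omega>"
  shows "Re (LINT x|lebesgue_on \<Omega>. Lambda_integrand \<Omega> A \<phi> v x) \<ge> 0"
proof -
  note U = H10_jetI[OF \<Omega> v]
  let ?G = "weak_grad \<Omega> v"
  have GL: "?G \<in> L2 \<Omega>" using H10_jet_L2[OF U] by (auto simp: L2_Pair_iff)
  note Li = Lambda_integrand_integrable[OF \<Omega> A v]
  obtain M where M: "M \<ge> 0" "AE x in lebesgue_on \<Omega>. \<forall>i j. norm (A x $ i $ j) \<le> M"
    by (rule Linfty_matrix_bound[OF A])
  define u where "u n x = of_real (u_prof (real (Suc n)) (cmod (v x))) * sgn (v x)" for n x
  define w where "w n x = of_real (w_prof (real (Suc n)) (cmod (v x))) * sgn (v x)" for n x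
  have k: "real (Suc n) \<ge> 1" for n by simp
  have b1: "\<bar>u_prof (real (Suc n)) t\<bar> \<le> (2 * real (Suc n)) * t" "\<bar>u_prof' (real (Suc n)) t\<bar> \<le> 2 * real (Suc n)"
    "\<bar>w_prof (real (Suc n)) t\<bar> \<le> (2 * real (Suc n)) * t" "\<bar>w_prof' (real (Suc n)) t\<bar> \<le> 2 * real (Suc n)" if "t > 0" for n t
  proof -
    have "real (Suc n) * t \<ge> 0" using that by simp
    then show "\<bar>u_prof (real (Suc n)) t\<bar> \<le> (2 * real (Suc n)) * t" "\<bar>w_prof (real (Suc n)) t\<bar> \<le> (2 * real (Suc n)) * t"
      using profile_bounds(1-4)[OF k[of n] that] by linarith+
    show "\<bar>u_prof' (real (Suc n)) t\<bar> \<le> 2 * real (Suc n)" "\<bar>w_prof' (real (Suc n)) t\<bar> \<le> 2 * real (Suc n)"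
      using profile_bounds(5,6,10,11)[OF k[of n] that] by linarith+
  qed
  have gu: "u n \<in> H10 \<Omega>"
    "AE x in lebesgue_on \<Omega>. (v x \<noteq> 0 \<longrightarrow> weak_grad \<Omega> (u n) x =
        sgn (v x) *s stretch (u_prof' (real (Suc n)) (cmod (v x))) (u_prof (real (Suc n)) (cmod (v x)) / cmod (v x)) (cnj (sgn (v x)) *s ?G x))
      \<and> (v x = 0 \<longrightarrow> weak_grad \<Omega> (u n) x = 0)" for n
    by (rule radial_gradient[OF \<Omega> U profile_DERIV(1)[OF k] profile_deriv_continuous(1)[OF k] b1(1,2) u_def]; assumption)+
  have gw: "w n \<in> H10 \<Omega>"
    "AE x in lebesgue_on \<Omega>. (v x \<noteq> 0 \<longrightarrow> weak_grad \<Omega> (w n) x =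
        sgn (v x) *s stretch (w_prof' (real (Suc n)) (cmod (v x))) (w_prof (real (Suc n)) (cmod (v x)) / cmod (v x)) (cnj (sgn (v x)) *s ?G x))
      \<and> (v x = 0 \<longrightarrow> weak_grad \<Omega> (w n) x = 0)" for n
    by (rule radial_gradient[OF \<Omega> U profile_DERIV(2)[OF k] profile_deriv_continuous(2)[OF k] b1(3,4) w_def]; assumption)+
  \<comment> \<open>For every positive m, damped or not, \<open>a\<close> splits m into
    \<open>a m\<close> and \<open>m - a m = b (a m)\<close>. So \<open>w n\<close> is exactly the
    multiple of \<open>u n\<close> that dissipativity refers to.\<close>
  have pm: "phi_mult \<phi> (u n) = w n" for n
  proof
    fix x
    show "phi_mult \<phi> (u n) x = w n x"
    proof (cases "v x = 0")
      case True then show ?thesis by (simp add: phi_mult_def u_def w_def)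
    next
      case False
      then have t: "cmod (v x) > 0" and s1: "norm (sgn (v x)) = 1" by (auto simp: norm_sgn)
      let ?f = "u_prof (real (Suc n)) (cmod (v x))"
      have f: "?f > 0" by (rule profile_bounds(1)[OF k t])
      have "b ?f = w_prof (real (Suc n)) (cmod (v x))"
        unfolding u_prof_def w_prof_def by (rule b_a[OF damped_facts(1)[OF k t]])
      moreover have "u n x \<noteq> 0" using f False by (simp add: u_def sgn_zero_iff)
      ultimately show ?thesis
        using radial_phi_mult[OF f s1] by (simp add: phi_mult_def w_def u_def)
    qed
  qed
  let ?F = "\<lambda>n x. herm_inner (A x *v weak_grad \<Omega> (u n) x) (weak_grad \<Omega> (w n) x)"
  have pos: "Re (LINT x|lebesgue_on \<Omega>. ?F n x) \<ge> 0" for n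
  proof -
    have "u n \<in> H10 \<Omega>" by (rule gu(1))
    moreover have "phi_mult \<phi> (u n) \<in> H10 \<Omega>" unfolding pm by (rule gw(1))
    ultimately have "Re (LINT x|lebesgue_on \<Omega>. herm_inner (A x *v weak_grad \<Omega> (u n) x) (weak_grad \<Omega> (phi_mult \<phi> (u n)) x)) \<ge> 0"
      using diss unfolding L_Phi_dissipative_def by blast
    then show ?thesis by (simp only: pm)
  qed
  have L: "weak_grad \<Omega> (u n) \<in> L2 \<Omega>" "weak_grad \<Omega> (w n) \<in> L2 \<Omega>" for n
    using H10_jet_L2[OF H10_jetI[OF \<Omega> gu(1)[of n]]] H10_jet_L2[OF H10_jetI[OF \<Omega> gw(1)[of n]]] by (auto simp: L2_Pair_iff)
  have Fi: "integrable (lebesgue_on \<Omega>) (?F n)" for n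
    using sesq_integrable[OF A L, of "\<lambda>_. 1"] by (simp add: herm_inner_eq_sesq)
  define N where "N = 4 * (4 * key_const\<^sup>2) * ((real CARD('n))\<^sup>2 * M)"
  define c11 c12 c21 c22 where "c11 n t = u_prof' (real (Suc n)) t * w_prof' (real (Suc n)) t"
    and "c12 n t = u_prof' (real (Suc n)) t * (w_prof (real (Suc n)) t / t)"
    and "c21 n t = u_prof (real (Suc n)) t / t * w_prof' (real (Suc n)) t"
    and "c22 n t = u_prof (real (Suc n)) t / t * (w_prof (real (Suc n)) t / t)" for n t
  have F_form: "AE x in lebesgue_on \<Omega>. (v x \<noteq> 0 \<longrightarrow> Re (?F n x) = form (A x) (cnj (sgn (v x)) *s ?G x)
      (c11 n (cmod (v x))) (c12 n (cmod (v x))) (c21 n (cmod (v x))) (c22 n (cmod (v x)))) \<and> (v x = 0 \<longrightarrow> ?F n x = 0)" for n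
    using gu(2)[of n] gw(2)[of n]
  proof eventually_elim
    case (elim x)
    show ?case
    proof (intro conjI impI)
      assume nz: "v x \<noteq> 0"
      then have n1: "norm (sgn (v x)) = 1" by (simp add: norm_sgn)
      show "Re (?F n x) = form (A x) (cnj (sgn (v x)) *s ?G x)
        (c11 n (cmod (v x))) (c12 n (cmod (v x))) (c21 n (cmod (v x))) (c22 n (cmod (v x)))"
        unfolding elim(1)[THEN conjunct1, rule_format, OF nz] elim(2)[THEN conjunct1, rule_format, OF nz]
          herm_inner_eq_sesq sesq_unit_scale[OF n1] Re_sesq_stretch c11_def c12_def c21_def c22_def ..
    next
      assume "v x = 0"
      then show "?F n x = 0" using elim by (simp add: herm_inner_def)
    qed
  qed
  \<comment> \<open>The quotients \<open>y1\<close> and \<open>y2\<close> have product at most 1,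
    and replacing one of them by the corresponding derivative costs a factor
    \<open>2 * key_const\<close>. At most two replacements occur.\<close>
  have cb: "\<bar>c11 n t\<bar> \<le> 4 * key_const\<^sup>2" "\<bar>c12 n t\<bar> \<le> 4 * key_const\<^sup>2" "\<bar>c21 n t\<bar> \<le> 4 * key_const\<^sup>2" "\<bar>c22 n t\<bar> \<le> 4 * key_const\<^sup>2" if t: "t > 0" for n t
  proof -
    note fb = profile_bounds[OF k[of n] t]
    define y1 where "y1 = u_prof (real (Suc n)) t / t"
    define y2 where "y2 = w_prof (real (Suc n)) t / t"
    define x1 where "x1 = u_prof' (real (Suc n)) t"
    define x2 where "x2 = w_prof' (real (Suc n)) t"
    have y: "y1 > 0" "y2 > 0" "y1 * y2 \<le> 1" using fb(1,2,9) t
      by (auto simp: y1_def y2_def power2_eq_square divide_le_eq)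
    have x: "x1 > 0" "x2 > 0" "x1 \<le> 2 * key_const * y1" "x2 \<le> 2 * key_const * y2" using fb(5-8) t
      by (auto simp: x1_def x2_def y1_def y2_def le_divide_eq mult.commute)
    have C1: "key_const \<ge> 1" by (rule key_const_ge_1)
    have CC: "2 * key_const \<le> 4 * key_const\<^sup>2" "1 \<le> 4 * key_const\<^sup>2"
      using C1 mult_mono[OF C1 C1] by (auto simp: power2_eq_square)
    have yy: "D * (y1 * y2) \<le> 4 * key_const\<^sup>2" if "D \<le> 4 * key_const\<^sup>2" "D \<ge> 0" for D
      using mult_left_mono[OF y(3) that(2)] that(1) by simp
    have "x1 * x2 \<le> (2 * key_const * y1) * (2 * key_const * y2)" using x y C1 by (intro mult_mono) auto
    also have "\<dots> = (4 * key_const\<^sup>2) * (y1 * y2)" by (simp add: power2_eq_square)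
    finally have a1: "x1 * x2 \<le> 4 * key_const\<^sup>2" using yy[of "4 * key_const\<^sup>2"] by simp
    have yy2: "2 * key_const * (y1 * y2) \<le> 4 * key_const\<^sup>2" by (rule yy) (use CC C1 in auto)
    have "x1 * y2 \<le> (2 * key_const * y1) * y2" using x y by (intro mult_right_mono) auto
    also have "\<dots> = 2 * key_const * (y1 * y2)" by simp
    also note yy2
    finally have a2: "x1 * y2 \<le> 4 * key_const\<^sup>2" .
    have "y1 * x2 \<le> y1 * (2 * key_const * y2)" using x y by (intro mult_left_mono) auto
    also have "\<dots> = 2 * key_const * (y1 * y2)" by simp
    also note yy2
    finally have a3: "y1 * x2 \<le> 4 * key_const\<^sup>2" .
    have a4: "y1 * y2 \<le> 4 * key_const\<^sup>2" using y(3) CC by simp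
    show "\<bar>c11 n t\<bar> \<le> 4 * key_const\<^sup>2" "\<bar>c12 n t\<bar> \<le> 4 * key_const\<^sup>2" "\<bar>c21 n t\<bar> \<le> 4 * key_const\<^sup>2" "\<bar>c22 n t\<bar> \<le> 4 * key_const\<^sup>2"
      using a1 a2 a3 a4 x(1,2) y(1,2)
      unfolding c11_def c12_def c21_def c22_def y1_def[symmetric] y2_def[symmetric] x1_def[symmetric] x2_def[symmetric]
      by (simp_all add: abs_mult)
  qed
  \<comment> \<open>No convergence of \<open>u n\<close> in the Sobolev space is claimed. The
    uniform bound on the coefficients dominates the integrands by a multiple of the squared gradient
    of v, which suffices.\<close>
  have "(\<lambda>n. LINT x|lebesgue_on \<Omega>. Re (?F n x)) \<longlonglongrightarrow> (LINT x|lebesgue_on \<Omega>. Re (Lambda_integrand \<Omega> A \<phi> v x))"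
  proof (rule integral_dominated_convergence)
    show "(\<lambda>x. Re (Lambda_integrand \<Omega> A \<phi> v x)) \<in> borel_measurable (lebesgue_on \<Omega>)" using Li by auto
    show "(\<lambda>x. Re (?F n x)) \<in> borel_measurable (lebesgue_on \<Omega>)" for n using Fi[of n] by auto
    show "integrable (lebesgue_on \<Omega>) (\<lambda>x. N * (norm (?G x))\<^sup>2)" using L2_integrable[OF GL] by simp
    show "AE x in lebesgue_on \<Omega>. norm (Re (?F n x)) \<le> N * (norm (?G x))\<^sup>2" for n
      using F_form[of n] M(2)
    proof eventually_elim
      case (elim x)
      have N0: "N \<ge> 0" using M(1) by (simp add: N_def)
      show ?case
      proof (cases "v x = 0")
        case True then show ?thesis using elim(1) N0 by simp
      next
        case False
        then have t: "cmod (v x) > 0" and n1: "norm (cnj (sgn (v x))) = 1" by (auto simp: norm_sgn)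
        have "norm (Re (?F n x)) \<le> N * (norm (cnj (sgn (v x)) *s ?G x))\<^sup>2"
          using elim(1) False form_bound[OF _ M(1) cb[OF t], of "A x"] elim(2) by (simp add: N_def)
        then show ?thesis by (simp only: norm_unit_scale[OF n1])
      qed
    qed
    have all: "AE x in lebesgue_on \<Omega>. \<forall>n. (v x \<noteq> 0 \<longrightarrow> Re (?F n x) = form (A x) (cnj (sgn (v x)) *s ?G x)
      (c11 n (cmod (v x))) (c12 n (cmod (v x))) (c21 n (cmod (v x))) (c22 n (cmod (v x)))) \<and> (v x = 0 \<longrightarrow> ?F n x = 0)"
      using F_form by (simp add: AE_all_countable)
    show "AE x in lebesgue_on \<Omega>. (\<lambda>n. Re (?F n x)) \<longlonglongrightarrow> Re (Lambda_integrand \<Omega> A \<phi> v x)"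
      using all Re_Lambda_integrand[OF \<Omega> v, of A]
    proof eventually_elim
      case (elim x)
      show ?case
      proof (cases "v x = 0")
        case True
        then show ?thesis using elim(1) by (simp add: Lambda_integrand_def)
      next
        case False
        define t where "t = cmod (v x)"
        define s where "s = zeta \<phi> t"
        define g where "g = cnj (sgn (v x)) *s ?G x"
        have t: "t > 0" using False by (simp add: t_def)
        have s: "s > 0" "\<tau> s = t" using zeta_props(1,2)[OF t] by (simp_all add: s_def)
        have n1: "norm (sgn (v x)) = 1" using False by (simp add: norm_sgn)
        let ?l = "Lambda \<phi> t"
        note I = Lambda_identities[OF s(1), unfolded s(2)]
        note T = \<tau>'_pos[OF s(1)]
        note lim = profile_limits[OF t, folded s_def]
        \<comment> \<open>Decomposed relative to v itself, both factors are 1, so the coefficients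
          to be reached are 1 - l^2, 1 + l, 1 - l and 1.\<close>
        have "?G x = sgn (v x) *s stretch 1 1 g"
          unfolding stretch_1 g_def unit_scale_cancel[OF n1] ..
        then have lam: "Re (Lambda_integrand \<Omega> A \<phi> v x) = form (A x) g (1 - ?l\<^sup>2) (1 + ?l) (1 - ?l) 1"
          using elim(2)[rule_format, OF False, of 1 1 g] by (simp add: t_def)
        have flim: "(\<lambda>n. form (A x) g (c11 n t) (c12 n t) (c21 n t) (c22 n t)) \<longlonglongrightarrow>
          form (A x) g (1 / \<tau>' s * (b' s / \<tau>' s)) (1 / \<tau>' s * (b s / t)) (s / t * (b' s / \<tau>' s)) (s / t * (b s / t))"
          unfolding c11_def c12_def c21_def c22_def
          using t by (intro form_tendsto tendsto_intros lim) auto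
        have e1: "1 / \<tau>' s * (b' s / \<tau>' s) = 1 - ?l\<^sup>2"
          unfolding I(1) using T by (simp add: power2_eq_square)
        have e2: "1 / \<tau>' s * (b s / t) = 1 + ?l"
          unfolding I(2) using T t by simp
        have e3: "s / t * (b' s / \<tau>' s) = 1 - ?l"
        proof -
          have "s / t * (b' s / \<tau>' s) = (s * b' s) / (\<tau>' s * t)" by (simp add: mult.commute)
          then show ?thesis unfolding I(3) using T t by simp
        qed
        have e4: "s / t * (b s / t) = 1"
        proof -
          have eq: "s / t * (b s / t) = (s * b s) / t\<^sup>2" by (simp add: power2_eq_square)
          show ?thesis unfolding eq I(4) using t by simp
        qed
        have F: "Re (?F n x) = form (A x) g (c11 n t) (c12 n t) (c21 n t) (c22 n t)" for n
          using elim(1) False by (simp add: g_def t_def)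
        show ?thesis unfolding F lam using flim unfolding e1 e2 e3 e4 .
      qed
    qed
  qed
  moreover have "(LINT x|lebesgue_on \<Omega>. Re (?F n x)) \<ge> 0" for n
    using pos[of n] integral_Re[OF Fi[of n]] by simp
  ultimately have "(LINT x|lebesgue_on \<Omega>. Re (Lambda_integrand \<Omega> A \<phi> v x)) \<ge> 0"
    by (intro LIMSEQ_le_const) auto
  then show ?thesis using integral_Re[OF Li] by simp
qed

end

theorem lemma5:
  fixes \<Omega> :: "(real^'n) set"
    and A :: "real^'n \<Rightarrow> complex^'n^'n"
    and \<phi> :: "real \<Rightarrow> real"
  assumes "domain \<Omega>"
    and "\<And>i j. (\<lambda>x. A x $ i $ j) \<in> Linfty \<Omega>"
    and "phi_conditions \<phi>"
  shows "L_Phi_dissipative \<Omega> A \<phi> \<longleftrightarrow>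
    (\<forall>v\<in>H10 \<Omega>. Re (LINT x|lebesgue_on \<Omega>. Lambda_integrand \<Omega> A \<phi> v x) \<ge> 0)"
proof -
  interpret phi_function \<phi> by unfold_locales (rule assms(3))
  have "open \<Omega>" using assms(1) by (simp add: domain_def)
  with assms(2) show ?thesis
    using Lambda_condition_imp_dissipative[of \<Omega> A] dissipative_imp_Lambda_condition[of \<Omega> A] by blast
qed

end
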